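(* There exists $\delta>0$ so that for every solution $q(t)=\Phi(t,q(0))$ to the Korteweg--de Vries equation $\frac{d}{dt}q=-q'''+6qq'$ on the line with initial data $q(0)\in H^{-1}(\mathbb{R})$ satisfying $\|q(0)\|_{H^{-1}(\mathbb{R})}\leq\delta$, $$\sup_{t_0,x_0\in\mathbb{R}}\ \int_0^1\!\!\int_0^1|q(t-t_0,x-x_0)|^2\,dx\,dt\leq C\,\delta^2,$$ where $C$ is an absolute constant.
   Context: All functions and distributions are real-valued; primes denote $\partial_x$. $\|f\|_{H^{-1}(\mathbb{R})}^2=\int_{\mathbb{R}}\frac{|\hat f(\xi)|^2}{\xi^2+4}\,d\xi$, with $\hat f(\xi)=\frac1{\sqrt{2\pi}}\int e^{-i\xi x}f(x)\,dx$. For Schwartz initial data $q_0\in\mathcal S(\mathbb{R})$ the KdV equation has a unique global Schwartz solution (known fact); the solution map $(t,q_0)\mapsto q(t)$ on $\mathbb{R}\times\mathcal S(\mathbb{R})$ extends uniquely to a jointly continuous map $\Phi:\mathbb{R}\times H^{-1}(\mathbb{R})\to H^{-1}(\mathbb{R})$, and "solution" means $t\mapsto\Phi(t,q(0))$. The integral is understood as the squared $L^2$-norm of the space-time distribution $q$ over the indicated region. *)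

theory Defs
  imports "HOL-Analysis.Analysis"
begin

section \<open>Schwartz functions and tempered distributions on the line\<close>

definition schwartz :: "(real \<Rightarrow> real) \<Rightarrow> bool" where
  "schwartz f \<longleftrightarrow>
     (\<forall>n x. (deriv ^^ n) f differentiable (at x)) \<and>
     (\<forall>k n. bounded (range (\<lambda>x. x ^ k * (deriv ^^ n) f x)))"

definition schwartz_seminorm :: "nat \<Rightarrow> nat \<Rightarrow> (real \<Rightarrow> real) \<Rightarrow> real" where
  "schwartz_seminorm k n f = (SUP x. \<bar>x ^ k * (deriv ^^ n) f x\<bar>)"

text \<open>A distribution is a total function on \<open>real \<Rightarrow> real\<close>; it is normalized to vanish on arguments
  that are not Schwartz functions, so that equality of distributions is equality in HOL.\<close>

type_synonym distribution = "(real \<Rightarrow> real) \<Rightarrow> real"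

definition tempered :: "distribution \<Rightarrow> bool" where
  "tempered T \<longleftrightarrow>
     (\<forall>\<phi> \<psi>. schwartz \<phi> \<longrightarrow> schwartz \<psi> \<longrightarrow> T (\<lambda>x. \<phi> x + \<psi> x) = T \<phi> + T \<psi>) \<and>
     (\<forall>c \<phi>. schwartz \<phi> \<longrightarrow> T (\<lambda>x. c * \<phi> x) = c * T \<phi>) \<and>
     (\<exists>A N. \<forall>\<phi>. schwartz \<phi> \<longrightarrow> \<bar>T \<phi>\<bar> \<le> A * (\<Sum>k\<le>N. \<Sum>n\<le>N. schwartz_seminorm k n \<phi>)) \<and>
     (\<forall>\<phi>. \<not> schwartz \<phi> \<longrightarrow> T \<phi> = 0)"

definition distribution_of :: "(real \<Rightarrow> real) \<Rightarrow> distribution" where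
  "distribution_of f = (\<lambda>\<phi>. if schwartz \<phi> then (LINT x|lborel. f x * \<phi> x) else 0)"

text \<open>The distribution \<open>T(x - x0)\<close>.\<close>

definition translate :: "real \<Rightarrow> distribution \<Rightarrow> distribution" where
  "translate x0 T = (\<lambda>\<phi>. T (\<lambda>x. \<phi> (x + x0)))"


section \<open>The space $H^{-1}(\mathbb R)$\<close>

definition fourier :: "(real \<Rightarrow> real) \<Rightarrow> real \<Rightarrow> complex" where
  "fourier f \<xi> = (1 / sqrt (2 * pi)) *\<^sub>R
     (LINT x|lborel. exp (- (\<i> * complex_of_real \<xi> * complex_of_real x)) * complex_of_real (f x))"

text \<open>The Fourier transform of a distribution is defined by duality, \<open>\<langle>FT, \<phi>\<rangle> = \<langle>T, F\<phi>\<rangle>\<close>, where the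
  real functional \<open>T\<close> is extended complex-linearly to the complex-valued function \<open>F\<phi>\<close>.
  Real-valued \<open>\<phi>\<close> suffice by complex linearity. The predicate says that this distribution is the
  function \<open>g\<close>, with finite weighted norm; \<open>g\<close> is then unique almost everywhere.\<close>

definition Hm1_fourier :: "distribution \<Rightarrow> (real \<Rightarrow> complex) \<Rightarrow> bool" where
  "Hm1_fourier T g \<longleftrightarrow>
     g \<in> borel_measurable borel \<and>
     integrable lborel (\<lambda>\<xi>. (cmod (g \<xi>))\<^sup>2 / (\<xi>\<^sup>2 + 4)) \<and>
     (\<forall>\<phi>. schwartz \<phi> \<longrightarrow>
        Complex (T (\<lambda>\<xi>. Re (fourier \<phi> \<xi>))) (T (\<lambda>\<xi>. Im (fourier \<phi> \<xi>)))
          = (LINT \<xi>|lborel. g \<xi> * complex_of_real (\<phi> \<xi>)))"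

definition Hm1 :: "distribution set" where
  "Hm1 = {T. tempered T \<and> (\<exists>g. Hm1_fourier T g)}"

definition Hm1_norm :: "distribution \<Rightarrow> real" where
  "Hm1_norm T = sqrt (LINT \<xi>|lborel. (cmod ((SOME g. Hm1_fourier T g) \<xi>))\<^sup>2 / (\<xi>\<^sup>2 + 4))"


section \<open>The KdV flow\<close>

text \<open>The time derivative is that of a curve in the Schwartz space, i.e. difference quotients
  converge in every seminorm. The first argument of \<open>u\<close> is time.\<close>

definition schwartz_KdV_solution :: "(real \<Rightarrow> real \<Rightarrow> real) \<Rightarrow> bool" where
  "schwartz_KdV_solution u \<longleftrightarrow>
     (\<forall>t. schwartz (u t)) \<and>
     (\<forall>t k n. ((\<lambda>s. schwartz_seminorm k n (\<lambda>x. (u s x - u t x) / (s - t)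
         - (- (deriv ^^ 3) (u t) x + 6 * u t x * deriv (u t) x))) \<longlongrightarrow> 0) (at t))"

text \<open>\<open>\<Phi>\<close> is the jointly continuous extension to \<open>\<real> \<times> H\<^sup>-\<^sup>1\<close> of the solution map on Schwartz data.
  Its values outside \<open>Hm1\<close> are irrelevant.\<close>

definition KdV_flow :: "(real \<Rightarrow> distribution \<Rightarrow> distribution) \<Rightarrow> bool" where
  "KdV_flow \<Phi> \<longleftrightarrow>
     (\<forall>t. \<forall>f\<in>Hm1. \<Phi> t f \<in> Hm1) \<and>
     (\<forall>t. \<forall>f\<in>Hm1. \<forall>\<epsilon>>0. \<exists>\<eta>>0. \<forall>s. \<forall>g\<in>Hm1.
        \<bar>s - t\<bar> < \<eta> \<longrightarrow> Hm1_norm (\<lambda>\<phi>. g \<phi> - f \<phi>) < \<eta> \<longrightarrow>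
        Hm1_norm (\<lambda>\<phi>. \<Phi> s g \<phi> - \<Phi> t f \<phi>) < \<epsilon>) \<and>
     (\<forall>f. schwartz f \<longrightarrow>
        (\<exists>u. schwartz_KdV_solution u \<and> u 0 = f \<and>
             (\<forall>t. \<Phi> t (distribution_of f) = distribution_of (u t))))"

definition KdV_solution :: "(real \<Rightarrow> distribution) \<Rightarrow> bool" where
  "KdV_solution q \<longleftrightarrow> q 0 \<in> Hm1 \<and> (\<exists>\<Phi>. KdV_flow \<Phi> \<and> (\<forall>t. q t = \<Phi> t (q 0)))"


section \<open>Square integrability of space-time distributions\<close>

fun times_differentiable :: "nat \<Rightarrow> ('a::real_normed_vector \<Rightarrow> real) \<Rightarrow> bool" where
  "times_differentiable 0 f \<longleftrightarrow> continuous_on UNIV f"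
| "times_differentiable (Suc n) f \<longleftrightarrow> (\<forall>x. f differentiable (at x)) \<and>
     (\<forall>v. times_differentiable n (\<lambda>x. frechet_derivative f (at x) v))"

definition test_function :: "(real \<times> real) set \<Rightarrow> (real \<times> real \<Rightarrow> real) \<Rightarrow> bool" where
  "test_function \<Omega> \<psi> \<longleftrightarrow> (\<forall>n. times_differentiable n \<psi>) \<and>
     (\<exists>K. compact K \<and> K \<subseteq> \<Omega> \<and> (\<forall>z. z \<notin> K \<longrightarrow> \<psi> z = 0))"

text \<open>The action on a test function of the space-time distribution given by a curve of
  distributions; points of space-time are pairs (time, position).\<close>

definition spacetime_pairing :: "(real \<Rightarrow> distribution) \<Rightarrow> (real \<times> real \<Rightarrow> real) \<Rightarrow> real" where
  "spacetime_pairing q \<psi> = (LINT t|lborel. q t (\<lambda>x. \<psi> (t, x)))"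

text \<open>\<open>F\<close> is unique almost everywhere on the open set \<open>\<Omega>\<close>, so the infimum below is over at most one
  value; it is \<open>\<infinity>\<close> if the restriction of the distribution to \<open>\<Omega>\<close> is not in \<open>L\<^sup>2(\<Omega>)\<close>.\<close>

definition is_L2_function_on ::
    "(real \<times> real) set \<Rightarrow> (real \<Rightarrow> distribution) \<Rightarrow> (real \<times> real \<Rightarrow> real) \<Rightarrow> bool" where
  "is_L2_function_on \<Omega> q F \<longleftrightarrow>
     F \<in> borel_measurable borel \<and>
     set_integrable lborel \<Omega> (\<lambda>z. (F z)\<^sup>2) \<and>
     (\<forall>\<psi>. test_function \<Omega> \<psi> \<longrightarrow> spacetime_pairing q \<psi> = (LINT z:\<Omega>|lborel. F z * \<psi> z))"

definition spacetime_L2_sq :: "(real \<times> real) set \<Rightarrow> (real \<Rightarrow> distribution) \<Rightarrow> ennreal" where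
  "spacetime_L2_sq \<Omega> q =
     (INF F\<in>{F. is_L2_function_on \<Omega> q F}. \<integral>\<^sup>+ z\<in>\<Omega>. ennreal ((F z)\<^sup>2) \<partial>lborel)"

end

theory Submission
  imports Defs "HOL-Probability.Characteristic_Functions"
begin

text \<open>
  The reason is that, with \<open>\<kappa> = 1\<close>, the Gardner (Riccati) substitution \<open>u = w' + 2 w + w\<^sup>2\<close> turns
  a solution \<open>u\<close> of KdV into a solution \<open>w\<close> of the equation
  \<open>w\<^sub>t = - w''' + 6 w\<^sup>2 w' + 12 w w'\<close>. The linear part of the substitution is an isometry: if
  \<open>u = h' + 2 h\<close>, then the norm of \<open>u\<close> in \<open>H\<^sup>-\<^sup>1\<close> (whose weight is \<open>\<xi>\<^sup>2 + 4 = |2 + i \<xi>|\<^sup>2\<close>) is the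
  \<open>L\<^sup>2\<close> norm of \<open>h\<close>. So small data in \<open>H\<^sup>-\<^sup>1\<close> correspond to small \<open>w\<close> in \<open>L\<^sup>2\<close>, and the question about
  \<open>u\<close> becomes Kato's local smoothing effect for \<open>w\<close> at the level of \<open>L\<^sup>2\<close>. For every weight \<open>\<phi>\<close>,
    \<open>d/dt \<integral> \<phi> w\<^sup>2 = - 3 \<integral> \<phi>' (w')\<^sup>2 + \<integral> \<phi>''' w\<^sup>2 - 3 \<integral> \<phi>' w\<^sup>4 - 8 \<integral> \<phi>' w\<^sup>3\<close>.
  With \<open>\<phi> = 1\<close> this says that \<open>\<integral> w\<^sup>2\<close> is conserved. With \<open>\<phi>\<close> increasing and bounded
  (\<open>\<phi> = arctan (x - x\<^sub>0)\<close>) the quartic term has the good sign and absorbs the cubic one, so the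
  time integral of \<open>\<integral> \<phi>' ((w')\<^sup>2 + w\<^sup>4)\<close> over a unit interval is controlled by \<open>\<integral> w\<^sup>2\<close>, and
  \<open>u\<^sup>2 \<le> 3 ((w')\<^sup>2 + 4 w\<^sup>2 + w\<^sup>4)\<close>.

  For Schwartz solutions \<open>w\<close> is constructed at each time separately: \<open>w = h - y\<close>, where \<open>y\<close> is
  the fixed point of a contraction as soon as \<open>\<integral> h\<^sup>2 \<le> 1/64\<close> (\<open>riccati_solution\<close>). Integrating the
  equation for \<open>y\<close> gives \<open>2 \<integral> y = \<integral> w\<^sup>2\<close>, hence \<open>\<integral> w\<^sup>2\<close> and \<open>\<integral> h\<^sup>2\<close> are comparable; together with
  the conservation of \<open>\<integral> w\<^sup>2\<close> and the continuity of \<open>\<integral> h\<^sup>2\<close> in time this keeps \<open>h\<close> small forever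
  (\<open>global_bound\<close>). A difference quotient of \<open>w\<close> in time solves a first-order linear equation in
  space, so its convergence follows from that of the difference quotients of \<open>u\<close> (\<open>wdiff_w\<close>).
  All functions built from \<open>u\<close> and \<open>w\<close> are dominated by multiples of \<open>om x = 1 / (4 + x\<^sup>2)\<close>, which is what allows
  differentiation under the integral and integration by parts without boundary terms.

  General data are limits in \<open>H\<^sup>-\<^sup>1\<close> of functions \<open>h' + 2 h\<close> with \<open>h\<close> Schwartz (\<open>Hm1_density\<close>, which
  rests on Fourier inversion and on the density of Schwartz functions in \<open>L\<^sup>2\<close>). By continuity of
  the flow the approximating classical solutions converge at each time when tested against Schwartz
  functions (\<open>Hm1_pairing_bound\<close>), hence as space-time distributions; since they are bounded in \<open>L\<^sup>2\<close>
  of the unit square, so is the limit (\<open>weak_limit_L2\<close>).\<close>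

section \<open>A decaying weight\<close>

text \<open>The weight that measures spatial decay. The \<open>4\<close> makes \<open>om\<close> vary slowly, \<open>|om'| \<le> om / 2\<close>,
  so that \<open>om\<close> is a supersolution of the equations \<open>Y' + k Y = om\<close> with \<open>k \<ge> 1\<close> up to a factor \<open>2\<close>;
  \<open>1 / (1 + x\<^sup>2)\<close> would not be one.\<close>

definition om :: "real \<Rightarrow> real" where "om x = 1 / (4 + x\<^sup>2)"

lemma om_pos: "0 < om x" by (simp add: om_def add_pos_nonneg)
lemma om_le: "om x \<le> 1/4" by (simp add: om_def field_simps add_pos_nonneg)
lemma om_sq_le: "(om x)\<^sup>2 \<le> om x / 4"
  using mult_left_mono[OF om_le[of x], of "om x"] om_pos[of x] by (simp add: power2_eq_square)
lemma om_cont [continuous_intros]: "continuous_on A om"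
  unfolding om_def by (intro continuous_intros) (simp add: add_nonneg_eq_0_iff)
lemma integrable_exp_atMost:
  fixes c x :: real assumes "0 < c"
  shows "set_integrable lborel {..x} (\<lambda>s. exp (c * s))"
    and "(LINT s:{..x}|lborel. exp (c * s)) = exp (c * x) / c"
proof -
  have 1: "((\<lambda>s. exp (c * s) / c) has_real_derivative exp (c * s)) (at s)" for s
    using assms by (auto intro!: derivative_eq_intros)
  have "((\<lambda>s. exp (c * s) / c) \<longlongrightarrow> 0 / c) at_bot"
    using assms
    by (intro tendsto_divide tendsto_const filterlim_compose[OF exp_at_bot]
      filterlim_tendsto_pos_mult_at_bot[OF tendsto_const _ filterlim_ident]) auto
  then have 2: "(((\<lambda>s. exp (c * s) / c) \<circ> real_of_ereal) \<longlongrightarrow> 0) (at_right (-\<infinity>))"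
    by (simp add: ereal_tendsto_simps)
  have 3: "(((\<lambda>s. exp (c * s) / c) \<circ> real_of_ereal) \<longlongrightarrow> exp (c * x) / c) (at_left (ereal x))"
    unfolding ereal_tendsto_simps using assms by (intro tendsto_intros) auto
  have *: "set_integrable lborel (einterval (-\<infinity>) (ereal x)) (\<lambda>s. exp (c * s))"
    "(LBINT s=-\<infinity>..ereal x. exp (c * s)) = exp (c * x) / c - 0"
    using interval_integral_FTC_nonneg[of "-\<infinity>" "ereal x" "\<lambda>s. exp (c * s) / c" "\<lambda>s. exp (c * s)", OF _ 1 _ _ 2 3]
    by auto
  have e: "einterval (-\<infinity>) (ereal x) = {..<x}" by (auto simp: einterval_def)
  have ae: "AE s in lborel. (s \<in> {..<x}) = (s \<in> {..x})"
    by (rule AE_mp[OF AE_lborel_singleton[of x]]) (auto intro!: AE_I2)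
  show "set_integrable lborel {..x} (\<lambda>s. exp (c * s))"
    unfolding set_integrable_def
    by (rule integrable_cong_AE_imp[OF *(1)[unfolded e set_integrable_def]])
       (use ae in \<open>auto elim!: eventually_mono simp: indicator_def\<close>)
  show "(LINT s:{..x}|lborel. exp (c * s)) = exp (c * x) / c"
  proof -
    have "(LINT s:{..x}|lborel. exp (c * s)) = (LINT s:{..<x}|lborel. exp (c * s))"
      by (rule set_integral_cong_set) (use ae in \<open>auto simp: set_borel_measurable_def elim!: eventually_mono\<close>)
    then show ?thesis using *(2) by (simp add: interval_lebesgue_integral_def e)
  qed
qed

lemma om_integrable: "integrable lborel om" and om_integral: "(LINT x|lborel. om x) = pi / 2"
proof -
  have 1: "((\<lambda>s. arctan (s/2) / 2) has_real_derivative om s) (at s)" for s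
    by (auto intro!: derivative_eq_intros simp: om_def divide_simps power2_eq_square)
  have l: "((\<lambda>s::real. arctan (1/2 * s) / 2) \<longlongrightarrow> (-(pi/2)) / 2) at_bot"
    by (intro tendsto_divide tendsto_const filterlim_compose[OF tendsto_arctan_at_bot]
      filterlim_tendsto_pos_mult_at_bot[OF tendsto_const _ filterlim_ident]) auto
  have r: "((\<lambda>s::real. arctan (1/2 * s) / 2) \<longlongrightarrow> (pi/2) / 2) at_top"
    by (intro tendsto_divide tendsto_const filterlim_compose[OF tendsto_arctan_at_top]
      filterlim_tendsto_pos_mult_at_top[OF tendsto_const _ filterlim_ident]) auto
  have c: "isCont om x" for x using om_cont[of UNIV] by (simp add: continuous_on_eq_continuous_at)
  have *: "set_integrable lborel (einterval (-\<infinity>) \<infinity>) om"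
    "(LBINT s=-\<infinity>..\<infinity>. om s) = (pi/2) / 2 - (-(pi/2)) / 2"
    using interval_integral_FTC_nonneg[of "-\<infinity>" "\<infinity>" "\<lambda>s. arctan (s/2) / 2" om "(-(pi/2)) / 2" "(pi/2) / 2"]
      1 c l r om_pos by (auto simp: ereal_tendsto_simps less_imp_le)
  show "integrable lborel om" "(LINT x|lborel. om x) = pi / 2"
    using * by (auto simp: interval_lebesgue_integral_def set_lebesgue_integral_def set_integrable_def einterval_def)
qed

lemma has_real_derivative_integral_atMost:
  fixes f :: "real \<Rightarrow> real"
  assumes c: "continuous_on UNIV f" and i: "\<And>x. set_integrable lborel {..x} f"
  shows "((\<lambda>x. LINT s:{..x}|lborel. f s) has_real_derivative f x) (at x)"
proof -
  define a where "a = x - 1"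
  have eq: "(LINT s:{..y}|lborel. f s) = (LINT s:{..a}|lborel. f s) + integral {a..y} f"
    if "a \<le> y" for y
  proof -
    have s: "set_integrable lborel {a<..y} f" "set_integrable lborel {a..y} f"
      by (rule set_integrable_subset[OF i[of y]]; auto)+
    have "{..y} = {..a} \<union> {a<..y}" using that by auto
    then have "(LINT s:{..y}|lborel. f s) = (LINT s:{..a}|lborel. f s) + (LINT s:{a<..y}|lborel. f s)"
      using set_integral_Un[OF _ i[of a] s(1)] by (simp add: disjoint_iff)
    also have "(LINT s:{a<..y}|lborel. f s) = (LINT s:{a..y}|lborel. f s)"
      by (rule set_integral_cong_set)
        (use s AE_lborel_singleton[of a] in \<open>auto simp: set_integrable_def set_borel_measurable_def\<close>)
    also have "\<dots> = integral {a..y} f" by (rule set_borel_integral_eq_integral(2)[OF s(2)])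
    finally show ?thesis .
  qed
  have "((\<lambda>y. integral {a..y} f) has_real_derivative f x) (at x within {a..x+1})"
    by (rule integral_has_real_derivative) (use c in \<open>auto simp: a_def intro: continuous_on_subset\<close>)
  then have "((\<lambda>y. integral {a..y} f) has_real_derivative f x) (at x)"
    using at_within_interior[of x "{a..x+1}"] by (simp add: a_def)
  then have "((\<lambda>y. (LINT s:{..a}|lborel. f s) + integral {a..y} f) has_real_derivative f x) (at x)"
    by (auto intro!: derivative_eq_intros)
  then show ?thesis
    by (rule has_field_derivative_transform_within_open[where S="{a<..}"])
      (simp_all add: eq[symmetric], simp add: a_def)
qed

section \<open>The resolvent\<close>

text \<open>The solution operator of \<open>Y' + 2 Y = f\<close> that selects the solution bounded at \<open>-\<infinity>\<close>.\<close>

definition resolvent :: "(real \<Rightarrow> real) \<Rightarrow> real \<Rightarrow> real" where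
  "resolvent f x = exp (- 2 * x) * (LINT s:{..x}|lborel. exp (2 * s) * f s)"

text \<open>Splitting a bound into a constant and an integrable part serves two purposes: the constant part
  gives the sup bound, and by \<open>2 |h| \<le> 1/4 + 4 h\<^sup>2\<close> the integrable part turns smallness of \<open>h\<close> in
  \<open>L\<^sup>2\<close> into smallness of the resolvent in the sup norm.\<close>

lemma resolvent_integrable:
  fixes f g :: "real \<Rightarrow> real"
  assumes c: "continuous_on UNIV f" and b: "\<And>s. \<bar>f s\<bar> \<le> \<alpha> + \<beta> * g s" and g: "integrable lborel g" "\<And>s. 0 \<le> g s"
    and ab: "0 \<le> \<alpha>" "0 \<le> \<beta>"
  shows "set_integrable lborel {..x} (\<lambda>s. exp (2 * s) * f s)"
    and "\<bar>resolvent f x\<bar> \<le> \<alpha> / 2 + \<beta> * (LINT s|lborel. g s)"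
proof -
  have e: "set_integrable lborel {..x} (\<lambda>s. exp (2 * s))" for x::real
    by (rule integrable_exp_atMost) simp
  have gi: "set_integrable lborel {..x} g"
    unfolding set_integrable_def by (rule integrable_mult_indicator) (use g in auto)
  have m: "set_integrable lborel {..x} (\<lambda>s. \<alpha> * exp (2 * s) + \<beta> * exp (2 * x) * g s)"
    by (intro set_integral_add(1) set_integrable_mult_right e gi)
  have le: "\<bar>exp (2 * s) * f s\<bar> \<le> \<alpha> * exp (2 * s) + \<beta> * exp (2 * x) * g s" if "s \<le> x" for s
  proof -
    have "\<bar>exp (2 * s) * f s\<bar> \<le> exp (2 * s) * (\<alpha> + \<beta> * g s)" using b[of s] by (simp add: abs_mult)
    also have "\<dots> \<le> \<alpha> * exp (2 * s) + \<beta> * exp (2 * x) * g s"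
      using that ab g(2)[of s] by (simp add: algebra_simps mult_mono mult_left_mono)
    finally show ?thesis .
  qed
  show i: "set_integrable lborel {..x} (\<lambda>s. exp (2 * s) * f s)"
  proof (rule set_integrable_bound[OF m])
    have "(\<lambda>s. exp (2 * s) * f s) \<in> borel_measurable borel"
      by (intro borel_measurable_continuous_onI continuous_intros c)
    then show "set_borel_measurable lborel {..x} (\<lambda>s. exp (2 * s) * f s)" 
      by (auto simp: set_borel_measurable_def)
    show "AE s in lborel. s \<in> {..x} \<longrightarrow> norm (exp (2 * s) * f s) \<le> norm (\<alpha> * exp (2 * s) + \<beta> * exp (2 * x) * g s)"
    proof (intro AE_I2 impI)
      fix s assume "s \<in> {..x}"
      then show "norm (exp (2 * s) * f s) \<le> norm (\<alpha> * exp (2 * s) + \<beta> * exp (2 * x) * g s)"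
        using le[of s] by auto
    qed
  qed
  have "\<bar>LINT s:{..x}|lborel. exp (2 * s) * f s\<bar> \<le> (LINT s:{..x}|lborel. \<bar>exp (2 * s) * f s\<bar>)"
    using set_integral_norm_bound[OF i] by simp
  also have "\<dots> \<le> (LINT s:{..x}|lborel. \<alpha> * exp (2 * s) + \<beta> * exp (2 * x) * g s)"
    by (rule set_integral_mono[OF _ m]) (use i le in \<open>auto intro: set_integrable_abs\<close>)
  also have "\<dots> = \<alpha> * (exp (2*x)/2) + \<beta> * exp (2*x) * (LINT s:{..x}|lborel. g s)"
    using e gi by (subst set_integral_add(2)) (auto intro!: set_integrable_mult_right simp: integrable_exp_atMost)
  also have "\<dots> \<le> \<alpha> * (exp (2*x)/2) + \<beta> * exp (2*x) * (LINT s|lborel. g s)"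
  proof -
    have "(LINT s:{..x}|lborel. g s) \<le> (LINT s|lborel. g s)"
      unfolding set_lebesgue_integral_def
      by (rule integral_mono[OF gi[unfolded set_integrable_def] g(1)]) (auto simp: indicator_def g(2))
    then show ?thesis using ab by (simp add: mult_left_mono)
  qed
  also have "\<dots> = exp (2*x) * (\<alpha> / 2 + \<beta> * (LINT s|lborel. g s))" by (simp add: algebra_simps)
  finally have "\<bar>resolvent f x\<bar> \<le> exp (-2*x) * (exp (2*x) * (\<alpha> / 2 + \<beta> * (LINT s|lborel. g s)))"
    unfolding resolvent_def abs_mult by (simp add: mult_left_mono)
  also have "\<dots> = \<alpha> / 2 + \<beta> * (LINT s|lborel. g s)" by (simp flip: mult.assoc exp_add)
  finally
 show "\<bar>resolvent f x\<bar> \<le> \<alpha> / 2 + \<beta> * (LINT s|lborel. g s)" .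
qed

lemma resolvent_deriv:
  fixes f :: "real \<Rightarrow> real"
  assumes c: "continuous_on UNIV f" and i: "\<And>x. set_integrable lborel {..x} (\<lambda>s. exp (2 * s) * f s)"
  shows "(resolvent f has_real_derivative (f x - 2 * resolvent f x)) (at x)"
proof -
  have "((\<lambda>x. LINT s:{..x}|lborel. exp (2 * s) * f s) has_real_derivative (exp (2 * x) * f x)) (at x)"
    by (rule has_real_derivative_integral_atMost) (use c i in \<open>auto intro!: continuous_intros\<close>)
  then show ?thesis unfolding resolvent_def[abs_def]
    by (auto intro!: derivative_eq_intros simp: algebra_simps mult_exp_exp simp flip: exp_add)
qed

lemma resolvent_deriv_bdd:
  fixes f :: "real \<Rightarrow> real"
  assumes c: "continuous_on UNIV f" and b: "\<And>s. \<bar>f s\<bar> \<le> B"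
  shows "(resolvent f has_real_derivative (f x - 2 * resolvent f x)) (at x)" "\<bar>resolvent f x\<bar> \<le> B / 2"
proof -
  have "0 \<le> B" using b[of 0] by linarith
  then show "(resolvent f has_real_derivative (f x - 2 * resolvent f x)) (at x)" 
    using resolvent_integrable(1)[OF c, of B 0 "\<lambda>_. 0"] b by (intro resolvent_deriv c) auto
  show "\<bar>resolvent f x\<bar> \<le> B / 2"
    using resolvent_integrable(2)[OF c, of B 0 "\<lambda>_. 0"] b \<open>0 \<le> B\<close> by simp
qed

lemma resolvent_diff:
  fixes f g :: "real \<Rightarrow> real"
  assumes "\<And>x. set_integrable lborel {..x} (\<lambda>s. exp (2 * s) * f s)" "\<And>x. set_integrable lborel {..x} (\<lambda>s. exp (2 * s) * g s)"
  shows "resolvent (\<lambda>x. f x - g x) x = resolvent f x - resolvent g x"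
proof -
  have "(\<lambda>s. exp (2 * s) * (f s - g s)) = (\<lambda>s. exp (2 * s) * f s - exp (2 * s) * g s)"
    by (simp add: right_diff_distrib)
  then show ?thesis unfolding resolvent_def by (simp only: set_integral_diff(2)[OF assms] right_diff_distrib)
qed

lemma resolvent_nonneg:
  assumes "\<And>s. 0 \<le> f s" shows "0 \<le> resolvent f x"
proof -
  have "0 \<le> (LINT s:{..x}|lborel. exp (2 * s) * f s)"
    unfolding set_lebesgue_integral_def
    by (rule Bochner_Integration.integral_nonneg) (simp add: assms)
  then show ?thesis unfolding resolvent_def by simp
qed

section \<open>Linear comparison\<close>

lemma om_deriv: "(om has_real_derivative (- 2 * x * (om x)\<^sup>2)) (at x)"
proof -
  have "4 + x\<^sup>2 > 0" by (simp add: add_pos_nonneg)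
  then show ?thesis unfolding om_def[abs_def]
   by (auto intro!: derivative_eq_intros simp: power2_eq_square)
qed
lemma om_deriv_bound: "\<bar>2 * x * (om x)\<^sup>2\<bar> \<le> om x / 2"
proof -
  have p: "4 + x\<^sup>2 > 0" by (simp add: add_pos_nonneg)
  have "4 * \<bar>x\<bar> \<le> 4 + x\<^sup>2" using zero_le_power2[of "\<bar>x\<bar> - 2"] by (simp add: power2_diff)
  then have "4 * \<bar>x\<bar> * om x \<le> 1" using p by (simp add: om_def divide_le_eq)
  from mult_right_mono[OF this, of "om x / 2"] om_pos[of x] show ?thesis
    by (simp add: abs_mult power2_eq_square algebra_simps)
qed

text \<open>The function \<open>exp (k x) (Y - 2 A om)\<close> is decreasing, because \<open>2 A om\<close> is a supersolution, and it
  is at most \<open>0\<close> in the limit at \<open>-\<infinity>\<close>, because \<open>Y\<close> is bounded above. So upper bounds for \<open>Y\<close> inherit the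
  decay of the right-hand side.\<close>

lemma comparison_upper:
  fixes Y Y' :: "real \<Rightarrow> real"
  assumes d: "\<And>x. (Y has_real_derivative Y' x) (at x)" and le: "\<And>x. Y' x \<le> A * om x - k * Y x"
    and k: "1 \<le> k" and A: "0 \<le> A" and B: "\<And>x. Y x \<le> B"
  shows "Y x \<le> 2 * A * om x"
proof -
  define F where "F x = exp (k * x) * (Y x - 2 * A * om x)" for x
  define F' where "F' x = exp (k * x) * (k * (Y x - 2 * A * om x) + (Y' x - 2 * A * (- 2 * x * (om x)\<^sup>2)))" for x
  have dF: "(F has_real_derivative F' x) (at x)" for x
    unfolding F_def[abs_def] F'_def
    by (rule derivative_eq_intros d om_deriv refl)+ (simp add: algebra_simps)
  have F'le: "F' x \<le> 0" for x
  proof -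
    have 1: "4 * A * (x * (om x)\<^sup>2) \<le> A * om x"
      using mult_left_mono[OF om_deriv_bound[of x] A] mult_left_mono[OF abs_ge_self[of "2 * x * (om x)\<^sup>2"] A] by (simp add: algebra_simps) 
    have 2: "A * om x \<le> k * (A * om x)" using mult_right_mono[OF k, of "A * om x"] A om_pos[of x] by simp
    have "k * (Y x - 2 * A * om x) + (Y' x - 2 * A * (- 2 * x * (om x)\<^sup>2)) \<le> 0"
      using 1 2 le[of x] by (simp add: algebra_simps)
    then show ?thesis unfolding F'_def by (simp add: mult_nonneg_nonpos)
  qed
  have mono: "F x \<le> F s" if "s \<le> x" for s x
    by (rule DERIV_nonpos_imp_nonincreasing[OF that]) (use dF F'le in blast)
  have lim: "((\<lambda>s. exp (k * s) * \<bar>B\<bar>) \<longlongrightarrow> 0 * \<bar>B\<bar>) at_bot"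
    using k by (intro tendsto_intros filterlim_compose[OF exp_at_bot]
      filterlim_tendsto_pos_mult_at_bot[OF tendsto_const _ filterlim_ident]) auto
  have "F x \<le> exp (k * s) * \<bar>B\<bar>" if "s \<le> x" for s
  proof -
    have "Y s - 2 * A * om s \<le> \<bar>B\<bar>" using B[of s] A om_pos[of s] by (smt (verit) mult_nonneg_nonneg)
    then have "exp (k * s) * (Y s - 2 * A * om s) \<le> exp (k * s) * \<bar>B\<bar>" by (intro mult_left_mono) auto
    then show ?thesis using mono[OF that] unfolding F_def by linarith
  qed
  then have "F x \<le> 0 * \<bar>B\<bar>"
    by (intro tendsto_lowerbound[OF lim] eventually_mono[OF eventually_le_at_bot[of x]]) auto
  then have "exp (k * x) * (Y x - 2 * A * om x) \<le> exp (k * x) * 0" by (simp add: F_def)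
  then have "Y x - 2 * A * om x \<le> 0" by (subst (asm) mult_le_cancel_left_pos) auto
  then show ?thesis by simp
qed

lemma comparison_abs:
  fixes Y \<rho> :: "real \<Rightarrow> real"
  assumes d: "\<And>x. (Y has_real_derivative (\<rho> x - 2 * Y x)) (at x)" and le: "\<And>x. \<bar>\<rho> x\<bar> \<le> A * om x"
    and B: "\<And>x. \<bar>Y x\<bar> \<le> B"
  shows "\<bar>Y x\<bar> \<le> 2 * A * om x"
proof -
  have A: "0 \<le> A" using le[of 0] om_pos[of 0] by (smt (verit) mult_neg_pos)
  have "Y x \<le> 2 * A * om x"
  proof (rule comparison_upper[OF d, of A 2 B])
    show "\<rho> x - 2 * Y x \<le> A * om x - 2 * Y x" for x using le[of x] by (simp add: abs_le_iff)
    show "Y x \<le> B" for x using B[of x] by (simp add: abs_le_iff)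
    show "0 \<le> A" by (rule A)
    show "(1::real) \<le> 2" by simp
  qed
  moreover have "- Y x \<le> 2 * A * om x"
    proof (rule comparison_upper[of "\<lambda>x. - Y x" "\<lambda>x. - (\<rho> x - 2 * Y x)" A 2 B])
    show "((\<lambda>x. - Y x) has_real_derivative - (\<rho> x - 2 * Y x)) (at x)" for x by (rule DERIV_minus[OF d])
    show "- (\<rho> x - 2 * Y x) \<le> A * om x - 2 * - Y x" for x using le[of x] by (simp add: abs_le_iff)
    show "- Y x \<le> B" for x using B[of x] by (simp add: abs_le_iff)
    show "0 \<le> A" by (rule A)
    show "(1::real) \<le> 2" by simp
  qed
  ultimately show ?thesis by linarith
qed

section \<open>Integrals of decaying functions\<close>

lemma DERIV_continuous_on_UNIV:
  fixes f :: "real \<Rightarrow> real"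
  assumes "\<And>x. (f has_real_derivative f' x) (at x)" shows "continuous_on UNIV f"
  by (rule DERIV_continuous_on[of UNIV f f']) (use assms in simp)

lemma integrable_om_bound:
  fixes g :: "real \<Rightarrow> real"
  assumes "continuous_on UNIV g" "\<And>x. \<bar>g x\<bar> \<le> C * om x"
  shows "integrable lborel g"
proof (rule Bochner_Integration.integrable_bound)
  show "integrable lborel (\<lambda>x. C * om x)" by (simp add: om_integrable)
  show "g \<in> borel_measurable lborel" using borel_measurable_continuous_onI[OF assms(1)] by simp
  show "AE x in lborel. norm (g x) \<le> norm (C * om x)" using order_trans[OF assms(2) abs_ge_self] by (intro AE_I2) simp
qed

lemma om_bound_sq:
  assumes "\<bar>a\<bar> \<le> C * om x" shows "a\<^sup>2 \<le> C\<^sup>2 / 4 * om x"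
proof -
  have "a\<^sup>2 \<le> (C * om x)\<^sup>2" using assms by (metis abs_ge_zero power2_abs power_mono)
  also have "\<dots> \<le> C\<^sup>2 * (om x / 4)" unfolding power_mult_distrib by (intro mult_left_mono om_sq_le) simp
  finally show ?thesis by simp
qed

lemma tendsto_om: "(om \<longlongrightarrow> 0) at_top" "(om \<longlongrightarrow> 0) at_bot"
proof -
  have "filterlim (\<lambda>x::real. 4 + x\<^sup>2) at_top at_top"
    by (intro filterlim_tendsto_add_at_top[OF tendsto_const] filterlim_pow_at_top filterlim_ident) simp
  then show 1: "(om \<longlongrightarrow> 0) at_top" unfolding om_def[abs_def] by (intro tendsto_divide_0[OF tendsto_const] filterlim_at_top_imp_at_infinity)
  have "om = (\<lambda>x. om (- x))" by (simp add: om_def fun_eq_iff)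
  then show "(om \<longlongrightarrow> 0) at_bot" using filterlim_compose[OF 1 filterlim_uminus_at_top_at_bot] by simp
qed

lemma integral_deriv_zero:
  fixes S S' :: "real \<Rightarrow> real"
  assumes d: "\<And>x. (S has_real_derivative S' x) (at x)" and c: "continuous_on UNIV S'"
    and b: "\<And>x. \<bar>S x\<bar> \<le> C * om x" and b': "\<And>x. \<bar>S' x\<bar> \<le> C' * om x"
  shows "(LINT x|lborel. S' x) = 0"
proof -
  have i: "integrable lborel S'" by (rule integrable_om_bound[OF c b'])
  have l: "(S \<longlongrightarrow> 0) F" if "(om \<longlongrightarrow> 0) F" for F
  proof (rule tendsto_0_le[OF tendsto_mult_right_zero[OF that, of C], of _ 1])
    show "\<forall>\<^sub>F x in F. norm (S x) \<le> norm (C * om x) * 1"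
      using order_trans[OF b abs_ge_self] by (intro always_eventually) simp
  qed
  have e: "einterval (-\<infinity>) \<infinity> = UNIV" by (auto simp: einterval_def)
  have "(LBINT x=-\<infinity>..\<infinity>. S' x) = 0 - 0"
  proof (rule interval_integral_FTC_integrable)
    show "(S has_vector_derivative S' x) (at x)" for x
      using d by (simp add: has_real_derivative_iff_has_vector_derivative)
    show "isCont S' x" for x using c by (simp add: continuous_on_eq_continuous_at)
    show "set_integrable lborel (einterval (-\<infinity>) \<infinity>) S'" using i by (simp add: e set_integrable_def)
    show "((S \<circ> real_of_ereal) \<longlongrightarrow> 0) (at_right (-\<infinity>))" "((S \<circ> real_of_ereal) \<longlongrightarrow> 0) (at_left \<infinity>)"
      by (simp_all add: ereal_tendsto_simps l tendsto_om)
  qed simp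
  then show ?thesis by (simp add: interval_lebesgue_integral_def e set_lebesgue_integral_def)
qed

section \<open>The Riccati equation\<close>

text \<open>With \<open>w = H - y\<close> the Riccati equation becomes \<open>y' + 2 y = (H - y)\<^sup>2\<close>, that is
  \<open>y = resolvent ((H - y)\<^sup>2)\<close>. On \<open>0 \<le> y \<le> 1/16\<close> the right-hand side is a contraction for the sup norm;
  \<open>y\<close> is clamped to this interval so that the contraction is global, and the fixed point turns out to
  lie in the interval. Two facts then compare \<open>w\<close> with \<open>H\<close> in \<open>L\<^sup>2\<close>: integrating the equation gives
  \<open>2 \<integral> y = \<integral> w\<^sup>2\<close>, and \<open>y\<^sup>2 \<le> y / 16\<close>. The bound by \<open>om\<close> is stated for all \<open>A\<close> at once because the same
  \<open>w\<close> is later estimated with constants that are uniform in time.\<close>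

lemma riccati_solution:
  fixes f H :: "real \<Rightarrow> real"
  assumes f: "continuous_on UNIV f" and fb: "\<And>x. \<bar>f x\<bar> \<le> A * om x"
    and H: "\<And>x. (H has_real_derivative (f x - 2 * H x)) (at x)" and HB: "\<And>x. \<bar>H x\<bar> \<le> B"
    and small: "(LINT x|lborel. (H x)\<^sup>2) \<le> 1/64"
  shows "\<exists>w. (\<forall>x. (w has_real_derivative (f x - 2 * w x - (w x)\<^sup>2)) (at x)) \<and>
     (\<forall>A. (\<forall>x. \<bar>f x\<bar> \<le> A * om x) \<longrightarrow> (\<forall>x. \<bar>w x\<bar> \<le> (2 * A + 4 * A\<^sup>2) * om x)) \<and>
     (LINT x|lborel. (w x)\<^sup>2) \<le> 4 * (LINT x|lborel. (H x)\<^sup>2) \<and>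
     (LINT x|lborel. (H x)\<^sup>2) \<le> 3 * (LINT x|lborel. (w x)\<^sup>2)"
proof -
  have Hc: "continuous_on UNIV H" by (rule DERIV_continuous_on_UNIV[OF H])
  have Hb: "\<bar>H x\<bar> \<le> 2 * A * om x" if fb: "\<And>x. \<bar>f x\<bar> \<le> A * om x" for A x
    by (rule comparison_abs[OF H fb HB])
  have H2b: "(H x)\<^sup>2 \<le> A\<^sup>2 * om x" if fb: "\<And>x. \<bar>f x\<bar> \<le> A * om x" for A x
    using om_bound_sq[OF Hb[OF fb, of x]] by (simp add: power_mult_distrib)
  have H2i: "integrable lborel (\<lambda>x. (H x)\<^sup>2)"
    by (rule integrable_om_bound[of _ "A\<^sup>2"]) (use H2b[OF fb] in \<open>auto intro!: continuous_intros Hc\<close>)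
  (* Clamping makes the fixed point map a contraction on all bounded continuous functions. *)
  define c where "c y = max 0 (min (1/16) y)" for y :: real
  have c01: "0 \<le> c y" "c y \<le> 1/16" for y by (auto simp: c_def)
  have c_lip: "\<bar>c y - c z\<bar> \<le> \<bar>y - z\<bar>" for y z by (auto simp: c_def)
  have c_cont: "continuous_on UNIV (\<lambda>s. c (g s))" if "continuous_on UNIV g" for g
    unfolding c_def by (intro continuous_intros that)
  define G where "G g = (\<lambda>s. (H s - c (g s))\<^sup>2)" for g
  have G_cont: "continuous_on UNIV (G g)" if "continuous_on UNIV g" for g
    unfolding G_def by (intro continuous_intros c_cont that Hc)
  have G_bd: "\<bar>G g s\<bar> \<le> 1/128 + 2 * (H s)\<^sup>2" for g s
  proof -
    have "(H s - c (g s))\<^sup>2 \<le> 2 * (H s)\<^sup>2 + 2 * (c (g s))\<^sup>2"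
      using zero_le_power2[of "H s + c (g s)"] by (simp add: power2_sum power2_diff)
    moreover have "(c (g s))\<^sup>2 \<le> (1/16)\<^sup>2" by (intro power_mono c01)
    ultimately show ?thesis by (simp add: G_def power2_eq_square)
  qed
  have KG_int: "set_integrable lborel {..x} (\<lambda>s. exp (2 * s) * G g s)" if "continuous_on UNIV g" for g x
    by (rule resolvent_integrable(1)[OF G_cont[OF that] G_bd H2i]) auto
  have KG_bd: "\<bar>resolvent (G g) x\<bar> \<le> 1/16" if "continuous_on UNIV g" for g x
    using resolvent_integrable(2)[OF G_cont[OF that] G_bd H2i, of x] small by simp
  have KG_deriv: "(resolvent (G g) has_real_derivative (G g x - 2 * resolvent (G g) x)) (at x)" if "continuous_on UNIV g" for g x
    by (rule resolvent_deriv[OF G_cont[OF that] KG_int[OF that]])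
  define Q where "Q y = Bcontfun (resolvent (G (apply_bcontfun y)))" for y
  have Q_app: "apply_bcontfun (Q y) = resolvent (G (apply_bcontfun y))" for y
    unfolding Q_def
  proof (rule Bcontfun_inverse)
    have yc: "continuous_on UNIV (apply_bcontfun y)" by simp
    have "continuous_on UNIV (resolvent (G (apply_bcontfun y)))"
      by (rule DERIV_continuous_on_UNIV[OF KG_deriv[OF yc]])
    moreover have "bounded (range (resolvent (G (apply_bcontfun y))))"
      using KG_bd[OF yc] by (intro boundedI[of _ "1/16"]) auto
    ultimately show "resolvent (G (apply_bcontfun y)) \<in> bcontfun" by (simp add: bcontfun_def)
  qed
  have "\<exists>!y. Q y = y"
  proof (rule banach_fix_type[of "1/4"])
    show "\<forall>y z. dist (Q y) (Q z) \<le> 1/4 * dist y z"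
    proof (intro allI dist_bound)
      fix y z :: "real \<Rightarrow>\<^sub>C real" and x
      have yc: "continuous_on UNIV (apply_bcontfun y)" for y :: "real \<Rightarrow>\<^sub>C real" by simp
      have "\<bar>G y s - G z s\<bar> \<le> dist y z * (3/8) + (dist y z * 4) * (H s)\<^sup>2" for s
      proof -
        have "G y s - G z s = (c (z s) - c (y s)) * (2 * H s - c (y s) - c (z s))"
          by (simp add: G_def power2_eq_square algebra_simps)
        then have "\<bar>G y s - G z s\<bar> = \<bar>c (z s) - c (y s)\<bar> * \<bar>2 * H s - c (y s) - c (z s)\<bar>"
          by (simp add: abs_mult)
        also have "\<dots> \<le> dist y z * (3/8 + 4 * (H s)\<^sup>2)"
        proof (rule mult_mono)
          have "\<bar>c (z s) - c (y s)\<bar> \<le> dist (y s) (z s)" using c_lip[of "z s" "y s"] by (simp add: dist_real_def abs_minus_commute)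
          also have "\<dots> \<le> dist y z" by (rule dist_bounded)
          finally show "\<bar>c (z s) - c (y s)\<bar> \<le> dist y z" .
          have "2 * \<bar>H s\<bar> \<le> 1/4 + 4 * (H s)\<^sup>2"
            using zero_le_power2[of "2 * \<bar>H s\<bar> - 1/2"] by (simp add: power2_diff power_mult_distrib) (simp add: power2_eq_square)
          then show "\<bar>2 * H s - c (y s) - c (z s)\<bar> \<le> 3/8 + 4 * (H s)\<^sup>2"
            using c01[of "y s"] c01[of "z s"] by linarith
        qed auto
        finally show ?thesis by (simp add: algebra_simps)
      qed
      then have "\<bar>resolvent (\<lambda>s. G y s - G z s) x\<bar> \<le> dist y z * (3/8) / 2 + (dist y z * 4) * (LINT s|lborel. (H s)\<^sup>2)"
        by (intro resolvent_integrable(2)[OF _ _ H2i] continuous_intros G_cont yc) auto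
      also have "\<dots> \<le> dist y z * (3/8) / 2 + (dist y z * 4) * (1/64)"
        using small by (intro add_left_mono mult_left_mono) auto
      finally have "\<bar>resolvent (G y) x - resolvent (G z) x\<bar> \<le> 1/4 * dist y z"
        by (subst (asm) resolvent_diff) (auto intro!: KG_int yc)
      then show "dist (Q y x) (Q z x) \<le> 1/4 * dist y z" by (simp add: Q_app dist_real_def)
    qed
  qed auto
  then obtain y where y: "Q y = y" by blast
  define Y where "Y = apply_bcontfun y"
  have Yc: "continuous_on UNIV Y" unfolding Y_def by simp
  have YK: "Y = resolvent (G Y)" using Q_app[of y] y by (simp add: Y_def)
  have Y0: "0 \<le> Y x" for x by (subst YK) (rule resolvent_nonneg, simp add: G_def)
  have Y1: "Y x \<le> 1/16" for x using KG_bd[OF Yc, of x] Y0[of x] by (simp flip: YK)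
  have cY: "c (Y x) = Y x" for x using Y0[of x] Y1[of x] by (simp add: c_def)
  have dY: "(Y has_real_derivative ((H x - Y x)\<^sup>2 - 2 * Y x)) (at x)" for x
    using KG_deriv[OF Yc, of x] unfolding YK[symmetric] by (simp add: G_def cY)
  have Yom: "Y x \<le> 2 * (2 * A\<^sup>2) * om x" if fb: "\<And>x. \<bar>f x\<bar> \<le> A * om x" for A x
  proof (rule comparison_upper[OF dY, of _ 1 "1/16"])
    fix x
    have "(H x - Y x)\<^sup>2 \<le> 2 * (H x)\<^sup>2 + 2 * (Y x)\<^sup>2"
      using zero_le_power2[of "H x + Y x"] by (simp add: power2_sum power2_diff)
    moreover have "(Y x)\<^sup>2 \<le> 1/16 * Y x" using mult_right_mono[OF Y1[of x] Y0[of x]] by (simp add: power2_eq_square)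
    ultimately show "(H x - Y x)\<^sup>2 - 2 * Y x \<le> 2 * A\<^sup>2 * om x - 1 * Y x" using H2b[OF fb, of x] Y0[of x] by simp
  qed (use Y1 in auto)
  define w where "w x = H x - Y x" for x
  have wc: "continuous_on UNIV w" unfolding w_def by (intro continuous_intros Hc Yc)
  have wb: "\<bar>w x\<bar> \<le> (2 * A + 4 * A\<^sup>2) * om x" if fb: "\<And>x. \<bar>f x\<bar> \<le> A * om x" for A x
    using Hb[OF fb, of x] Yom[OF fb, of x] Y0[of x] by (simp add: w_def algebra_simps)
  have dw: "(w has_real_derivative (f x - 2 * w x - (w x)\<^sup>2)) (at x)" for x
    unfolding w_def by (rule DERIV_cong[OF DERIV_diff[OF H dY]]) (simp add: algebra_simps)
  have w2b: "(w x)\<^sup>2 \<le> (2 * A + 4 * A\<^sup>2)\<^sup>2 / 4 * om x" for x using om_bound_sq[OF wb[OF fb, of x]] .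
  have w2i: "integrable lborel (\<lambda>x. (w x)\<^sup>2)"
    by (rule integrable_om_bound[of _ "(2 * A + 4 * A\<^sup>2)\<^sup>2 / 4"]) (use w2b in \<open>auto intro!: continuous_intros wc\<close>)
  have Yi: "integrable lborel Y"
    by (rule integrable_om_bound[OF Yc, of "2 * (2 * A\<^sup>2)"]) (use Y0 Yom[OF fb] in \<open>simp add: abs_of_nonneg\<close>)
  have "(Y x)\<^sup>2 \<le> 1/16 * Y x" for x using mult_right_mono[OF Y1[of x] Y0[of x]] by (simp add: power2_eq_square)
  note Y2 = this
  have Y2i: "integrable lborel (\<lambda>x. (Y x)\<^sup>2)"
    by (rule Bochner_Integration.integrable_bound[OF Yi])
      (use Y2 Y0 borel_measurable_continuous_onI[OF Yc] in \<open>auto intro!: AE_I2 order_trans[OF Y2]\<close>)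
  have "(LINT x|lborel. (w x)\<^sup>2 - 2 * Y x) = 0"
  proof (rule integral_deriv_zero)
    show "(Y has_real_derivative (w x)\<^sup>2 - 2 * Y x) (at x)" for x using dY by (simp add: w_def)
    show "continuous_on UNIV (\<lambda>x. (w x)\<^sup>2 - 2 * Y x)" by (intro continuous_intros wc Yc)
    show "\<bar>Y x\<bar> \<le> (2 * (2 * A\<^sup>2)) * om x" for x using Y0 Yom[OF fb] by (simp add: abs_of_nonneg)
    show "\<bar>(w x)\<^sup>2 - 2 * Y x\<bar> \<le> ((2 * A + 4 * A\<^sup>2)\<^sup>2 / 4 + 2 * (2 * (2 * A\<^sup>2))) * om x" for x
    proof -
      have "\<bar>(w x)\<^sup>2 - 2 * Y x\<bar> \<le> (w x)\<^sup>2 + 2 * Y x" using Y0[of x] zero_le_power2[of "w x"] by linarith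
      then show ?thesis using w2b[of x] Yom[OF fb, of x] unfolding distrib_right by linarith
    qed
  qed
  then have IY: "2 * (LINT x|lborel. Y x) = (LINT x|lborel. (w x)\<^sup>2)"
    using w2i Yi by (simp add: Bochner_Integration.integral_diff)
  have "(LINT x|lborel. (Y x)\<^sup>2) \<le> (LINT x|lborel. 1/16 * Y x)"
    using Y2 by (intro integral_mono Y2i integrable_mult_right Yi) auto
  then have IY2: "(LINT x|lborel. (Y x)\<^sup>2) \<le> 1/32 * (LINT x|lborel. (w x)\<^sup>2)" using IY by simp
  have w0: "0 \<le> (LINT x|lborel. (w x)\<^sup>2)" "0 \<le> (LINT x|lborel. (H x)\<^sup>2)" by simp_all
  have "(LINT x|lborel. (w x)\<^sup>2) \<le> (LINT x|lborel. 2 * (H x)\<^sup>2 + 2 * (Y x)\<^sup>2)"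
  proof (intro integral_mono w2i Bochner_Integration.integrable_add integrable_mult_right H2i Y2i)
    show "(w x)\<^sup>2 \<le> 2 * (H x)\<^sup>2 + 2 * (Y x)\<^sup>2" for x
      unfolding w_def using zero_le_power2[of "H x + Y x"] by (simp add: power2_sum power2_diff)
  qed
  then have 1: "(LINT x|lborel. (w x)\<^sup>2) \<le> 2 * (LINT x|lborel. (H x)\<^sup>2) + 2 * (LINT x|lborel. (Y x)\<^sup>2)"
    using H2i Y2i by simp
  have "(LINT x|lborel. (H x)\<^sup>2) \<le> (LINT x|lborel. 2 * (w x)\<^sup>2 + 2 * (Y x)\<^sup>2)"
  proof (intro integral_mono w2i Bochner_Integration.integrable_add integrable_mult_right H2i Y2i)
    show "(H x)\<^sup>2 \<le> 2 * (w x)\<^sup>2 + 2 * (Y x)\<^sup>2" for x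
      unfolding w_def using zero_le_power2[of "H x - 2 * Y x"] by (simp add: power2_diff power2_eq_square algebra_simps)
  qed
  then have 2: "(LINT x|lborel. (H x)\<^sup>2) \<le> 2 * (LINT x|lborel. (w x)\<^sup>2) + 2 * (LINT x|lborel. (Y x)\<^sup>2)"
    using w2i Y2i by simp
  show ?thesis
    by (rule exI[of _ w]) (use dw wb 1 2 IY2 w0 in auto)
qed

section \<open>Decaying functions\<close>

definition decays :: "(real \<Rightarrow> real) \<Rightarrow> bool" where
  "decays f \<longleftrightarrow> continuous_on UNIV f \<and> (\<exists>C. \<forall>x. \<bar>f x\<bar> \<le> C * om x)"

definition bounded_cont :: "(real \<Rightarrow> real) \<Rightarrow> bool" where
  "bounded_cont f \<longleftrightarrow> continuous_on UNIV f \<and> (\<exists>C. \<forall>x. \<bar>f x\<bar> \<le> C)"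

lemma decays_bounded_cont: assumes "decays f" shows "bounded_cont f"
proof -
  obtain C where C: "\<bar>f x\<bar> \<le> C * om x" for x using assms by (auto simp: decays_def)
  have "\<bar>f x\<bar> \<le> \<bar>C\<bar> * (1/4)" for x
    using C[of x] mult_mono[OF abs_ge_self[of C] om_le[of x]] om_pos[of x] by simp
  then show ?thesis using assms unfolding decays_def bounded_cont_def by blast
qed

lemma bounded_cont_const: "bounded_cont (\<lambda>_. c)" by (auto simp: bounded_cont_def)
lemma decays_add: assumes "decays f" "decays g" shows "decays (\<lambda>x. f x + g x)"
proof -
  obtain C D where "\<bar>f x\<bar> \<le> C * om x" "\<bar>g x\<bar> \<le> D * om x" for x using assms by (auto simp: decays_def)
  then have "\<bar>f x + g x\<bar> \<le> (C + D) * om x" for x unfolding distrib_right by (rule order_trans[OF abs_triangle_ineq add_mono])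
  then show ?thesis using assms by (auto simp: decays_def intro!: continuous_intros)
qed
lemma decays_mult_left: assumes "bounded_cont f" "decays g" shows "decays (\<lambda>x. f x * g x)"
proof -
  obtain C D where "\<bar>f x\<bar> \<le> C" "\<bar>g x\<bar> \<le> D * om x" for x using assms by (auto simp: bounded_cont_def decays_def)
  then have "\<bar>f x * g x\<bar> \<le> C * (D * om x)" for x unfolding abs_mult by (intro mult_mono) (auto intro: order_trans[OF abs_ge_zero])
  then have "\<bar>f x * g x\<bar> \<le> (C * D) * om x" for x by (simp add: mult.assoc)
  then show ?thesis using assms by (auto simp: bounded_cont_def decays_def intro!: continuous_intros)
qed
lemma decays_mult: "decays f \<Longrightarrow> decays g \<Longrightarrow> decays (\<lambda>x. f x * g x)"
  by (rule decays_mult_left[OF decays_bounded_cont])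
lemma decays_cmult: "decays f \<Longrightarrow> decays (\<lambda>x. c * f x)"
  by (rule decays_mult_left[OF bounded_cont_const])
lemma decays_minus: "decays f \<Longrightarrow> decays (\<lambda>x. - f x)"
  using decays_cmult[of f "-1"] by simp
lemma decays_diff: "decays f \<Longrightarrow> decays g \<Longrightarrow> decays (\<lambda>x. f x - g x)"
  using decays_add[OF _ decays_minus, of f g] by simp
lemma decays_power: "decays f \<Longrightarrow> 0 < n \<Longrightarrow> decays (\<lambda>x. f x ^ n)"
proof (induction n)
  case (Suc n) then show ?case by (cases n) (auto intro: decays_mult)
qed simp
lemma decays_integrable: "decays f \<Longrightarrow> integrable lborel f"
  by (auto simp: decays_def intro: integrable_om_bound)
lemma decays_bound_nonneg:
  assumes "decays f" obtains C where "0 \<le> C" "\<And>x. \<bar>f x\<bar> \<le> C * om x"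
proof -
  obtain C where C: "\<bar>f x\<bar> \<le> C * om x" for x using assms by (auto simp: decays_def)
  show thesis
  proof (rule that[of "\<bar>C\<bar>"])
    show "\<bar>f x\<bar> \<le> \<bar>C\<bar> * om x" for x
      using order_trans[OF C[of x] mult_right_mono[OF abs_ge_self[of C], of "om x"]] om_pos[of x] by simp
  qed simp
qed

lemma integral_deriv_zero_decays:
  assumes "\<And>x. (S has_real_derivative S' x) (at x)" "decays S" "decays S'"
  shows "(LINT x|lborel. S' x) = 0"
proof -
  obtain C C' where "\<bar>S x\<bar> \<le> C * om x" "\<bar>S' x\<bar> \<le> C' * om x" for x using assms by (auto simp: decays_def)
  then show ?thesis using integral_deriv_zero[OF assms(1)] assms(3) by (auto simp: decays_def)
qed

section \<open>Linear perturbation bound\<close>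

text \<open>The integrating factor \<open>exp (\<integral> \<gamma>)\<close> removes the perturbation. It is bounded above and below, since
  \<open>\<gamma>\<close> is dominated by \<open>B om\<close> and \<open>\<integral> om = \<pi> / 2\<close>.\<close>

lemma perturbed_linear_bound:
  fixes Z \<rho> \<gamma> :: "real \<Rightarrow> real"
  assumes d: "\<And>x. (Z has_real_derivative (\<rho> x - 2 * Z x - \<gamma> x * Z x)) (at x)"
    and c: "continuous_on UNIV \<gamma>" and \<gamma>: "\<And>x. \<bar>\<gamma> x\<bar> \<le> B * om x"
    and \<rho>: "\<And>x. \<bar>\<rho> x\<bar> \<le> A * om x" and M: "\<And>x. \<bar>Z x\<bar> \<le> M"
  shows "\<bar>Z x\<bar> \<le> 2 * exp (pi * B) * A * om x"
proof -
  have A: "0 \<le> A" using \<rho>[of 0] om_pos[of 0] by (smt (verit) mult_neg_pos)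
  have gi: "integrable lborel \<gamma>" by (rule integrable_om_bound[OF c \<gamma>])
  have gs: "set_integrable lborel {..x} \<gamma>" for x
    unfolding set_integrable_def by (rule integrable_mult_indicator[OF _ gi]) simp
  define \<beta> where "\<beta> x = (LINT s:{..x}|lborel. \<gamma> s)" for x
  have d\<beta>: "(\<beta> has_real_derivative \<gamma> x) (at x)" for x
    unfolding \<beta>_def by (rule has_real_derivative_integral_atMost[OF c gs])
  have \<beta>b: "\<bar>\<beta> x\<bar> \<le> pi * B / 2" for x
  proof -
    have "\<bar>\<beta> x\<bar> \<le> (LINT s:{..x}|lborel. \<bar>\<gamma> s\<bar>)"
      unfolding \<beta>_def using set_integral_norm_bound[OF gs] by simp
    also have "\<dots> \<le> (LINT s|lborel. B * om s)"
      unfolding set_lebesgue_integral_def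
    proof (rule integral_mono)
      show "integrable lborel (\<lambda>s. indicator {..x} s *\<^sub>R \<bar>\<gamma> s\<bar>)"
        by (rule integrable_mult_indicator) (use gi in auto)
      show "integrable lborel (\<lambda>s. B * om s)" by (simp add: om_integrable)
      show "indicator {..x} s *\<^sub>R \<bar>\<gamma> s\<bar> \<le> B * om s" for s
        using \<gamma>[of s] abs_ge_zero[of "\<gamma> s"] by (auto simp: indicator_def)
    qed
    finally show ?thesis by (simp add: om_integral mult.commute)
  qed
  define Y where "Y x = exp (\<beta> x) * Z x" for x
  have dY: "(Y has_real_derivative (exp (\<beta> x) * \<rho> x - 2 * Y x)) (at x)" for x
    unfolding Y_def[abs_def]
    by (rule derivative_eq_intros d d\<beta> refl)+ (simp add: algebra_simps)
  have eb: "exp (\<beta> x) \<le> exp (pi * B / 2)" "exp (- \<beta> x) \<le> exp (pi * B / 2)" for x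
    using \<beta>b[of x] by (auto simp: abs_le_iff)
  have "\<bar>Y x\<bar> \<le> 2 * (exp (pi * B / 2) * A) * om x"
  proof (rule comparison_abs[OF dY])
    show "\<bar>exp (\<beta> x) * \<rho> x\<bar> \<le> exp (pi * B / 2) * A * om x" for x
      unfolding abs_mult mult.assoc by (intro mult_mono \<rho>) (use eb[of x] in auto)
    show "\<bar>Y x\<bar> \<le> exp (pi * B / 2) * M" for x
      unfolding Y_def abs_mult by (intro mult_mono M) (use eb[of x] in auto)
  qed
  moreover have "\<bar>Z x\<bar> = exp (- \<beta> x) * \<bar>Y x\<bar>" by (simp add: Y_def abs_mult flip: exp_add mult.assoc)
  ultimately have "\<bar>Z x\<bar> \<le> exp (pi * B / 2) * (2 * (exp (pi * B / 2) * A) * om x)"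
    using eb[of x] by (auto intro!: mult_mono)
  also have "\<dots> = 2 * (exp (pi * B / 2) * exp (pi * B / 2)) * A * om x" by simp
  also have "exp (pi * B / 2) * exp (pi * B / 2) = exp (pi * B)" by (simp flip: exp_add)
  finally show ?thesis .
qed

text \<open>The quotient \<open>D = (w2 - w1) / \<tau>\<close> satisfies the linear equation
  \<open>D' = (f2 - f1) / \<tau> - 2 D - (w1 + w2) D\<close>, and \<open>P\<close> satisfies its limit as \<open>\<tau>\<close> tends to \<open>0\<close>. The
  difference \<open>D - P\<close> has the source \<open>(f2 - f1) / \<tau> - V - \<tau> D P\<close>, which is small.\<close>

lemma riccati_difference_quotient:
  fixes w1 w2 f1 f2 V P :: "real \<Rightarrow> real"
  assumes w1: "\<And>x. (w1 has_real_derivative (f1 x - 2 * w1 x - (w1 x)\<^sup>2)) (at x)"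
    and w2: "\<And>x. (w2 has_real_derivative (f2 x - 2 * w2 x - (w2 x)\<^sup>2)) (at x)"
    and b: "\<And>x. \<bar>w1 x\<bar> \<le> B * om x" "\<And>x. \<bar>w2 x\<bar> \<le> B * om x"
    and P: "\<And>x. (P has_real_derivative (V x - 2 * P x - 2 * w1 x * P x)) (at x)"
    and bP: "\<And>x. \<bar>P x\<bar> \<le> Ap * om x" and bV: "\<And>x. \<bar>V x\<bar> \<le> Av * om x"
    and \<tau>: "\<tau> \<noteq> 0" and e: "\<And>x. \<bar>(f2 x - f1 x) / \<tau> - V x\<bar> \<le> e * om x"
  defines "c \<equiv> 2 * exp (2 * pi * B)"
  shows "\<bar>(w2 x - w1 x) / \<tau> - P x\<bar> \<le> c * (e + \<bar>\<tau>\<bar> * (c * (Av + e) * Ap)) * om x"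
proof -
  have nonneg: "0 \<le> Ap" "0 \<le> e" "0 \<le> Av" "0 \<le> B"
    using bP[of 0] e[of 0] bV[of 0] b(1)[of 0] om_pos[of 0]
    by (smt (verit) mult_neg_pos)+
  have small: "a * om x \<le> a" if "0 \<le> a" for a x
    using mult_left_mono[OF om_le[of x] that] that by simp
  define D where "D x = (w2 x - w1 x) / \<tau>" for x
  define \<gamma> where "\<gamma> x = w1 x + w2 x" for x
  have \<gamma>c: "continuous_on UNIV \<gamma>" unfolding \<gamma>_def
    by (intro continuous_intros DERIV_continuous_on_UNIV[OF w1] DERIV_continuous_on_UNIV[OF w2])
  have \<gamma>b: "\<bar>\<gamma> x\<bar> \<le> (2 * B) * om x" for x using b(1)[of x] b(2)[of x] by (simp add: \<gamma>_def)
  have Db: "\<bar>D x\<bar> \<le> 2 * B / \<bar>\<tau>\<bar>" for x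
  proof -
    have "\<bar>w2 x - w1 x\<bar> \<le> 2 * B" using b(1)[of x] b(2)[of x] small[OF nonneg(4), of x] by linarith
    then show ?thesis using \<tau> by (simp add: D_def divide_right_mono abs_divide)
  qed
  have dD: "(D has_real_derivative ((f2 x - f1 x) / \<tau> - 2 * D x - \<gamma> x * D x)) (at x)" for x
    unfolding D_def[abs_def] \<gamma>_def
    by (rule DERIV_cong[OF DERIV_cdivide[OF DERIV_diff[OF w2 w1]]]) (use \<tau> in \<open>simp add: field_simps power2_eq_square\<close>)
  have Dom: "\<bar>D x\<bar> \<le> c * (Av + e) * om x" for x
  proof -
    have "\<bar>D x\<bar> \<le> 2 * exp (pi * (2 * B)) * (Av + e) * om x"
    proof (rule perturbed_linear_bound[OF dD \<gamma>c \<gamma>b _ Db])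
      show "\<bar>(f2 x - f1 x) / \<tau>\<bar> \<le> (Av + e) * om x" for x
        using e[of x] bV[of x] unfolding distrib_right by linarith
    qed
    moreover have "pi * (2 * B) = 2 * pi * B" by simp
    ultimately show ?thesis unfolding c_def by metis
  qed
  define Z where "Z x = D x - P x" for x
  define \<rho> where "\<rho> x = ((f2 x - f1 x) / \<tau> - V x) - \<tau> * D x * P x" for x
  have dZ: "(Z has_real_derivative (\<rho> x - 2 * Z x - \<gamma> x * Z x)) (at x)" for x
  proof -
    have "w2 x = w1 x + \<tau> * D x" using \<tau> by (simp add: D_def)
    then show ?thesis unfolding Z_def[abs_def] \<rho>_def
      by (intro DERIV_cong[OF DERIV_diff[OF dD P]]) (simp add: \<gamma>_def algebra_simps)
  qed
  have \<rho>b: "\<bar>\<rho> x\<bar> \<le> (e + \<bar>\<tau>\<bar> * (c * (Av + e) * Ap)) * om x" for x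
  proof -
    have "\<bar>D x * P x\<bar> \<le> (c * (Av + e)) * (Ap * om x)"
      unfolding abs_mult
    proof (intro mult_mono bP)
      have "0 \<le> c * (Av + e)" using nonneg by (simp add: c_def)
      from small[OF this, of x] Dom[of x] show "\<bar>D x\<bar> \<le> c * (Av + e)" by linarith
    qed (use nonneg in \<open>auto simp: c_def\<close>)
    then have "\<bar>\<tau>\<bar> * \<bar>D x * P x\<bar> \<le> \<bar>\<tau>\<bar> * ((c * (Av + e)) * (Ap * om x))" by (intro mult_left_mono) auto
    moreover have "\<bar>\<rho> x\<bar> \<le> e * om x + \<bar>\<tau>\<bar> * \<bar>D x * P x\<bar>"
      using e[of x] abs_triangle_ineq4[of "(f2 x - f1 x) / \<tau> - V x" "\<tau> * D x * P x"]
      by (simp add: \<rho>_def abs_mult mult.assoc)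
    ultimately show ?thesis by (simp add: algebra_simps)
  qed
  have Zb: "\<bar>Z x\<bar> \<le> 2 * B / \<bar>\<tau>\<bar> + Ap" for x
    using Db[of x] bP[of x] small[OF nonneg(1), of x] unfolding Z_def by linarith
  have "\<bar>Z x\<bar> \<le> 2 * exp (pi * (2 * B)) * (e + \<bar>\<tau>\<bar> * (c * (Av + e) * Ap)) * om x"
    by (rule perturbed_linear_bound[OF dZ \<gamma>c \<gamma>b \<rho>b Zb])
  moreover have "pi * (2 * B) = 2 * pi * B" by simp
  ultimately show ?thesis unfolding Z_def D_def c_def by metis
qed

section \<open>Algebra of the Gardner flow\<close>

text \<open>The spatial picture at one time. The function \<open>P\<close> defined below is \<open>\<partial>\<^sub>x (- u' + 2 u + 2 u w - 4 w)\<close>,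
  the value of \<open>w\<^sub>t\<close> that the Lax pair of KdV predicts.\<close>

locale gardner =
  fixes u u1 u2 u3 w :: "real \<Rightarrow> real"
  assumes u: "\<And>x. (u has_real_derivative u1 x) (at x)" "\<And>x. (u1 has_real_derivative u2 x) (at x)"
     "\<And>x. (u2 has_real_derivative u3 x) (at x)"
    and w: "\<And>x. (w has_real_derivative (u x - 2 * w x - (w x)\<^sup>2)) (at x)"
    and decays_u: "decays u" "decays u1" "decays u2" "decays u3" "decays w"
begin

definition "w1 x = u x - 2 * w x - (w x)\<^sup>2"
definition "w2 x = u1 x - 2 * w1 x - 2 * w x * w1 x"
definition "P x = - u2 x + 2 * u1 x + 2 * u1 x * w x + 2 * (u x * w1 x) - 4 * w1 x"

lemma dw: "(w has_real_derivative w1 x) (at x)" using w by (simp add: w1_def)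
lemma dw1: "(w1 has_real_derivative w2 x) (at x)"
  unfolding w1_def[abs_def] by (rule derivative_eq_intros u dw refl)+ (simp add: w2_def)
lemma dw2: "(w2 has_real_derivative (u2 x - 2 * w2 x - 2 * (w1 x)\<^sup>2 - 2 * w x * w2 x)) (at x)"
  unfolding w2_def[abs_def] by (rule derivative_eq_intros u dw dw1 refl)+ (simp add: w2_def power2_eq_square)
lemma decays_w: "decays w1" "decays w2"
  proof -
  show 1: "decays w1" unfolding w1_def[abs_def] by (intro decays_diff decays_cmult decays_power decays_u) simp
  show "decays w2" unfolding w2_def[abs_def] by (intro decays_diff decays_cmult decays_mult decays_u 1)
qed
lemma decays_P: "decays P"
  unfolding P_def[abs_def] by (intro decays_diff decays_add decays_minus decays_cmult decays_mult decays_u decays_w)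
text \<open>This is the Riccati equation differentiated in time, with \<open>u\<^sub>t\<close> replaced by the KdV expression:
  it identifies \<open>P\<close> as the limit of the difference quotients of \<open>w\<close>.\<close>

lemma dP: "(P has_real_derivative ((- u3 x + 6 * u x * u1 x) - 2 * P x - 2 * w x * P x)) (at x)"
proof -
  have "(P has_real_derivative (- u3 x + 2 * u2 x + (2 * u2 x * w x + 2 * u1 x * w1 x) + (2 * (u1 x * w1 x + u x * w2 x) - 4 * w2 x))) (at x)"
    unfolding P_def[abs_def] by (rule derivative_eq_intros u dw dw1 refl)+ (simp add: algebra_simps)
  moreover have "- u3 x + 2 * u2 x + (2 * u2 x * w x + 2 * u1 x * w1 x) + (2 * (u1 x * w1 x + u x * w2 x) - 4 * w2 x)
     = (- u3 x + 6 * u x * u1 x) - 2 * P x - 2 * w x * P x"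
    unfolding P_def w2_def w1_def by (simp add: power2_eq_square algebra_simps)
  ultimately show ?thesis by metis
qed

text \<open>In terms of \<open>w\<close> alone \<open>P = - w''' + 6 w\<^sup>2 w' + 12 w w'\<close>. The integrands of the two sides differ by
  the derivative of the decaying function \<open>S\<close> of the proof, which collects all boundary terms of the
  integrations by parts.\<close>

lemma energy_identity:
  assumes \<phi>: "\<And>x. (\<phi> has_real_derivative \<phi>1 x) (at x)" "\<And>x. (\<phi>1 has_real_derivative \<phi>2 x) (at x)"
     "\<And>x. (\<phi>2 has_real_derivative \<phi>3 x) (at x)"
    and b: "bounded_cont \<phi>" "bounded_cont \<phi>1" "bounded_cont \<phi>2" "bounded_cont \<phi>3"
  shows "(LINT x|lborel. \<phi> x * (2 * w x * P x)) =
    (LINT x|lborel. \<phi>3 x * (w x)^2 - 3 * (\<phi>1 x * (w1 x)^2) - 3 * (\<phi>1 x * (w x)^4) - 8 * (\<phi>1 x * (w x)^3))"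
proof -
  define S where "S x = \<phi> x * (- 2 * (w x * w2 x) + (w1 x)^2 + 3 * (w x)^4 + 8 * (w x)^3) + 2 * (\<phi>1 x * (w x * w1 x)) - \<phi>2 x * (w x)^2" for x
  define L where "L x = \<phi> x * (2 * w x * P x)" for x
  define R where "R x = \<phi>3 x * (w x)^2 - 3 * (\<phi>1 x * (w1 x)^2) - 3 * (\<phi>1 x * (w x)^4) - 8 * (\<phi>1 x * (w x)^3)" for x
  have dS: "(S has_real_derivative (L x - R x)) (at x)" for x
    unfolding S_def[abs_def]
    apply (rule derivative_eq_intros dw dw1 dw2 \<phi> refl)+
    unfolding L_def R_def P_def w2_def w1_def
    by (simp add: eval_nat_numeral algebra_simps)
  have q: "decays (\<lambda>x. - 2 * (w x * w2 x) + (w1 x)^2 + 3 * (w x)^4 + 8 * (w x)^3)"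
    by (intro decays_add decays_cmult decays_mult decays_power decays_u decays_w) simp_all
  have q2: "decays (\<lambda>x. w x * w1 x)" "decays (\<lambda>x. (w x)^2)" "decays (\<lambda>x. (w1 x)^2)" "decays (\<lambda>x. (w x)^4)" "decays (\<lambda>x. (w x)^3)"
    "decays (\<lambda>x. 2 * w x * P x)"
    by (intro decays_cmult decays_mult decays_power decays_u decays_w decays_P; simp)+
  have "decays S" "decays L" "decays R"
    unfolding S_def[abs_def] L_def[abs_def] R_def[abs_def]
    by (intro decays_add decays_diff decays_cmult q q2 decays_mult_left[OF b(1)] decays_mult_left[OF b(2)] decays_mult_left[OF b(3)] decays_mult_left[OF b(4)])+
  then have "(LINT x|lborel. L x - R x) = 0"
    by (intro integral_deriv_zero_decays[OF dS] decays_diff)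
  then have "(LINT x|lborel. L x) = (LINT x|lborel. R x)"
    using \<open>decays L\<close> \<open>decays R\<close> decays_integrable by (simp add: Bochner_Integration.integral_diff)
  then show ?thesis by (simp add: L_def R_def)
qed

end

section \<open>Differentiation in time\<close>

text \<open>Differentiability in time, uniformly in space relative to the weight \<open>om\<close>; since \<open>om\<close> is integrable,
  this permits differentiation under the spatial integral.\<close>

definition wdiff :: "(real \<Rightarrow> real \<Rightarrow> real) \<Rightarrow> (real \<Rightarrow> real) \<Rightarrow> real \<Rightarrow> bool" where
  "wdiff F F' t \<longleftrightarrow> (\<forall>e>0. \<forall>\<^sub>F s in at t. \<forall>x. \<bar>(F s x - F t x) / (s - t) - F' x\<bar> \<le> e * om x)"

lemma wdiff_increment:
  assumes w: "wdiff F F' t" and b: "\<And>x. \<bar>F' x\<bar> \<le> C * om x"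
  shows "\<forall>\<^sub>F s in at t. \<forall>x. \<bar>F s x - F t x\<bar> \<le> \<bar>s - t\<bar> * ((C + 1) * om x)"
proof -
  have "\<forall>\<^sub>F s in at t. \<forall>x. \<bar>(F s x - F t x) / (s - t) - F' x\<bar> \<le> 1 * om x"
    using w[unfolded wdiff_def, rule_format, of 1] by simp
  moreover have "\<forall>\<^sub>F s in at t. s \<noteq> t" by (simp add: eventually_at_filter)
  ultimately show ?thesis
  proof eventually_elim
    case (elim s)
    show ?case
    proof
      fix x
      have "\<bar>(F s x - F t x) / (s - t)\<bar> \<le> (C + 1) * om x"
        using elim(1)[rule_format, of x] b[of x] unfolding distrib_right by linarith
      then show "\<bar>F s x - F t x\<bar> \<le> \<bar>s - t\<bar> * ((C + 1) * om x)"
        using elim(2) by (simp add: abs_divide pos_divide_le_eq mult.commute)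
    qed
  qed
qed

lemma eventually_at_close: "0 < d \<Longrightarrow> \<forall>\<^sub>F s in at (t::real). \<bar>s - t\<bar> < d"
  unfolding eventually_at by (auto simp: dist_real_def)

lemma wdiff_bounded:
  assumes w: "wdiff F F' t" and b: "\<And>x. \<bar>F' x\<bar> \<le> C' * om x" and b0: "\<And>x. \<bar>F t x\<bar> \<le> C * om x"
  shows "\<forall>\<^sub>F s in at t. \<forall>x. \<bar>F s x\<bar> \<le> (C + C' + 1) * om x"
  using wdiff_increment[OF w b] eventually_at_close[OF zero_less_one, of t]
proof eventually_elim
  case (elim s)
  show ?case
  proof
    fix x
    have "0 \<le> (C' + 1) * om x" using b[of x] om_pos[of x] by (simp add: distrib_right) 
    then have "\<bar>s - t\<bar> * ((C' + 1) * om x) \<le> 1 * ((C' + 1) * om x)"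
      using elim(2) by (intro mult_right_mono) auto
    moreover have "(C + C' + 1) * om x = C * om x + 1 * ((C' + 1) * om x)" by (simp add: algebra_simps)
    ultimately show "\<bar>F s x\<bar> \<le> (C + C' + 1) * om x"
      using elim(1)[rule_format, of x] b0[of x] by linarith
  qed
qed

lemma om_le_1: "om x \<le> 1" using om_le[of x] by simp

text \<open>The difference quotient of \<open>F\<^sup>2\<close> minus \<open>2 F F'\<close> is \<open>(F s + F t) (Q - F') + (F s - F t) F'\<close>, where \<open>Q\<close>
  is the difference quotient of \<open>F\<close>.\<close>

lemma wdiff_square:
  assumes w: "wdiff F F' t" and d: "decays (F t)" "decays F'"
  shows "wdiff (\<lambda>s x. (F s x)\<^sup>2) (\<lambda>x. 2 * F t x * F' x) t"
  unfolding wdiff_def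
proof (intro allI impI)
  fix e :: real assume e: "0 < e"
  obtain C where C: "0 \<le> C" "\<And>x. \<bar>F t x\<bar> \<le> C * om x" using decays_bound_nonneg[OF d(1)] by blast
  obtain C' where C': "0 \<le> C'" "\<And>x. \<bar>F' x\<bar> \<le> C' * om x" using decays_bound_nonneg[OF d(2)] by blast
  define M where "M = 2 * C + C' + 1"
  define e1 where "e1 = e / (2 * M)"
  define e2 where "e2 = (e / 2) / ((C' + 1) * (C' + 1))"
  have P: "0 < (C' + 1) * (C' + 1)" using C'(1) by simp
  have M: "0 < M" using C C' by (simp add: M_def)
  have e1: "0 < e1" "M * e1 = e / 2" using e M by (simp_all add: e1_def)
  have e2: "0 < e2" using e P unfolding e2_def by (intro divide_pos_pos) auto
  have e2': "e2 * ((C' + 1) * (C' + 1)) = e / 2"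
    by (rule nonzero_eq_divide_eq[THEN iffD1, OF P[THEN less_imp_neq, symmetric] e2_def])
  have "\<forall>\<^sub>F s in at t. \<forall>x. \<bar>(F s x - F t x) / (s - t) - F' x\<bar> \<le> e1 * om x"
    using w e1 by (auto simp: wdiff_def)
  moreover note wdiff_bounded[OF w C'(2) C(2)] wdiff_increment[OF w C'(2)] eventually_at_close[OF e2, of t]
  ultimately show "\<forall>\<^sub>F s in at t. \<forall>x. \<bar>((F s x)\<^sup>2 - (F t x)\<^sup>2) / (s - t) - 2 * F t x * F' x\<bar> \<le> e * om x"
  proof eventually_elim
    case (elim s)
    show ?case
    proof
      fix x
      have o: "0 < om x" "om x \<le> 1" by (simp_all add: om_pos om_le_1)
      have "((F s x)\<^sup>2 - (F t x)\<^sup>2) / (s - t) - 2 * F t x * F' x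
        = (F s x + F t x) * ((F s x - F t x) / (s - t) - F' x) + (F s x - F t x) * F' x"
        by (simp add: power2_eq_square divide_inverse algebra_simps)
      then have "\<bar>((F s x)\<^sup>2 - (F t x)\<^sup>2) / (s - t) - 2 * F t x * F' x\<bar>
        \<le> \<bar>F s x + F t x\<bar> * \<bar>(F s x - F t x) / (s - t) - F' x\<bar> + \<bar>F s x - F t x\<bar> * \<bar>F' x\<bar>"
        by (metis abs_triangle_ineq abs_mult)
      also have "\<dots> \<le> M * (e1 * om x) + (e2 * (C' + 1)) * ((C' + 1) * om x)"
      proof (intro add_mono mult_mono)
        have "\<bar>F s x + F t x\<bar> \<le> M * om x"
          using elim(2)[rule_format, of x] C(2)[of x] by (simp add: M_def algebra_simps)
        also have "\<dots> \<le> M" using M o by simp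
        finally show "\<bar>F s x + F t x\<bar> \<le> M" .
        show "\<bar>(F s x - F t x) / (s - t) - F' x\<bar> \<le> e1 * om x" using elim(1) by blast
        have "\<bar>F s x - F t x\<bar> \<le> \<bar>s - t\<bar> * ((C' + 1) * om x)" using elim(3) by blast
        also have "\<dots> \<le> e2 * (C' + 1)"
        proof (rule mult_mono)
          show "(C' + 1) * om x \<le> C' + 1" using C'(1) o by (simp add: mult_left_le)
        qed (use elim(4) C'(1) o e2 in auto)
        finally show "\<bar>F s x - F t x\<bar> \<le> e2 * (C' + 1)" .
        show "\<bar>F' x\<bar> \<le> (C' + 1) * om x" using C'(2)[of x] o by (simp add: distrib_right)
      qed (use M e2 C'(1) in auto)
      also have "\<dots> = (M * e1 + e2 * ((C' + 1) * (C' + 1))) * om x" by (simp add: algebra_simps)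
      also have "\<dots> = e * om x" using e1 e2' by simp
      finally show "\<bar>((F s x)\<^sup>2 - (F t x)\<^sup>2) / (s - t) - 2 * F t x * F' x\<bar> \<le> e * om x" .
    qed
  qed
qed

lemma wdiff_integral:
  assumes w: "wdiff F F' t" and d: "\<forall>\<^sub>F s in at t. decays (F s)" "decays (F t)" "decays F'" and \<phi>: "bounded_cont \<phi>"
  shows "((\<lambda>s. LINT x|lborel. \<phi> x * F s x) has_real_derivative (LINT x|lborel. \<phi> x * F' x)) (at t)"
  unfolding has_field_derivative_iff
proof (rule tendstoI)
  fix e :: real assume e: "0 < e"
  obtain B where B: "\<bar>\<phi> x\<bar> \<le> B" for x using \<phi> by (auto simp: bounded_cont_def)
  have B0: "0 \<le> B" using B[of 0] by linarith
  (* The total mass of om is pi / 2, so e1 leaves an error of e / 2 in the integral. *)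
  define e1 where "e1 = (e / 2) / ((B + 1) * (pi / 2))"
  have P: "0 < (B + 1) * (pi / 2)" using B0 by simp
  have e1: "0 < e1" using e P unfolding e1_def by (intro divide_pos_pos) auto
  have "e1 * ((B + 1) * (pi / 2)) = e / 2"
    by (rule nonzero_eq_divide_eq[THEN iffD1, OF P[THEN less_imp_neq, symmetric] e1_def])
  then have e1': "(B + 1) * e1 * (pi / 2) = e / 2" by (simp only: mult_ac)
  have "\<forall>\<^sub>F s in at t. \<forall>x. \<bar>(F s x - F t x) / (s - t) - F' x\<bar> \<le> e1 * om x"
    using w e1 by (auto simp: wdiff_def)
  with d(1) show "\<forall>\<^sub>F s in at t. dist (((LINT x|lborel. \<phi> x * F s x) - (LINT x|lborel. \<phi> x * F t x)) / (s - t))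
     (LINT x|lborel. \<phi> x * F' x) < e"
  proof eventually_elim
    case (elim s)
    have i: "integrable lborel (\<lambda>x. \<phi> x * F s x)" "integrable lborel (\<lambda>x. \<phi> x * F t x)" "integrable lborel (\<lambda>x. \<phi> x * F' x)"
      by (intro decays_integrable decays_mult_left \<phi> elim d)+
    have "((LINT x|lborel. \<phi> x * F s x) - (LINT x|lborel. \<phi> x * F t x)) / (s - t) - (LINT x|lborel. \<phi> x * F' x)
      = (LINT x|lborel. (\<phi> x * F s x - \<phi> x * F t x) / (s - t) - \<phi> x * F' x)"
      using i by (simp add: Bochner_Integration.integral_diff)
    also have "\<bar>\<dots>\<bar> \<le> (LINT x|lborel. (B + 1) * e1 * om x)"
    proof (rule Bochner_Integration.integral_abs_bound_integral)
      show "integrable lborel (\<lambda>x. (\<phi> x * F s x - \<phi> x * F t x) / (s - t) - \<phi> x * F' x)" using i by simp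
      show "integrable lborel (\<lambda>x. (B + 1) * e1 * om x)" by (simp add: om_integrable)
      fix x
      have "(\<phi> x * F s x - \<phi> x * F t x) / (s - t) - \<phi> x * F' x = \<phi> x * ((F s x - F t x) / (s - t) - F' x)"
        by (simp add: divide_inverse algebra_simps)
      also have "\<bar>\<dots>\<bar> \<le> (B + 1) * (e1 * om x)"
        unfolding abs_mult using B[of x] B0 elim(2) by (intro mult_mono) auto
      finally show "\<bar>(\<phi> x * F s x - \<phi> x * F t x) / (s - t) - \<phi> x * F' x\<bar> \<le> (B + 1) * e1 * om x" by (simp add: mult.assoc)
    qed
    also have "\<dots> = (B + 1) * e1 * (pi / 2)" by (simp add: om_integral)
    also have "\<dots> < e" using e e1' by simp
    finally show ?case by (simp add: dist_real_def)
  qed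
qed

lemma decays_resolvent:
  assumes "decays f" shows "decays (resolvent f)" "(resolvent f has_real_derivative (f x - 2 * resolvent f x)) (at x)"
    "set_integrable lborel {..x} (\<lambda>s. exp (2 * s) * f s)"
proof -
  obtain C where C: "0 \<le> C" "\<And>x. \<bar>f x\<bar> \<le> C * om x" using decays_bound_nonneg[OF assms] by blast
  have fc: "continuous_on UNIV f" using assms by (simp add: decays_def)
  have b: "\<bar>f s\<bar> \<le> C" for s using C(2)[of s] mult_left_mono[OF om_le_1[of s] C(1)] by simp
  show d: "(resolvent f has_real_derivative (f x - 2 * resolvent f x)) (at x)" for x by (rule resolvent_deriv_bdd(1)[OF fc b])
  have "\<bar>resolvent f x\<bar> \<le> 2 * C * om x" for x by (rule comparison_abs[OF d C(2) resolvent_deriv_bdd(2)[OF fc b]])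
  then show "decays (resolvent f)" using DERIV_continuous_on_UNIV[OF d] by (auto simp: decays_def)
  show "set_integrable lborel {..x} (\<lambda>s. exp (2 * s) * f s)"
    by (rule resolvent_integrable(1)[OF fc, of C 0 "\<lambda>_. 0"]) (use b C in auto)
qed

text \<open>The resolvent is linear and maps functions below \<open>e om\<close> to functions below \<open>2 e om\<close>.\<close>

lemma wdiff_resolvent:
  assumes w: "wdiff F F' t" and d: "\<And>s. decays (F s)" "decays F'"
  shows "wdiff (\<lambda>s. resolvent (F s)) (resolvent F') t"
  unfolding wdiff_def
proof (intro allI impI)
  fix e :: real assume e: "0 < e"
  then have "\<forall>\<^sub>F s in at t. \<forall>x. \<bar>(F s x - F t x) / (s - t) - F' x\<bar> \<le> e / 2 * om x"
    using w[unfolded wdiff_def, rule_format, of "e / 2"] by simp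
  then show "\<forall>\<^sub>F s in at t. \<forall>x. \<bar>(resolvent (F s) x - resolvent (F t) x) / (s - t) - resolvent F' x\<bar> \<le> e * om x"
  proof eventually_elim
    case (elim s)
    define Z where "Z x = (resolvent (F s) x - resolvent (F t) x) / (s - t) - resolvent F' x" for x
    have dZ: "(Z has_real_derivative (((F s x - F t x) / (s - t) - F' x) - 2 * Z x)) (at x)" for x
      unfolding Z_def[abs_def]
      by (rule DERIV_cong[OF DERIV_diff[OF DERIV_cdivide[OF DERIV_diff[OF decays_resolvent(2)[OF d(1)] decays_resolvent(2)[OF d(1)]]] decays_resolvent(2)[OF d(2)]]])
        (simp add: divide_inverse algebra_simps)
    have "bounded_cont (\<lambda>x. inverse (s - t) * (resolvent (F s) x - resolvent (F t) x) - resolvent F' x)"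
      by (intro decays_bounded_cont decays_diff decays_cmult decays_resolvent(1) d)
    then have "bounded_cont Z" by (simp add: Z_def[abs_def] divide_inverse mult.commute)
    then obtain B where B: "\<bar>Z x\<bar> \<le> B" for x by (auto simp: bounded_cont_def)
    have "\<bar>Z x\<bar> \<le> 2 * (e / 2) * om x" for x
      by (rule comparison_abs[OF dZ _ B]) (use elim in auto)
    then show ?case by (simp add: Z_def)
  qed
qed

section \<open>A continuity argument\<close>

text \<open>At the first time at which \<open>\<eta>\<close> reached \<open>a\<close>, conservation of \<open>I\<close> up to that time and \<open>\<eta> \<le> 3 I\<close> would
  give \<open>\<eta> \<le> 3 I 0 < a\<close>.\<close>

lemma bootstrap_forward:
  fixes \<eta> I :: "real \<Rightarrow> real"
  assumes c: "continuous_on UNIV \<eta>" and I: "\<And>t. \<eta> t < a \<Longrightarrow> (I has_real_derivative 0) (at t)"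
    and le: "\<And>t. \<eta> t < a \<Longrightarrow> \<eta> t \<le> 3 * I t" and init: "\<eta> 0 < a" "3 * I 0 < a"
    and t: "0 \<le> t"
  shows "\<eta> t < a \<and> I t = I 0"
proof -
  have const: "I t = I 0" if "0 \<le> t" "\<And>s. 0 \<le> s \<Longrightarrow> s \<le> t \<Longrightarrow> \<eta> s < a" for t
  proof (cases "t = 0")
    case False
    then have "0 < t" using that by simp
    then show ?thesis
    proof (rule DERIV_isconst_end[of 0 t I])
      show "continuous_on {0..t} I"
        using that(2) I by (intro continuous_at_imp_continuous_on ballI DERIV_isCont[of I 0]) auto
    qed (use that I in auto)
  qed simp
  have all: "\<eta> t < a" if "0 \<le> t" for t
  proof (rule ccontr)
    assume "\<not> \<eta> t < a"
    define S where "S = {s. 0 \<le> s \<and> a \<le> \<eta> s}"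
    have "closed S" unfolding S_def
      by (intro closed_Collect_conj closed_Collect_le continuous_intros c)
    moreover have ne: "S \<noteq> {}" and bd: "bdd_below S"
      using \<open>\<not> \<eta> t < a\<close> that by (auto simp: S_def intro!: bdd_belowI[of _ 0])
    ultimately have T: "Inf S \<in> S" using closed_contains_Inf by blast
    define T where "T = Inf S"
    have TS: "0 \<le> T" "a \<le> \<eta> T" using T by (auto simp: S_def T_def)
    have below: "\<eta> s < a" if "0 \<le> s" "s < T" for s
      using that cInf_lower[OF _ bd, of s] by (force simp: T_def S_def)
    have T0: "0 < T" using TS init by (cases "T = 0") auto
    have "\<eta> s \<le> 3 * I 0" if "0 \<le> s" "s < T" for s
      using le[OF below[OF that]] const[OF that(1)] below that by (metis order_le_less_trans)
    moreover have "(\<eta> \<longlongrightarrow> \<eta> T) (at_left T)"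
      using c by (simp add: continuous_on_eq_continuous_at isCont_def filterlim_at_split)
    ultimately have "\<eta> T \<le> 3 * I 0"
      using T0 by (intro tendsto_upperbound[of \<eta> "\<eta> T" "at_left T"]) (auto simp: eventually_at_left[of 0 T] intro!: exI[of _ 0])
    then show False using TS init by simp
  qed
  show ?thesis using all const t by blast
qed

lemma bootstrap:
  fixes \<eta> I :: "real \<Rightarrow> real"
  assumes c: "continuous_on UNIV \<eta>" and I: "\<And>t. \<eta> t < a \<Longrightarrow> (I has_real_derivative 0) (at t)"
    and le: "\<And>t. \<eta> t < a \<Longrightarrow> \<eta> t \<le> 3 * I t" and init: "\<eta> 0 < a" "3 * I 0 < a"
  shows "\<eta> t < a \<and> I t = I 0"
proof (cases "0 \<le> t")
  case True then show ?thesis using bootstrap_forward[OF assms] by blast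
next
  case False
  have "\<eta> (- (- t)) < a \<and> I (- (- t)) = I (- 0)"
  proof (rule bootstrap_forward[of "\<lambda>t. \<eta> (- t)" a "\<lambda>t. I (- t)"])
    show "continuous_on UNIV (\<lambda>t. \<eta> (- t))"
      by (rule continuous_on_compose2[OF c]) (auto intro!: continuous_intros)
    show "((\<lambda>t. I (- t)) has_real_derivative 0) (at t)" if "\<eta> (- t) < a" for t
      using DERIV_chain2[OF I[OF that] DERIV_minus[OF DERIV_ident]] by simp
  qed (use le init False in auto)
  then show ?thesis by simp
qed

section \<open>Conservation of the Gardner energy\<close>

text \<open>What is used of a classical solution: decay of three spatial derivatives, and the equation as a
  time derivative in the weighted sup norm.\<close>

locale kdv_flow_smooth =
  fixes u u1 u2 u3 :: "real \<Rightarrow> real \<Rightarrow> real"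
  assumes du: "\<And>t x. (u t has_real_derivative u1 t x) (at x)" "\<And>t x. (u1 t has_real_derivative u2 t x) (at x)"
     "\<And>t x. (u2 t has_real_derivative u3 t x) (at x)"
    and decays_u: "\<And>t. decays (u t)" "\<And>t. decays (u1 t)" "\<And>t. decays (u2 t)" "\<And>t. decays (u3 t)"
    and kdv: "\<And>t. wdiff u (\<lambda>x. - u3 t x + 6 * u t x * u1 t x) t"
begin

definition "V t x = - u3 t x + 6 * u t x * u1 t x"
definition "\<eta> t = (LINT x|lborel. (resolvent (u t) x)\<^sup>2)"

text \<open>The conclusion of \<open>riccati_solution\<close> at time \<open>t\<close>. A solution is chosen independently at every time;
  its regularity in time is a consequence of the equation.\<close>

definition gardner_variable where "gardner_variable t w \<longleftrightarrow> (\<forall>x. (w has_real_derivative (u t x - 2 * w x - (w x)\<^sup>2)) (at x)) \<and>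
     (\<forall>A. (\<forall>x. \<bar>u t x\<bar> \<le> A * om x) \<longrightarrow> (\<forall>x. \<bar>w x\<bar> \<le> (2 * A + 4 * A\<^sup>2) * om x)) \<and>
     (LINT x|lborel. (w x)\<^sup>2) \<le> 4 * \<eta> t \<and> \<eta> t \<le> 3 * (LINT x|lborel. (w x)\<^sup>2)"

definition "w t = (SOME w. gardner_variable t w)"

lemma decays_V: "decays (V t)" unfolding V_def[abs_def] by (intro decays_add decays_minus decays_mult decays_cmult decays_u)

lemma gardner_variable_w: assumes "\<eta> t \<le> 1/64" shows "gardner_variable t (w t)"
proof -
  obtain A where A: "\<And>x. \<bar>u t x\<bar> \<le> A * om x" using decays_bound_nonneg[OF decays_u(1)] by blast
  obtain B where B: "\<And>x. \<bar>resolvent (u t) x\<bar> \<le> B" using decays_bounded_cont[OF decays_resolvent(1)[OF decays_u(1)]] by (auto simp: bounded_cont_def)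
  have "\<exists>w. gardner_variable t w" unfolding gardner_variable_def \<eta>_def
    by (rule riccati_solution[OF _ A decays_resolvent(2)[OF decays_u(1)] B]) (use assms decays_u(1)[of t] in \<open>auto simp: \<eta>_def decays_def\<close>)
  then show ?thesis unfolding w_def by (rule someI_ex)
qed

lemma decays_w: assumes "\<eta> t \<le> 1/64" shows "decays (w t)"
proof -
  note w = gardner_variable_w[OF assms, unfolded gardner_variable_def]
  obtain A where "\<And>x. \<bar>u t x\<bar> \<le> A * om x" using decays_bound_nonneg[OF decays_u(1)] by blast
  then have "\<And>x. \<bar>w t x\<bar> \<le> (2 * A + 4 * A\<^sup>2) * om x" using w by blast
  moreover have "continuous_on UNIV (w t)" by (rule DERIV_continuous_on_UNIV) (use w in blast)
  ultimately show ?thesis unfolding decays_def by blast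
qed

lemma gardner: "\<eta> t \<le> 1/64 \<Longrightarrow> gardner (u t) (u1 t) (u2 t) (u3 t) (w t)"
  using gardner_variable_w[of t] decays_w[of t] by unfold_locales (auto simp: gardner_variable_def du decays_u)

lemma kdv': "wdiff u (V t) t" using kdv[of t] by (simp add: V_def[abs_def])

lemma decays_resolvent_sq: "decays (\<lambda>x. (resolvent (u t) x)\<^sup>2)" by (intro decays_power decays_resolvent decays_u) simp

lemma \<eta>_deriv: "\<exists>D. (\<eta> has_real_derivative D) (at t)"
proof -
  have "wdiff (\<lambda>s x. (resolvent (u s) x)\<^sup>2) (\<lambda>x. 2 * resolvent (u t) x * resolvent (V t) x) t"
    by (intro wdiff_square wdiff_resolvent kdv' decays_u decays_V decays_resolvent)
  then have "((\<lambda>s. LINT x|lborel. 1 * (resolvent (u s) x)\<^sup>2) has_real_derivative (LINT x|lborel. 1 * (2 * resolvent (u t) x * resolvent (V t) x))) (at t)"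
    by (rule wdiff_integral[OF _ _ _ _ bounded_cont_const[of 1]]) (auto intro!: always_eventually decays_resolvent_sq decays_mult decays_cmult decays_resolvent decays_u decays_V)
  then show ?thesis unfolding \<eta>_def by auto
qed

lemma \<eta>_cont: "continuous_on UNIV \<eta>"
  by (intro continuous_at_imp_continuous_on ballI) (metis \<eta>_deriv DERIV_isCont)

lemma \<eta>_near: assumes "\<eta> t < 1/64" shows "\<forall>\<^sub>F s in at t. \<eta> s < 1/64"
proof -
  have "(\<eta> \<longlongrightarrow> \<eta> t) (at t)" using \<eta>_cont by (simp add: continuous_on_eq_continuous_at isCont_def)
  then show ?thesis using assms by (rule order_tendstoD)
qed

text \<open>The bound \<open>B om\<close> for \<open>w s\<close> is uniform for \<open>s\<close> near \<open>t\<close>, since \<open>u s\<close> is bounded by \<open>A om\<close> with \<open>A\<close>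
  independent of \<open>s\<close>. So the constants of \<open>riccati_difference_quotient\<close> do not depend on \<open>s\<close>.\<close>

lemma wdiff_w: assumes t: "\<eta> t < 1/64" shows "wdiff w (gardner.P (u t) (u1 t) (u2 t) (w t)) t"
proof -
  interpret g: gardner "u t" "u1 t" "u2 t" "u3 t" "w t" using gardner t by simp
  obtain A0 where A0: "\<And>x. \<bar>u t x\<bar> \<le> A0 * om x" "0 \<le> A0" using decays_bound_nonneg[OF decays_u(1)] by blast
  obtain Av where Av: "\<And>x. \<bar>V t x\<bar> \<le> Av * om x" "0 \<le> Av" using decays_bound_nonneg[OF decays_V] by blast
  obtain Ap where Ap: "\<And>x. \<bar>g.P x\<bar> \<le> Ap * om x" "0 \<le> Ap" using decays_bound_nonneg[OF g.decays_P] by blast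
  define A where "A = A0 + Av + 1"
  define B where "B = 2 * A + 4 * A\<^sup>2"
  define c where "c = 2 * exp (2 * pi * B)"
  have c: "0 < c" by (simp add: c_def)
  have At: "\<bar>u t x\<bar> \<le> A * om x" for x
    using A0(1)[of x] Av(2) om_pos[of x] unfolding A_def distrib_right by (smt (verit) mult_nonneg_nonneg)
  have As: "\<forall>\<^sub>F s in at t. \<forall>x. \<bar>u s x\<bar> \<le> A * om x"
    unfolding A_def by (rule wdiff_bounded[OF kdv' Av(1) A0(1)])
  show ?thesis unfolding wdiff_def
  proof (intro allI impI)
    fix e :: real assume e: "0 < e"
    define e1 where "e1 = min 1 (e / (2 * c))"
    define d where "d = e / (2 * c) / (c * (Av + 1) * Ap + 1)"
    have k: "0 \<le> c * (Av + 1) * Ap" using c Av Ap by simp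
    have e1: "0 < e1" "e1 \<le> 1" "e1 \<le> e / (2 * c)" using e c by (auto simp: e1_def)
    have d: "0 < d" using e c k by (auto simp: d_def intro!: divide_pos_pos)
    have "\<forall>\<^sub>F s in at t. \<forall>x. \<bar>(u s x - u t x) / (s - t) - V t x\<bar> \<le> e1 * om x"
      using kdv' e1(1) unfolding wdiff_def by blast
    moreover have "\<forall>\<^sub>F s in at t. s \<noteq> t" by (simp add: eventually_at_filter)
    moreover note As \<eta>_near[OF t] eventually_at_close[OF d, of t]
    ultimately show "\<forall>\<^sub>F s in at t. \<forall>x. \<bar>(w s x - w t x) / (s - t) - g.P x\<bar> \<le> e * om x"
    proof eventually_elim
      case (elim s)
      have ws: "gardner_variable s (w s)" "gardner_variable t (w t)" using elim(4) t by (auto intro!: gardner_variable_w)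
      show ?case
      proof
        fix x
        have "\<bar>(w s x - w t x) / (s - t) - g.P x\<bar> \<le> (2 * exp (2 * pi * B)) * (e1 + \<bar>s - t\<bar> * ((2 * exp (2 * pi * B)) * (Av + e1) * Ap)) * om x"
        proof (rule riccati_difference_quotient)
          show "(w t has_real_derivative u t x - 2 * w t x - (w t x)\<^sup>2) (at x)" for x using ws by (simp add: gardner_variable_def)
          show "(w s has_real_derivative u s x - 2 * w s x - (w s x)\<^sup>2) (at x)" for x using ws by (simp add: gardner_variable_def)
          show "\<bar>w t x\<bar> \<le> B * om x" for x using ws(2) At unfolding gardner_variable_def B_def by blast
          show "\<bar>w s x\<bar> \<le> B * om x" for x using ws(1) elim(3) unfolding gardner_variable_def B_def by blast
          show "(g.P has_real_derivative V t x - 2 * g.P x - 2 * w t x * g.P x) (at x)" for x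
            using g.dP by (simp add: V_def)
        qed (use Ap Av elim in auto)
        also have "\<dots> = c * (e1 + \<bar>s - t\<bar> * (c * (Av + e1) * Ap)) * om x" by (simp add: c_def)
        also have "\<dots> \<le> e * om x"
        proof (rule mult_right_mono)
          have "\<bar>s - t\<bar> * (c * (Av + e1) * Ap) \<le> d * (c * (Av + 1) * Ap + 1)"
          proof (rule mult_mono)
            have "c * (Av + e1) * Ap \<le> c * (Av + 1) * Ap"
              using c e1 Ap by (intro mult_right_mono mult_left_mono) auto
            then show "c * (Av + e1) * Ap \<le> c * (Av + 1) * Ap + 1" by simp
          qed (use elim(5) d c e1 Av Ap in auto)
          also have "\<dots> = e / (2 * c)" using k by (simp add: d_def)
          finally have "e1 + \<bar>s - t\<bar> * (c * (Av + e1) * Ap) \<le> e / c" using e1(3) by (simp add: field_simps)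
          then show "c * (e1 + \<bar>s - t\<bar> * (c * (Av + e1) * Ap)) \<le> e" using c by (simp add: field_simps)
        qed (simp add: om_pos less_imp_le)
        finally show "\<bar>(w s x - w t x) / (s - t) - g.P x\<bar> \<le> e * om x" .
      qed
    qed
  qed
qed

lemma J_deriv:
  assumes t: "\<eta> t < 1/64" 
    and \<phi>: "\<And>x. (\<phi> has_real_derivative \<phi>1 x) (at x)" "\<And>x. (\<phi>1 has_real_derivative \<phi>2 x) (at x)"
     "\<And>x. (\<phi>2 has_real_derivative \<phi>3 x) (at x)"
    and b: "bounded_cont \<phi>" "bounded_cont \<phi>1" "bounded_cont \<phi>2" "bounded_cont \<phi>3"
  shows "((\<lambda>s. LINT x|lborel. \<phi> x * (w s x)\<^sup>2) has_real_derivative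
    (LINT x|lborel. \<phi>3 x * (w t x)^2 - 3 * (\<phi>1 x * (gardner.w1 (u t) (w t) x)^2) - 3 * (\<phi>1 x * (w t x)^4) - 8 * (\<phi>1 x * (w t x)^3))) (at t)"
proof -
  interpret g: gardner "u t" "u1 t" "u2 t" "u3 t" "w t" using gardner t by simp
  have "wdiff (\<lambda>s x. (w s x)\<^sup>2) (\<lambda>x. 2 * w t x * g.P x) t"
    by (intro wdiff_square wdiff_w t g.decays_P g.decays_u)
  moreover have "\<forall>\<^sub>F s in at t. decays (\<lambda>x. (w s x)\<^sup>2)"
    using \<eta>_near[OF t] by eventually_elim (intro decays_power decays_w; simp)
  moreover have "decays (\<lambda>x. (w t x)\<^sup>2)" "decays (\<lambda>x. 2 * w t x * g.P x)"
    by (intro decays_power decays_mult decays_cmult g.decays_u g.decays_P; simp)+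
  ultimately show ?thesis
    unfolding g.energy_identity[OF \<phi> b, symmetric] by (intro wdiff_integral[OF _ _ _ _ b(1)])
qed

text \<open>The constants: \<open>\<integral> w\<^sup>2 \<le> 4 / 1536 = 1 / 384\<close> at time \<open>0\<close>, so \<open>\<eta> \<le> 3 / 384 < 1 / 64\<close> as long as
  \<open>\<integral> w\<^sup>2\<close> is conserved.\<close>

lemma global_bound:
  assumes init: "\<eta> 0 \<le> 1/1536"
  shows "\<eta> t < 1/64" "(LINT x|lborel. (w t x)\<^sup>2) \<le> 1/384"
proof -
  define I where "I s = (LINT x|lborel. (w s x)\<^sup>2)" for s
  have w0: "gardner_variable 0 (w 0)" using gardner_variable_w[of 0] init by simp
  have *: "\<eta> t < 1/64 \<and> I t = I 0"
  proof (rule bootstrap[OF \<eta>_cont])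
    show "(I has_real_derivative 0) (at t)" if "\<eta> t < 1/64" for t
      using J_deriv[OF that, of "\<lambda>_. 1" "\<lambda>_. 0" "\<lambda>_. 0" "\<lambda>_. 0"] by (simp add: I_def[abs_def] bounded_cont_const)
    show "\<eta> t \<le> 3 * I t" if "\<eta> t < 1/64" for t using gardner_variable_w[of t] that by (simp add: gardner_variable_def I_def)
    show "\<eta> 0 < 1/64" using init by simp
    show "3 * I 0 < 1/64" using w0 init by (simp add: gardner_variable_def I_def)
  qed
  then show "\<eta> t < 1/64" by simp
  show "(LINT x|lborel. (w t x)\<^sup>2) \<le> 1/384" using * w0 init by (simp add: gardner_variable_def I_def)
qed

end

section \<open>Local smoothing\<close>

context
  fixes x0 :: real
begin
definition "arc0 x = arctan (x - x0)"
definition "arc1 x = 1 / (1 + (x - x0)\<^sup>2)"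
definition "arc2 x = - 2 * (x - x0) / (1 + (x - x0)\<^sup>2)^2"
definition "arc3 x = (6 * (x - x0)\<^sup>2 - 2) / (1 + (x - x0)\<^sup>2)^3"

lemma arc_pos: "0 < 1 + (x - x0)\<^sup>2" by (simp add: add_pos_nonneg)

lemma arc_deriv:
  "(arc0 has_real_derivative arc1 x) (at x)"
  "(arc1 has_real_derivative arc2 x) (at x)"
  "(arc2 has_real_derivative arc3 x) (at x)"
proof -
  have ne: "1 + (x - x0)\<^sup>2 \<noteq> 0" using arc_pos[of x] by simp
  show "(arc0 has_real_derivative arc1 x) (at x)"
    unfolding arc0_def[abs_def] arc1_def by (rule derivative_eq_intros refl)+ (simp add: inverse_eq_divide)
  show "(arc1 has_real_derivative arc2 x) (at x)"
    unfolding arc1_def[abs_def] arc2_def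
    by (rule derivative_eq_intros ne refl)+ (simp add: power2_eq_square)
  have *: "(- 2 * (1 + (x - x0)\<^sup>2)^2 - (- 2 * (x - x0)) * (2 * (1 + (x - x0)\<^sup>2) * (2 * (x - x0)))) / ((1 + (x - x0)\<^sup>2)^2 * (1 + (x - x0)\<^sup>2)^2)
     = (6 * (x - x0)\<^sup>2 - 2) / (1 + (x - x0)\<^sup>2)^3"
  proof -
    define z q where "z = x - x0" and "q = 1 + z\<^sup>2"
    have q: "q \<noteq> 0" using ne by (simp add: q_def z_def)
    have "- 2 * q^2 - (- 2 * z) * (2 * q * (2 * z)) = q * (6 * z\<^sup>2 - 2)"
      by (simp add: q_def power2_eq_square algebra_simps)
    moreover have "q^2 * q^2 = q * q^3" by (simp add: eval_nat_numeral)
    ultimately show ?thesis using q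
      unfolding z_def[symmetric] q_def[symmetric] by (metis nonzero_mult_divide_mult_cancel_left)
  qed
  show "(arc2 has_real_derivative arc3 x) (at x)"
    unfolding arc2_def[abs_def] arc3_def
  proof (rule DERIV_cong[OF DERIV_divide])
    show "((\<lambda>x. - 2 * (x - x0)) has_real_derivative - 2) (at x)" by (auto intro!: derivative_eq_intros)
    show "((\<lambda>x. (1 + (x - x0)\<^sup>2)\<^sup>2) has_real_derivative 2 * (1 + (x - x0)\<^sup>2) * (2 * (x - x0))) (at x)"
      by (auto intro!: derivative_eq_intros)
    show "(1 + (x - x0)\<^sup>2)\<^sup>2 \<noteq> 0" using ne by simp
  qed (rule *)
qed

lemma arc_bounds: "\<bar>arc0 x\<bar> \<le> pi / 2" "0 \<le> arc1 x" "arc1 x \<le> 1" "\<bar>arc2 x\<bar> \<le> 1" "\<bar>arc3 x\<bar> \<le> 6"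
proof -
  define y where "y = x - x0"
  have p: "1 \<le> 1 + y\<^sup>2" by simp
  show "\<bar>arc0 x\<bar> \<le> pi / 2" unfolding arc0_def using arctan_lbound[of "x - x0"] arctan_ubound[of "x - x0"] by linarith
  show "0 \<le> arc1 x" "arc1 x \<le> 1" using arc_pos[of x] by (simp_all add: arc1_def)
  have "2 * \<bar>y\<bar> \<le> (1 + y\<^sup>2)" using zero_le_power2[of "\<bar>y\<bar> - 1"] by (simp add: power2_diff)
  also have "\<dots> \<le> (1 + y\<^sup>2)^2" using self_le_power[OF p, of 2] by simp
  finally have "2 * \<bar>y\<bar> \<le> (1 + y\<^sup>2)^2" .
  moreover have "0 < (1 + y\<^sup>2)^2" using p by (intro zero_less_power) linarith
  ultimately show "\<bar>arc2 x\<bar> \<le> 1" by (simp add: arc2_def y_def[symmetric] abs_mult divide_le_eq_1)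
  have "\<bar>6 * y\<^sup>2 - 2\<bar> \<le> 6 * (1 + y\<^sup>2)" by (simp add: abs_le_iff)
  also have "\<dots> \<le> 6 * (1 + y\<^sup>2)^3" using self_le_power[OF p, of 3] by simp
  finally have "\<bar>6 * y\<^sup>2 - 2\<bar> \<le> 6 * (1 + y\<^sup>2)^3" .
  moreover have "0 < (1 + y\<^sup>2)^3" using p by (intro zero_less_power) linarith
  ultimately show "\<bar>arc3 x\<bar> \<le> 6" by (simp add: arc3_def y_def[symmetric] pos_divide_le_eq abs_divide)
qed

lemma arc_bounded_cont: "bounded_cont arc0" "bounded_cont arc1" "bounded_cont arc2" "bounded_cont arc3"
proof -
  have "continuous_on UNIV arc3" unfolding arc3_def
    by (intro continuous_intros) (metis arc_pos less_numeral_extra(3) power_eq_0_iff)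
  then show "bounded_cont arc0" "bounded_cont arc1" "bounded_cont arc2" "bounded_cont arc3"
    using arc_bounds DERIV_continuous_on_UNIV[OF arc_deriv(1)] DERIV_continuous_on_UNIV[OF arc_deriv(2)] DERIV_continuous_on_UNIV[OF arc_deriv(3)]
    unfolding bounded_cont_def by (auto intro: exI[of _ "pi/2"] exI[of _ 1] exI[of _ 6])
qed

lemma arc1_lower: "x \<in> {x0..x0+1} \<Longrightarrow> 1/2 \<le> arc1 x"
proof -
  assume "x \<in> {x0..x0+1}"
  then have "(x - x0)\<^sup>2 \<le> 1\<^sup>2" by (intro power_mono) auto
  then show ?thesis unfolding arc1_def using arc_pos[of x] by (simp add: field_simps)
qed

end

text \<open>The cubic term is absorbed by two thirds of the quartic one, because \<open>2 w\<^sup>4 + 8 w\<^sup>3 + 8 w\<^sup>2 = 2 (w (w + 2))\<^sup>2\<close>. What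
  remains of \<open>(w')\<^sup>2 + w\<^sup>4\<close> controls \<open>u\<^sup>2\<close> up to a multiple of \<open>w\<^sup>2\<close>.\<close>

lemma smoothing_pointwise:
  fixes a b w w1 u c :: real
  assumes u: "w1 = u - 2 * w - w\<^sup>2" and a: "0 \<le> a" "a \<le> 1" and c: "\<bar>c\<bar> \<le> 6"
  shows "c * w^2 - 3 * (a * w1^2) - 3 * (a * w^4) - 8 * (a * w^3) \<le> 18 * w^2 - 1/3 * (a * u^2)"
proof -
  have 1: "u^2 \<le> 3 * (w1^2 + 4 * w^2 + w^4)"
  proof -
    have "u = w1 + 2 * w + w^2" using u by simp
    moreover have "3 * (p^2 + q^2 + r^2) - (p + q + r)^2 = (p - q)^2 + (q - r)^2 + (p - r)^2" for p q r :: real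
      by (simp add: power2_eq_square algebra_simps)
    from this[of w1 "2*w" "w^2"] have "(w1 + 2 * w + w^2)^2 \<le> 3 * (w1^2 + (2*w)^2 + (w^2)^2)"
      by (smt (verit) zero_le_power2)
    ultimately show ?thesis by (simp add: power_mult_distrib flip: power_mult)
  qed
  have 2: "0 \<le> 2 * w^4 + 8 * w^3 + 8 * w^2"
  proof -
    have "2 * w^4 + 8 * w^3 + 8 * w^2 = 2 * (w * (w + 2))^2" by (simp add: eval_nat_numeral algebra_simps)
    then show ?thesis by simp
  qed
  have "- 3 * w1^2 - 3 * w^4 - 8 * w^3 \<le> 12 * w^2 - 1/3 * u^2" 
  proof -
    have "\<lbrakk>U \<le> 3 * (X + 4 * Y + Z); 0 \<le> 2 * Z + 8 * T + 8 * Y; 0 \<le> X\<rbrakk> \<Longrightarrow> - 3 * X - 3 * Z - 8 * T \<le> 12 * Y - 1/3 * U"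
      for U X Y Z T :: real by argo
    from this[OF 1 2 zero_le_power2] show ?thesis .
  qed
  from mult_left_mono[OF this a(1)] have "a * (- 3 * w1^2 - 3 * w^4 - 8 * w^3) \<le> 12 * (a * w^2) - 1/3 * (a * u^2)"
    by (simp add: algebra_simps)
  moreover have "a * w^2 \<le> w^2" using a by (simp add: mult_left_le_one_le)
  moreover have "c * w^2 \<le> 6 * w^2" using c by (intro mult_right_mono) auto
  ultimately show ?thesis by (simp add: algebra_simps)
qed

context kdv_flow_smooth begin

lemma u_continuous: "continuous_on UNIV (\<lambda>(t, x). u t x)"
proof (intro continuous_at_imp_continuous_on ballI)
  fix p :: "real \<times> real"
  obtain t x where p: "p = (t, x)" by (cases p)
  obtain Av where Av: "\<And>x. \<bar>V t x\<bar> \<le> Av * om x" "0 \<le> Av" using decays_bound_nonneg[OF decays_V] by blast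
  show "isCont (\<lambda>(t, x). u t x) p" unfolding p isCont_def
  proof (rule tendstoI)
    fix e :: real assume e: "0 < e"
    define d where "d = e / 2 / (Av + 1)"
    have Av1: "0 < Av + 1" using Av(2) by simp
    have d: "0 < d" using e Av1 unfolding d_def by (intro divide_pos_pos) auto
    have d': "d * (Av + 1) = e / 2" by (rule nonzero_eq_divide_eq[THEN iffD1, OF Av1[THEN less_imp_neq, symmetric] d_def])
    have "\<forall>\<^sub>F s in at t. \<forall>y. \<bar>u s y - u t y\<bar> < e / 2"
      using wdiff_increment[OF kdv' Av(1)] eventually_at_close[OF d]
    proof eventually_elim
      case (elim s)
      show ?case
      proof
        fix y
        have "\<bar>u s y - u t y\<bar> \<le> \<bar>s - t\<bar> * ((Av + 1) * om y)" using elim(1) by blast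
        also have "\<dots> \<le> \<bar>s - t\<bar> * (Av + 1)" using Av(2) om_le_1[of y] by (intro mult_left_mono) (auto simp: mult_left_le)
        also have "\<dots> < d * (Av + 1)" using elim(2) Av(2) by (intro mult_strict_right_mono) auto
        finally show "\<bar>u s y - u t y\<bar> < e / 2" using d' by simp
      qed
    qed
    then obtain d1 where d1: "0 < d1" "\<And>s y. s \<noteq> t \<Longrightarrow> dist s t < d1 \<Longrightarrow> \<bar>u s y - u t y\<bar> < e / 2"
      unfolding eventually_at by auto
    have "isCont (u t) x" by (rule DERIV_isCont[OF du(1)])
    then obtain d2 where d2: "0 < d2" "\<And>y. dist y x < d2 \<Longrightarrow> dist (u t y) (u t x) < e / 2"
      using e unfolding continuous_at_eps_delta by (metis half_gt_zero)
    show "\<forall>\<^sub>F z in at (t, x). dist (case z of (t, x) \<Rightarrow> u t x) (case (t, x) of (t, x) \<Rightarrow> u t x) < e"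
      unfolding eventually_at
    proof (intro exI[of _ "min d1 d2"] conjI ballI impI)
      fix z :: "real \<times> real" assume z: "z \<noteq> (t, x) \<and> dist z (t, x) < min d1 d2"
      obtain s y where zz: "z = (s, y)" by (cases z)
      have "dist s t < d1" "dist y x < d2" using z dist_fst_le[of z "(t,x)"] dist_snd_le[of z "(t,x)"] by (auto simp: zz)
      then have "\<bar>u s y - u t y\<bar> < e / 2" "\<bar>u t y - u t x\<bar> < e / 2"
        using d1(2)[of s y] d2(2)[of y] e by (cases "s = t"; simp add: dist_real_def)+
      then show "dist (case z of (t, x) \<Rightarrow> u t x) (case (t, x) of (t, x) \<Rightarrow> u t x) < e"
        unfolding zz dist_real_def by simp argo
    qed (use d1 d2 in auto)
  qed
qed

text \<open>The energy identity with \<open>\<phi> = arctan (x - x0)\<close> reads \<open>g \<le> 54 I - 3 J'\<close>, where \<open>g = \<integral> \<phi>' u\<^sup>2\<close> and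
  \<open>J = \<integral> \<phi> w\<^sup>2\<close> is bounded by \<open>\<pi> I / 2\<close>; and \<open>\<phi>' \<ge> 1/2\<close> on the unit interval that starts at \<open>x0\<close>.\<close>

lemma local_smoothing:
  assumes init: "\<eta> 0 \<le> 1/1536"
  shows "(\<integral>\<^sup>+t. (\<integral>\<^sup>+x. ennreal ((u t x)\<^sup>2) * indicator {x0..x0+1} x \<partial>lborel) * indicator {a..a+1} t \<partial>lborel) \<le> 1"
proof -
  define g where "g t = (LINT x|lborel. arc1 x0 x * (u t x)\<^sup>2)" for t
  define J where "J t = (LINT x|lborel. arc0 x0 x * (w t x)\<^sup>2)" for t
  define J' where "J' t = (LINT x|lborel. arc3 x0 x * (w t x)^2 - 3 * (arc1 x0 x * (gardner.w1 (u t) (w t) x)^2) - 3 * (arc1 x0 x * (w t x)^4) - 8 * (arc1 x0 x * (w t x)^3))" for t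
  define I0 :: real where "I0 = 1 / 384"
  have \<eta>t: "\<eta> t < 1/64" for t by (rule global_bound(1)[OF init])
  have It: "(LINT x|lborel. (w t x)\<^sup>2) \<le> I0" for t unfolding I0_def by (rule global_bound(2)[OF init])
  have dw2: "decays (\<lambda>x. (w t x)\<^sup>2)" for t using \<eta>t[of t] by (intro decays_power decays_w) auto
  have du2: "decays (\<lambda>x. arc1 x0 x * (u t x)\<^sup>2)" for t by (intro decays_mult_left arc_bounded_cont decays_power decays_u) simp
  have dJ: "(J has_real_derivative J' t) (at t)" for t
    unfolding J_def[abs_def] J'_def by (rule J_deriv[OF \<eta>t arc_deriv arc_bounded_cont])
  have Jb: "\<bar>J t\<bar> \<le> pi / 2 * I0" for t
  proof -
    have "\<bar>J t\<bar> \<le> (LINT x|lborel. pi / 2 * (w t x)\<^sup>2)" unfolding J_def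
    proof (rule Bochner_Integration.integral_abs_bound_integral)
      show "integrable lborel (\<lambda>x. arc0 x0 x * (w t x)\<^sup>2)" by (intro decays_integrable decays_mult_left arc_bounded_cont dw2)
      show "integrable lborel (\<lambda>x. pi / 2 * (w t x)\<^sup>2)" by (intro decays_integrable decays_cmult dw2)
      show "\<bar>arc0 x0 x * (w t x)\<^sup>2\<bar> \<le> pi / 2 * (w t x)\<^sup>2" for x
        unfolding abs_mult using arc_bounds(1)[of x0 x] by (intro mult_mono) auto
    qed
    also have "\<dots> \<le> pi / 2 * I0" using It[of t] by simp
    finally show ?thesis .
  qed
  have J'b: "J' t \<le> 18 * I0 - 1/3 * g t" for t
  proof -
    interpret g: gardner "u t" "u1 t" "u2 t" "u3 t" "w t" using gardner \<eta>t[of t] by simp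
    have "J' t \<le> (LINT x|lborel. 18 * (w t x)^2 - 1/3 * (arc1 x0 x * (u t x)^2))" unfolding J'_def
    proof (rule integral_mono)
      show "integrable lborel (\<lambda>x. arc3 x0 x * (w t x)^2 - 3 * (arc1 x0 x * (g.w1 x)^2) - 3 * (arc1 x0 x * (w t x)^4) - 8 * (arc1 x0 x * (w t x)^3))"
        by (intro decays_integrable decays_diff decays_cmult decays_mult_left[OF arc_bounded_cont(4)] decays_mult_left[OF arc_bounded_cont(2)] decays_power g.decays_u g.decays_w) simp_all
      show "integrable lborel (\<lambda>x. 18 * (w t x)^2 - 1/3 * (arc1 x0 x * (u t x)^2))"
        by (intro decays_integrable decays_diff decays_cmult dw2 du2)
      show "arc3 x0 x * (w t x)^2 - 3 * (arc1 x0 x * (g.w1 x)^2) - 3 * (arc1 x0 x * (w t x)^4) - 8 * (arc1 x0 x * (w t x)^3)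
          \<le> 18 * (w t x)^2 - 1/3 * (arc1 x0 x * (u t x)^2)" for x
        by (rule smoothing_pointwise) (use arc_bounds[of x0 x] in \<open>auto simp: g.w1_def\<close>)
    qed
    also have "\<dots> = 18 * (LINT x|lborel. (w t x)^2) - 1/3 * g t"
      using decays_integrable[OF dw2[of t]] decays_integrable[OF du2[of t]]
      by (simp add: g_def Bochner_Integration.integral_diff)
    also have "\<dots> \<le> 18 * I0 - 1/3 * g t" using It[of t] by simp
    finally show ?thesis .
  qed
  have gc: "continuous_on UNIV g"
  proof (intro continuous_at_imp_continuous_on ballI)
    fix t
    have "((\<lambda>s. LINT x|lborel. arc1 x0 x * (u s x)\<^sup>2) has_real_derivative (LINT x|lborel. arc1 x0 x * (2 * u t x * V t x))) (at t)"
      by (rule wdiff_integral[OF wdiff_square[OF kdv' decays_u(1) decays_V]])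
        (auto intro!: always_eventually decays_power decays_mult decays_cmult decays_u decays_V arc_bounded_cont)
    then show "isCont g t" unfolding g_def[abs_def] by (rule DERIV_isCont)
  qed
  have g0: "0 \<le> g t" for t unfolding g_def
    by (intro Bochner_Integration.integral_nonneg mult_nonneg_nonneg arc_bounds) simp
  (* An antiderivative of g; it starts at a - 1 so that it is differentiable at both ends of {a..a+1}. *)
  define F where "F t = integral {a-1..t} g" for t
  have dF: "(F has_real_derivative g t) (at t)" if "a \<le> t" "t \<le> a + 1" for t
  proof -
    have "(F has_real_derivative g t) (at t within {a-1..a+2})" unfolding F_def
      by (rule integral_has_real_derivative) (use that gc in \<open>auto intro: continuous_on_subset\<close>)
    then show ?thesis using that by (simp add: at_within_interior[of t "{a-1..a+2}"])
  qed
  have "F (a + 1) + 3 * J (a + 1) - 54 * I0 * (a + 1) \<le> F a + 3 * J a - 54 * I0 * a"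
  proof (rule DERIV_nonpos_imp_nonincreasing[of a "a + 1" "\<lambda>t. F t + 3 * J t - 54 * I0 * t"])
    fix t assume t: "a \<le> t" "t \<le> a + 1"
    have "((\<lambda>t. F t + 3 * J t - 54 * I0 * t) has_real_derivative (g t + 3 * J' t - 54 * I0)) (at t)"
      by (rule derivative_eq_intros dF[OF t] dJ refl)+ simp
    moreover have "g t + 3 * J' t - 54 * I0 \<le> 0" using J'b[of t] by simp
    ultimately show "\<exists>y. ((\<lambda>t. F t + 3 * J t - 54 * I0 * t) has_real_derivative y) (at t) \<and> y \<le> 0" by blast
  qed simp
  then have Fb: "F (a + 1) - F a \<le> 1/2"
    using Jb[of a] Jb[of "a+1"] pi_less_4 unfolding I0_def by argo
  have inner: "(\<integral>\<^sup>+x. ennreal ((u t x)\<^sup>2) * indicator {x0..x0+1} x \<partial>lborel) \<le> ennreal (2 * g t)" for t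
  proof -
    have "(\<integral>\<^sup>+x. ennreal ((u t x)\<^sup>2) * indicator {x0..x0+1} x \<partial>lborel) \<le> (\<integral>\<^sup>+x. ennreal (2 * (arc1 x0 x * (u t x)\<^sup>2)) \<partial>lborel)"
    proof (rule nn_integral_mono)
      fix x
      have "(u t x)\<^sup>2 \<le> 2 * (arc1 x0 x * (u t x)\<^sup>2)" if "x \<in> {x0..x0+1}"
        using mult_right_mono[OF arc1_lower[OF that], of "(u t x)\<^sup>2"] by simp
      then show "ennreal ((u t x)\<^sup>2) * indicator {x0..x0+1} x \<le> ennreal (2 * (arc1 x0 x * (u t x)\<^sup>2))"
        by (auto simp: indicator_def intro!: ennreal_leI)
    qed
    also have "\<dots> = ennreal (LINT x|lborel. 2 * (arc1 x0 x * (u t x)\<^sup>2))"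
      by (rule nn_integral_eq_integral) (use decays_integrable[OF du2] arc_bounds(2) in \<open>auto intro!: AE_I2\<close>)
    also have "\<dots> = ennreal (2 * g t)" by (simp add: g_def)
    finally show ?thesis .
  qed
  have "(\<integral>\<^sup>+t. (\<integral>\<^sup>+x. ennreal ((u t x)\<^sup>2) * indicator {x0..x0+1} x \<partial>lborel) * indicator {a..a+1} t \<partial>lborel)
    \<le> (\<integral>\<^sup>+t. ennreal (2 * g t) * indicator {a..a+1} t \<partial>lborel)"
    by (intro nn_integral_mono mult_right_mono inner) simp
  also have "\<dots> = ennreal (2 * F (a + 1) - 2 * F a)"
  proof (rule nn_integral_FTC_Icc)
    show "(\<lambda>t. 2 * g t) \<in> borel_measurable borel" by (intro borel_measurable_continuous_onI continuous_intros gc)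
    show "((\<lambda>t. 2 * F t) has_real_derivative 2 * g t) (at t)" if "t \<in> {a..a+1}" for t
      using that by (intro DERIV_cmult dF) auto
  qed (use g0 in auto)
  also have "\<dots> \<le> ennreal 1" using Fb by (intro ennreal_leI) simp
  finally show ?thesis by simp
qed

end

section \<open>Schwartz functions\<close>

text \<open>A coinduction principle: a class of rapidly decreasing functions that is closed under
  differentiation consists of Schwartz functions. All closure properties below are instances; for
  a product with \<open>x\<close>, for example, the class consists of the functions \<open>x f + g\<close>.\<close>

lemma schwartz_coinduct:
  assumes P: "P f" and step: "\<And>f. P f \<Longrightarrow> (\<forall>x. f differentiable (at x)) \<and> (\<forall>k. bounded (range (\<lambda>x. x ^ k * f x))) \<and> P (deriv f)"
  shows "schwartz f"
proof -
  have "P ((deriv ^^ n) f)" for n by (induction n) (auto simp: P step)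
  then show ?thesis using step unfolding schwartz_def by blast
qed

lemma schwartzD:
  assumes "schwartz f"
  shows "(f has_real_derivative deriv f x) (at x)" "bounded (range (\<lambda>x. x ^ k * f x))" "schwartz (deriv f)" "f differentiable (at x)"
proof -
  have 1: "(deriv ^^ n) f differentiable (at x)" "bounded (range (\<lambda>x. x ^ k * (deriv ^^ n) f x))" for n k x
    using assms by (auto simp: schwartz_def)
  from 1(1)[of 0 x] show d: "f differentiable (at x)" by simp
  then show "(f has_real_derivative deriv f x) (at x)"
    using DERIV_deriv_iff_real_differentiable by blast
  from 1(2)[of k 0] show "bounded (range (\<lambda>x. x ^ k * f x))" by simp
  show "schwartz (deriv f)" unfolding schwartz_def
    using 1(1)[of "Suc _"] 1(2)[of _ "Suc _"] by (simp add: funpow_swap1)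
qed

lemma schwartz_derivI:
  assumes "P f"
    and step: "\<And>f. P f \<Longrightarrow> \<exists>f'. P f' \<and> (\<forall>x. (f has_real_derivative f' x) (at x)) \<and> (\<forall>k. bounded (range (\<lambda>x. x ^ k * f x)))"
  shows "schwartz f"
proof (rule schwartz_coinduct[of P])
  fix f assume "P f"
  then obtain f' where f': "P f'" "\<And>x. (f has_real_derivative f' x) (at x)" "\<forall>k. bounded (range (\<lambda>x. x ^ k * f x))"
    using step by blast
  have "deriv f = f'" using f'(2) by (intro ext DERIV_imp_deriv)
  then show "(\<forall>x. f differentiable at x) \<and> (\<forall>k. bounded (range (\<lambda>x. x ^ k * f x))) \<and> P (deriv f)"
    using f' by (auto simp: real_differentiable_def)
qed fact

lemma bounded_range_add:
  fixes f g :: "'a \<Rightarrow> real"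
  shows "bounded (range f) \<Longrightarrow> bounded (range g) \<Longrightarrow> bounded (range (\<lambda>x. f x + g x))"
  by (rule bounded_plus_comp)

lemma bounded_range_cmult:
  fixes f :: "'a \<Rightarrow> real"
  shows "bounded (range f) \<Longrightarrow> bounded (range (\<lambda>x. c * f x))"
  using bounded_scaling[of "range f" c] by (simp add: image_image)

lemma schwartz_add: assumes "schwartz f" "schwartz g" shows "schwartz (\<lambda>x. f x + g x)"
proof (rule schwartz_derivI[of "\<lambda>h. \<exists>f g. schwartz f \<and> schwartz g \<and> h = (\<lambda>x. f x + g x)"])
  fix h assume "\<exists>f g. schwartz f \<and> schwartz g \<and> h = (\<lambda>x. f x + g x)"
  then obtain f g where s: "schwartz f" "schwartz g" and h: "h = (\<lambda>x. f x + g x)" by blast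
  show "\<exists>f'. (\<exists>f g. schwartz f \<and> schwartz g \<and> f' = (\<lambda>x. f x + g x)) \<and> (\<forall>x. (h has_real_derivative f' x) (at x)) \<and> (\<forall>k. bounded (range (\<lambda>x. x ^ k * h x)))"
  proof (rule exI[of _ "\<lambda>x. deriv f x + deriv g x"], intro conjI allI)
    show "\<exists>fa ga. schwartz fa \<and> schwartz ga \<and> (\<lambda>x. deriv f x + deriv g x) = (\<lambda>x. fa x + ga x)"
      using s schwartzD(3) by blast
    show "(h has_real_derivative deriv f x + deriv g x) (at x)" for x
      unfolding h by (intro DERIV_add schwartzD(1) s)
    show "bounded (range (\<lambda>x. x ^ k * h x))" for k
      unfolding h distrib_left by (intro bounded_range_add schwartzD s)
  qed
qed (use assms in blast)

lemma schwartz_cmult: assumes "schwartz f" shows "schwartz (\<lambda>x. c * f x)"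
proof (rule schwartz_derivI[of "\<lambda>h. \<exists>f. schwartz f \<and> h = (\<lambda>x. c * f x)"])
  fix h assume "\<exists>f. schwartz f \<and> h = (\<lambda>x. c * f x)"
  then obtain f where s: "schwartz f" and h: "h = (\<lambda>x. c * f x)" by blast
  show "\<exists>f'. (\<exists>f. schwartz f \<and> f' = (\<lambda>x. c * f x)) \<and> (\<forall>x. (h has_real_derivative f' x) (at x)) \<and> (\<forall>k. bounded (range (\<lambda>x. x ^ k * h x)))"
  proof (rule exI[of _ "\<lambda>x. c * deriv f x"], intro conjI allI)
    show "\<exists>fa. schwartz fa \<and> (\<lambda>x. c * deriv f x) = (\<lambda>x. c * fa x)" using s schwartzD(3) by blast
    show "(h has_real_derivative c * deriv f x) (at x)" for x unfolding h by (intro DERIV_cmult schwartzD(1) s)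
    show "bounded (range (\<lambda>x. x ^ k * h x))" for k
      unfolding h mult.left_commute[of _ c] by (intro bounded_range_cmult schwartzD s)
  qed
qed (use assms in blast)

lemma schwartz_minus: "schwartz f \<Longrightarrow> schwartz (\<lambda>x. - f x)"
  using schwartz_cmult[of f "-1"] by simp

lemma schwartz_diff: "schwartz f \<Longrightarrow> schwartz g \<Longrightarrow> schwartz (\<lambda>x. f x - g x)"
  using schwartz_add[OF _ schwartz_minus, of f g] by simp

lemma schwartz_mult_x: assumes "schwartz f" shows "schwartz (\<lambda>x. x * f x)"
proof -
  have "schwartz (\<lambda>x. x * f x + 0 * f x)"
  proof (rule schwartz_derivI[of "\<lambda>h. \<exists>f g. schwartz f \<and> schwartz g \<and> h = (\<lambda>x. x * f x + g x)"])
    fix h assume "\<exists>f g. schwartz f \<and> schwartz g \<and> h = (\<lambda>x. x * f x + g x)"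
    then obtain f g where s: "schwartz f" "schwartz g" and h: "h = (\<lambda>x. x * f x + g x)" by blast
    show "\<exists>f'. (\<exists>f g. schwartz f \<and> schwartz g \<and> f' = (\<lambda>x. x * f x + g x)) \<and> (\<forall>x. (h has_real_derivative f' x) (at x)) \<and> (\<forall>k. bounded (range (\<lambda>x. x ^ k * h x)))"
    proof (rule exI[of _ "\<lambda>x. x * deriv f x + (f x + deriv g x)"], intro conjI allI)
      show "\<exists>fa ga. schwartz fa \<and> schwartz ga \<and> (\<lambda>x. x * deriv f x + (f x + deriv g x)) = (\<lambda>x. x * fa x + ga x)"
        using schwartzD(3)[OF s(1)] schwartz_add[OF s(1) schwartzD(3)[OF s(2)]] by blast
      show "(h has_real_derivative x * deriv f x + (f x + deriv g x)) (at x)" for x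
        unfolding h by (rule derivative_eq_intros schwartzD(1)[OF s(1)] schwartzD(1)[OF s(2)] refl)+ simp
      have "bounded (range (\<lambda>x. x ^ Suc k * f x + x ^ k * g x))" for k
        by (intro bounded_range_add schwartzD s)
      then show "bounded (range (\<lambda>x. x ^ k * h x))" for k
        unfolding h by (simp add: distrib_left mult_ac)
    qed
  next
    show "\<exists>fa g. schwartz fa \<and> schwartz g \<and> (\<lambda>x. x * f x + 0 * f x) = (\<lambda>x. x * fa x + g x)"
      using assms schwartz_cmult[OF assms, of 0] by blast
  qed
  then show ?thesis by simp
qed

lemma schwartz_reflect: assumes "schwartz f" shows "schwartz (\<lambda>x. f (- x))"
proof (rule schwartz_derivI[of "\<lambda>h. \<exists>f. schwartz f \<and> h = (\<lambda>x. f (- x))"])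
  fix h assume "\<exists>f. schwartz f \<and> h = (\<lambda>x. f (- x))"
  then obtain f where s: "schwartz f" and h: "h = (\<lambda>x. f (- x))" by blast
  show "\<exists>f'. (\<exists>f. schwartz f \<and> f' = (\<lambda>x. f (- x))) \<and> (\<forall>x. (h has_real_derivative f' x) (at x)) \<and> (\<forall>k. bounded (range (\<lambda>x. x ^ k * h x)))"
  proof (rule exI[of _ "\<lambda>x. - deriv f (- x)"], intro conjI allI)
    show "\<exists>fa. schwartz fa \<and> (\<lambda>x. - deriv f (- x)) = (\<lambda>x. fa (- x))"
      using schwartz_minus[OF schwartzD(3)[OF s]] by blast
    show "(h has_real_derivative - deriv f (- x)) (at x)" for x
      unfolding h using DERIV_chain2[OF schwartzD(1)[OF s] DERIV_minus[OF DERIV_ident], of x] by simp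
    show "bounded (range (\<lambda>x. x ^ k * h x))" for k
    proof -
      obtain B where B: "\<And>x. \<bar>x ^ k * f x\<bar> \<le> B" using schwartzD(2)[OF s, of k] by (auto simp: bounded_iff)
      have "\<bar>x ^ k * h x\<bar> \<le> B" for x using B[of "- x"] by (simp add: h abs_mult power_abs)
      then show ?thesis by (auto simp: bounded_iff)
    qed
  qed
qed (use assms in blast)

lemma schwartz_shift: assumes "schwartz f" shows "schwartz (\<lambda>x. f (x + a))"
proof (rule schwartz_derivI[of "\<lambda>h. \<exists>f. schwartz f \<and> h = (\<lambda>x. f (x + a))"])
  fix h assume "\<exists>f. schwartz f \<and> h = (\<lambda>x. f (x + a))"
  then obtain f where s: "schwartz f" and h: "h = (\<lambda>x. f (x + a))" by blast
  show "\<exists>f'. (\<exists>f. schwartz f \<and> f' = (\<lambda>x. f (x + a))) \<and> (\<forall>x. (h has_real_derivative f' x) (at x)) \<and> (\<forall>k. bounded (range (\<lambda>x. x ^ k * h x)))"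
  proof (rule exI[of _ "\<lambda>x. deriv f (x + a)"], intro conjI allI)
    show "\<exists>fa. schwartz fa \<and> (\<lambda>x. deriv f (x + a)) = (\<lambda>x. fa (x + a))" using schwartzD(3)[OF s] by blast
    show "(h has_real_derivative deriv f (x + a)) (at x)" for x
      unfolding h using schwartzD(1)[OF s, of "x + a"] by (simp add: DERIV_shift)
    have *: "bounded (range (\<lambda>x. x ^ k * g (x + a)))" if "schwartz g" for k g using that
    proof (induction k arbitrary: g)
      case 0
      have "range (\<lambda>x. g (x + a)) \<subseteq> range g" by auto
      then show ?case using schwartzD(2)[OF 0, of 0] bounded_subset by auto
    next
      case (Suc k)
      have "x ^ Suc k * g (x + a) = x ^ k * ((x + a) * g (x + a)) + (- a) * (x ^ k * g (x + a))" for x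
        by (simp add: algebra_simps)
      then show ?case
        using bounded_range_add[OF Suc.IH[OF schwartz_mult_x[OF Suc.prems]] bounded_range_cmult[OF Suc.IH[OF Suc.prems], of "- a"]]
        by simp
    qed
    then show "bounded (range (\<lambda>x. x ^ k * h x))" for k unfolding h using s by blast
  qed
qed (use assms in blast)

lemma schwartz_continuous: "schwartz f \<Longrightarrow> continuous_on UNIV f"
  by (rule DERIV_continuous_on_UNIV[OF schwartzD(1)])

lemma schwartz_measurable [measurable_dest]: "schwartz f \<Longrightarrow> f \<in> borel_measurable borel"
  by (intro borel_measurable_continuous_onI schwartz_continuous)

lemma decaysI:
  assumes "continuous_on UNIV f" "\<And>x. \<bar>f x\<bar> \<le> B" "\<And>x. \<bar>x\<^sup>2 * f x\<bar> \<le> C"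
  shows "\<bar>f x\<bar> \<le> (4 * B + C) * om x" "decays f"
proof -
  have b: "\<bar>f x\<bar> \<le> (4 * B + C) * om x" for x
  proof -
    have p: "0 < 4 + x\<^sup>2" by (simp add: add_pos_nonneg)
    have "\<bar>f x\<bar> * (4 + x\<^sup>2) = 4 * \<bar>f x\<bar> + \<bar>x\<^sup>2 * f x\<bar>" by (simp add: abs_mult algebra_simps)
    also have "\<dots> \<le> 4 * B + C" using assms(2,3)[of x] by simp
    finally show ?thesis using p by (simp add: om_def pos_le_divide_eq)
  qed
  then show "\<bar>f x\<bar> \<le> (4 * B + C) * om x" "decays f" using assms(1) by (auto simp: decays_def)
qed

lemma schwartz_decays: assumes "schwartz f" shows "decays f"
proof -
  obtain B where B: "\<bar>f x\<bar> \<le> B" for x using schwartzD(2)[OF assms, of 0] by (auto simp: bounded_iff)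
  obtain C where C: "\<bar>x\<^sup>2 * f x\<bar> \<le> C" for x using schwartzD(2)[OF assms, of 2] by (auto simp: bounded_iff)
  show ?thesis by (rule decaysI(2)[OF schwartz_continuous[OF assms] B C])
qed

lemma schwartz_integrable: "schwartz f \<Longrightarrow> integrable lborel f"
  by (intro decays_integrable schwartz_decays)

lemma schwartz_seminorm_bound:
  assumes "schwartz f" shows "\<bar>x ^ k * (deriv ^^ n) f x\<bar> \<le> schwartz_seminorm k n f"
  unfolding schwartz_seminorm_def
proof (rule cSUP_upper)
  have "bounded (range (\<lambda>x. x ^ k * (deriv ^^ n) f x))" using assms by (simp add: schwartz_def)
  then obtain B where B: "\<And>x. \<bar>x ^ k * (deriv ^^ n) f x\<bar> \<le> B" by (auto simp: bounded_iff)
  show "bdd_above (range (\<lambda>x. \<bar>x ^ k * (deriv ^^ n) f x\<bar>))" by (rule bdd_aboveI2[OF B])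
qed simp

section \<open>Cosine and sine transforms\<close>

text \<open>Up to sign and normalization, the real and the imaginary part of the Fourier transform. Working with
  them separately keeps everything inside real-valued Schwartz functions.\<close>

definition cosT :: "(real \<Rightarrow> real) \<Rightarrow> real \<Rightarrow> real" where "cosT f \<xi> = (LINT x|lborel. cos (\<xi> * x) * f x)"
definition sinT :: "(real \<Rightarrow> real) \<Rightarrow> real \<Rightarrow> real" where "sinT f \<xi> = (LINT x|lborel. sin (\<xi> * x) * f x)"

lemma trig_integrable:
  fixes f :: "real \<Rightarrow> real"
  assumes "integrable lborel f"
  shows "integrable lborel (\<lambda>x. cos (\<xi> * x) * f x)" "integrable lborel (\<lambda>x. sin (\<xi> * x) * f x)"
proof -
  have m[measurable]: "f \<in> borel_measurable borel" using borel_measurable_integrable[OF assms] by simp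
  have [measurable]: "(\<lambda>x. cos (\<xi> * x)) \<in> borel_measurable borel"
    by (intro borel_measurable_continuous_onI continuous_intros)
  have [measurable]: "(\<lambda>x. sin (\<xi> * x)) \<in> borel_measurable borel"
    by (intro borel_measurable_continuous_onI continuous_intros)
  have b: "norm (cos (\<xi> * x) * f x) \<le> norm (f x)" "norm (sin (\<xi> * x) * f x) \<le> norm (f x)" for x
    by (simp_all add: abs_mult mult_left_le_one_le)
  show "integrable lborel (\<lambda>x. cos (\<xi> * x) * f x)"
    by (rule Bochner_Integration.integrable_bound[OF assms]) (use b in \<open>simp_all del: norm_mult real_norm_def\<close>)
  show "integrable lborel (\<lambda>x. sin (\<xi> * x) * f x)"
    by (rule Bochner_Integration.integrable_bound[OF assms]) (use b in \<open>simp_all del: norm_mult real_norm_def\<close>)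
qed

lemma trig_bound:
  assumes "integrable lborel f"
  shows "\<bar>cosT f \<xi>\<bar> \<le> (LINT x|lborel. \<bar>f x\<bar>)" "\<bar>sinT f \<xi>\<bar> \<le> (LINT x|lborel. \<bar>f x\<bar>)"
  unfolding cosT_def sinT_def
  by (intro Bochner_Integration.integral_abs_bound_integral trig_integrable assms integrable_abs; simp add: abs_mult mult_left_le_one_le)+

lemma cosT_minus: "cosT (\<lambda>x. - f x) = (\<lambda>\<xi>. - cosT f \<xi>)" and sinT_minus: "sinT (\<lambda>x. - f x) = (\<lambda>\<xi>. - sinT f \<xi>)"
  by (auto simp: cosT_def sinT_def)
lemma cosT_cmult: "cosT (\<lambda>x. c * f x) = (\<lambda>\<xi>. c * cosT f \<xi>)" and sinT_cmult: "sinT (\<lambda>x. c * f x) = (\<lambda>\<xi>. c * sinT f \<xi>)"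
  by (auto simp: cosT_def sinT_def mult.left_commute)

lemma trig_add:
  assumes "integrable lborel f" "integrable lborel g"
  shows "cosT (\<lambda>x. f x + g x) \<xi> = cosT f \<xi> + cosT g \<xi>" "sinT (\<lambda>x. f x + g x) \<xi> = sinT f \<xi> + sinT g \<xi>"
  using trig_integrable[OF assms(1)] trig_integrable[OF assms(2)] by (simp_all add: cosT_def sinT_def distrib_left)

lemma trig_taylor:
  fixes a b :: real
  shows "\<bar>cos b - cos a + (b - a) * sin a\<bar> \<le> (b - a)\<^sup>2" "\<bar>sin b - sin a - (b - a) * cos a\<bar> \<le> (b - a)\<^sup>2"
proof -
  define h where "h = b - a"
  have c: "\<bar>cos h - 1\<bar> \<le> h\<^sup>2 / 2"
  proof -
    have "\<bar>sin (h / 2)\<bar> \<le> \<bar>h / 2\<bar>" by (rule abs_sin_x_le_abs_x)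
    then have "(sin (h / 2))\<^sup>2 \<le> (h / 2)\<^sup>2" by (simp only: abs_le_square_iff)
    moreover have "cos h = 1 - 2 * (sin (h / 2))\<^sup>2" using cos_double_sin[of "h / 2"] by simp
    ultimately show ?thesis by (simp add: power_divide)
  qed
  have s: "\<bar>sin h - h\<bar> \<le> h\<^sup>2 / 2"
    using Maclaurin_sin_bound[of h 2] by (simp add: sin_coeff_def numeral_2_eq_2 field_simps)
  have b: "b = a + h" by (simp add: h_def)
  have 1: "cos b - cos a + h * sin a = cos a * (cos h - 1) - sin a * (sin h - h)"
    by (simp add: b cos_add algebra_simps)
  have 2: "sin b - sin a - h * cos a = sin a * (cos h - 1) + cos a * (sin h - h)"
    by (simp add: b sin_add algebra_simps)
  have m: "\<bar>x * (cos h - 1)\<bar> \<le> h\<^sup>2 / 2" "\<bar>x * (sin h - h)\<bar> \<le> h\<^sup>2 / 2" if "\<bar>x\<bar> \<le> 1" for x :: real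
    using mult_mono[OF that c] mult_mono[OF that s] by (simp_all add: abs_mult)
  show "\<bar>cos b - cos a + (b - a) * sin a\<bar> \<le> (b - a)\<^sup>2" "\<bar>sin b - sin a - (b - a) * cos a\<bar> \<le> (b - a)\<^sup>2"
    unfolding h_def[symmetric] 1 2
    using m[OF abs_cos_le_one[of a]] m[OF abs_sin_le_one[of a]] by linarith+
qed

text \<open>Differentiation under the integral sign is an instance of differentiability in time, with the
  frequency in the role of time: by the second-order Taylor remainder the error of the difference
  quotient is at most \<open>|s - \<xi>| |x\<^sup>2 f|\<close>.\<close>

lemma wdiff_trig:
  assumes f: "schwartz f"
  shows "wdiff (\<lambda>s x. cos (s * x) * f x) (\<lambda>x. - (sin (\<xi> * x) * (x * f x))) \<xi>"
    and "wdiff (\<lambda>s x. sin (s * x) * f x) (\<lambda>x. cos (\<xi> * x) * (x * f x)) \<xi>"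
proof -
  have "decays (\<lambda>x. x * (x * f x))" by (intro schwartz_decays schwartz_mult_x f)
  then obtain C where C: "0 \<le> C" "\<And>x. \<bar>x * (x * f x)\<bar> \<le> C * om x" by (rule decays_bound_nonneg) blast
  have key: "\<forall>\<^sub>F s in at \<xi>. \<forall>x. \<bar>(T (s * x) * f x - T (\<xi> * x) * f x) / (s - \<xi>) - T' (\<xi> * x) * (x * f x)\<bar> \<le> e * om x"
    if T: "\<And>a b. \<bar>T b - T a - (b - a) * T' a\<bar> \<le> (b - a)\<^sup>2" and e: "0 < e" for T T' :: "real \<Rightarrow> real" and e
  proof -
    have d: "0 < e / (C + 1)" using e C by simp
    have "\<forall>\<^sub>F s in at \<xi>. s \<noteq> \<xi>" by (simp add: eventually_at_filter)
    with eventually_at_close[OF d, of \<xi>] show ?thesis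
    proof eventually_elim
      case (elim s)
      show ?case
      proof
        fix x
        have "\<bar>(T (s * x) * f x - T (\<xi> * x) * f x) / (s - \<xi>) - T' (\<xi> * x) * (x * f x)\<bar>
          = \<bar>T (s * x) - T (\<xi> * x) - (s * x - \<xi> * x) * T' (\<xi> * x)\<bar> * \<bar>f x\<bar> / \<bar>s - \<xi>\<bar>"
          using elim(2) unfolding abs_mult[symmetric] abs_divide[symmetric]
          by (intro arg_cong[of _ _ abs]) (simp add: field_simps)
        also have "\<dots> \<le> (s * x - \<xi> * x)\<^sup>2 * \<bar>f x\<bar> / \<bar>s - \<xi>\<bar>"
          by (intro divide_right_mono mult_right_mono T) auto
        also have "\<dots> = \<bar>s - \<xi>\<bar> * \<bar>x * (x * f x)\<bar>"
        proof -
          have "(s * x - \<xi> * x)\<^sup>2 = \<bar>s - \<xi>\<bar> * (\<bar>s - \<xi>\<bar> * (\<bar>x\<bar> * \<bar>x\<bar>))"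
            by (simp add: power2_eq_square algebra_simps flip: abs_mult)
          then show ?thesis using elim(2) by (simp add: abs_mult)
        qed
        also have "\<dots> \<le> (e / (C + 1)) * (C * om x)" using elim(1) C by (intro mult_mono) auto
        also have "\<dots> \<le> e * om x"
        proof -
          have "e * C \<le> e * (C + 1)" using e by simp
          then have "(e / (C + 1)) * C \<le> e" using C(1) by (simp add: pos_divide_le_eq)
          from mult_right_mono[OF this, of "om x"] om_pos[of x] show ?thesis by (simp add: mult.assoc)
        qed
        finally show "\<bar>(T (s * x) * f x - T (\<xi> * x) * f x) / (s - \<xi>) - T' (\<xi> * x) * (x * f x)\<bar> \<le> e * om x" .
      qed
    qed
  qed
  show "wdiff (\<lambda>s x. cos (s * x) * f x) (\<lambda>x. - (sin (\<xi> * x) * (x * f x))) \<xi>"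
    unfolding wdiff_def using key[of cos "\<lambda>a. - sin a"] trig_taylor(1) by simp
  show "wdiff (\<lambda>s x. sin (s * x) * f x) (\<lambda>x. cos (\<xi> * x) * (x * f x)) \<xi>"
    unfolding wdiff_def using key[of sin cos] trig_taylor(2) by simp
qed

lemma bounded_cont_trig: "bounded_cont (\<lambda>x. cos (\<xi> * x))" "bounded_cont (\<lambda>x. sin (\<xi> * x))"
  by (auto simp: bounded_cont_def intro!: continuous_intros exI[of _ 1])

lemma trig_deriv:
  assumes f: "schwartz f"
  shows "(cosT f has_real_derivative - sinT (\<lambda>x. x * f x) \<xi>) (at \<xi>)"
    "(sinT f has_real_derivative cosT (\<lambda>x. x * f x) \<xi>) (at \<xi>)"
proof -
  have d: "decays (\<lambda>x. cos (s * x) * f x)" "decays (\<lambda>x. sin (s * x) * f x)"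
    "decays (\<lambda>x. cos (s * x) * (x * f x))" "decays (\<lambda>x. - (sin (s * x) * (x * f x)))" for s
    by (intro decays_minus decays_mult_left bounded_cont_trig schwartz_decays schwartz_mult_x f)+
  have "((\<lambda>s. LINT x|lborel. 1 * (cos (s * x) * f x)) has_real_derivative (LINT x|lborel. 1 * (- (sin (\<xi> * x) * (x * f x))))) (at \<xi>)"
    by (rule wdiff_integral[OF wdiff_trig(1)[OF f] _ _ _ bounded_cont_const]) (auto intro!: always_eventually d)
  then show "(cosT f has_real_derivative - sinT (\<lambda>x. x * f x) \<xi>) (at \<xi>)"
    by (simp add: cosT_def[abs_def] sinT_def)
  have "((\<lambda>s. LINT x|lborel. 1 * (sin (s * x) * f x)) has_real_derivative (LINT x|lborel. 1 * (cos (\<xi> * x) * (x * f x)))) (at \<xi>)"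
    by (rule wdiff_integral[OF wdiff_trig(2)[OF f] _ _ _ bounded_cont_const]) (auto intro!: always_eventually d)
  then show "(sinT f has_real_derivative cosT (\<lambda>x. x * f x) \<xi>) (at \<xi>)"
    by (simp add: cosT_def sinT_def[abs_def])
qed

lemma trig_of_deriv:
  assumes f: "schwartz f"
  shows "cosT (deriv f) \<xi> = \<xi> * sinT f \<xi>" "sinT (deriv f) \<xi> = - \<xi> * cosT f \<xi>"
proof -
  have f': "schwartz (deriv f)" by (rule schwartzD[OF f])
  note d = schwartzD(1)[OF f]
  have dd: "decays (\<lambda>x. cos (\<xi> * x) * g x)" "decays (\<lambda>x. sin (\<xi> * x) * g x)" if "schwartz g" for g
    by (intro decays_mult_left bounded_cont_trig schwartz_decays that)+
  have i: "integrable lborel (\<lambda>x. cos (\<xi> * x) * g x)" "integrable lborel (\<lambda>x. sin (\<xi> * x) * g x)" if "schwartz g" for g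
    by (intro trig_integrable schwartz_integrable that)+
  have "(LINT x|lborel. cos (\<xi> * x) * deriv f x - \<xi> * (sin (\<xi> * x) * f x)) = 0"
  proof (rule integral_deriv_zero_decays)
    show "((\<lambda>x. cos (\<xi> * x) * f x) has_real_derivative cos (\<xi> * x) * deriv f x - \<xi> * (sin (\<xi> * x) * f x)) (at x)" for x
      by (rule derivative_eq_intros d refl)+ simp
  qed (intro decays_diff decays_cmult dd f f')+
  then show "cosT (deriv f) \<xi> = \<xi> * sinT f \<xi>" using i[OF f] i[OF f']
    by (simp add: cosT_def sinT_def Bochner_Integration.integral_diff)
  have "(LINT x|lborel. sin (\<xi> * x) * deriv f x + \<xi> * (cos (\<xi> * x) * f x)) = 0"
  proof (rule integral_deriv_zero_decays)
    show "((\<lambda>x. sin (\<xi> * x) * f x) has_real_derivative sin (\<xi> * x) * deriv f x + \<xi> * (cos (\<xi> * x) * f x)) (at x)" for x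
      by (rule derivative_eq_intros d refl)+ simp
  qed (intro decays_add decays_cmult dd f f')+
  then show "sinT (deriv f) \<xi> = - \<xi> * cosT f \<xi>" using i[OF f] i[OF f']
    by (simp add: cosT_def sinT_def)
qed

lemma trig_moment_bounded:
  assumes "schwartz f"
  shows "bounded (range (\<lambda>\<xi>. \<xi> ^ k * cosT f \<xi>)) \<and> bounded (range (\<lambda>\<xi>. \<xi> ^ k * sinT f \<xi>))"
  using assms
proof (induction k arbitrary: f)
  case 0
  then show ?case using trig_bound[OF schwartz_integrable[OF 0]] by (auto simp: bounded_iff)
next
  case (Suc k)
  have "\<xi> ^ Suc k * cosT f \<xi> = (-1) * (\<xi> ^ k * sinT (deriv f) \<xi>)" "\<xi> ^ Suc k * sinT f \<xi> = \<xi> ^ k * cosT (deriv f) \<xi>" for \<xi>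
    by (simp_all add: trig_of_deriv[OF Suc.prems])
  then have "(\<lambda>\<xi>. \<xi> ^ Suc k * cosT f \<xi>) = (\<lambda>\<xi>. (-1) * (\<xi> ^ k * sinT (deriv f) \<xi>))"
    "(\<lambda>\<xi>. \<xi> ^ Suc k * sinT f \<xi>) = (\<lambda>\<xi>. \<xi> ^ k * cosT (deriv f) \<xi>)" by blast+
  then show ?case using Suc.IH[OF schwartzD(3)[OF Suc.prems]] bounded_range_cmult[of _ "-1"] by metis
qed

text \<open>The transforms of Schwartz functions are closed under differentiation (multiply by \<open>x\<close> before
  transforming), and a power of the frequency can be exchanged for derivatives.\<close>

lemma schwartz_cosT_sinT:
  assumes "schwartz f" shows "schwartz (cosT f)" "schwartz (sinT f)"
proof -
  define P where "P h \<longleftrightarrow> (\<exists>f. schwartz f \<and> (h = cosT f \<or> h = sinT f))" for h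
  have step: "\<exists>f'. P f' \<and> (\<forall>x. (h has_real_derivative f' x) (at x)) \<and> (\<forall>k. bounded (range (\<lambda>x. x ^ k * h x)))" if "P h" for h
  proof -
    obtain f where f: "schwartz f" "h = cosT f \<or> h = sinT f" using \<open>P h\<close> by (auto simp: P_def)
    have xf: "schwartz (\<lambda>x. x * f x)" "schwartz (\<lambda>x. - (x * f x))" by (intro schwartz_minus schwartz_mult_x f)+
    from f(2) show ?thesis
    proof
      assume h: "h = cosT f"
      have "P (\<lambda>\<xi>. - sinT (\<lambda>x. x * f x) \<xi>)" unfolding P_def sinT_minus[symmetric] using xf by blast
      then show ?thesis unfolding h using trig_deriv(1)[OF f(1)] trig_moment_bounded[OF f(1)] by blast
    next
      assume h: "h = sinT f"
      have "P (cosT (\<lambda>x. x * f x))" unfolding P_def using xf by blast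
      then show ?thesis unfolding h using trig_deriv(2)[OF f(1)] trig_moment_bounded[OF f(1)] by blast
    qed
  qed
  show "schwartz (cosT f)" "schwartz (sinT f)"
    by (rule schwartz_derivI[of P]; use step assms in \<open>auto simp: P_def\<close>)+
qed

section \<open>Fourier inversion\<close>

lemma integrable_product_real:
  fixes f g :: "real \<Rightarrow> real"
  assumes f: "integrable lborel f" and g: "integrable lborel g"
  shows "integrable (lborel \<Otimes>\<^sub>M lborel) (\<lambda>(x, y). g x * f y)"
proof (rule lborel_pair.Fubini_integrable)
  have [measurable]: "f \<in> borel_measurable borel" "g \<in> borel_measurable borel"
    using borel_measurable_integrable[OF f] borel_measurable_integrable[OF g] by simp_all
  show "(\<lambda>(x, y). g x * f y) \<in> borel_measurable (lborel \<Otimes>\<^sub>M lborel)" by measurable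
  show "integrable lborel (\<lambda>x. LINT y|lborel. norm (case (x, y) of (x, y) \<Rightarrow> g x * f y))"
    using g by (simp add: abs_mult integrable_abs)
  show "AE x in lborel. integrable lborel (\<lambda>y. case (x, y) of (x, y) \<Rightarrow> g x * f y)"
    using f by simp
qed

lemma Fubini_kernel:
  fixes f g :: "real \<Rightarrow> real" and k :: "real \<Rightarrow> real"
  assumes f: "integrable lborel f" and g: "integrable lborel g"
    and k[measurable]: "k \<in> borel_measurable borel" and b: "\<And>z. \<bar>k z\<bar> \<le> 1"
  shows "(LINT x|lborel. g x * (LINT y|lborel. k (x * y) * f y)) = (LINT y|lborel. f y * (LINT x|lborel. k (y * x) * g x))"
proof -
  have m[measurable]: "f \<in> borel_measurable borel" "g \<in> borel_measurable borel"
    using borel_measurable_integrable[OF f] borel_measurable_integrable[OF g] by simp_all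
  have i: "integrable (lborel \<Otimes>\<^sub>M lborel) (\<lambda>(x, y). k (x * y) * (g x * f y))"
  proof (rule Bochner_Integration.integrable_bound[OF integrable_product_real[OF f g]])
    show "(\<lambda>(x, y). k (x * y) * (g x * f y)) \<in> borel_measurable (lborel \<Otimes>\<^sub>M lborel)" by measurable
    show "AE p in lborel \<Otimes>\<^sub>M lborel. norm (case p of (x, y) \<Rightarrow> k (x * y) * (g x * f y)) \<le> norm (case p of (x, y) \<Rightarrow> g x * f y)"
      using mult_right_mono[OF b] by (intro AE_I2) (auto simp: abs_mult split: prod.split)
  qed
  have "(LINT x|lborel. g x * (LINT y|lborel. k (x * y) * f y)) = (LINT x|lborel. LINT y|lborel. k (x * y) * (g x * f y))"
    by (intro Bochner_Integration.integral_cong refl) (simp add: mult.left_commute)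
  also have "\<dots> = (LINT y|lborel. LINT x|lborel. k (x * y) * (g x * f y))"
    by (rule lborel_pair.Fubini_integral[OF i, symmetric])
  also have "\<dots> = (LINT y|lborel. f y * (LINT x|lborel. k (y * x) * g x))"
  proof (intro Bochner_Integration.integral_cong refl)
    fix y
    have "(LINT x|lborel. k (x * y) * (g x * f y)) = (LINT x|lborel. f y * (k (y * x) * g x))"
      by (intro Bochner_Integration.integral_cong refl) (simp add: mult_ac)
    then show "(LINT x|lborel. k (x * y) * (g x * f y)) = f y * (LINT x|lborel. k (y * x) * g x)" by simp
  qed
  finally show ?thesis .
qed

text \<open>The transforms are symmetric operators; this is Fubini's theorem for a bounded kernel.\<close>

lemma trig_multiplication:
  assumes "integrable lborel f" "integrable lborel g"
  shows "(LINT x|lborel. g x * cosT f x) = (LINT x|lborel. f x * cosT g x)"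
    "(LINT x|lborel. g x * sinT f x) = (LINT x|lborel. f x * sinT g x)"
  unfolding cosT_def sinT_def by (rule Fubini_kernel[OF assms]; simp)+

lemma gauss_integrable: "integrable lborel std_normal_density"
  using integrable_std_normal_moment[of 0] by simp

lemma cosT_gauss: "cosT std_normal_density t = exp (- t\<^sup>2 / 2)"
proof -
  have "Re (char std_normal_distribution t) = exp (- t\<^sup>2 / 2)"
    by (simp add: char_std_normal_distribution)
  moreover have "char std_normal_distribution t = (LINT x|lborel. std_normal_density x *\<^sub>R iexp (t * x))"
    unfolding char_def by (rule integral_density) (auto simp: normal_density_nonneg)
  moreover have "integrable lborel (\<lambda>x. std_normal_density x *\<^sub>R iexp (t * x))"
    by (rule Bochner_Integration.integrable_bound[OF gauss_integrable]) auto
  ultimately have "(LINT x|lborel. Re (std_normal_density x *\<^sub>R iexp (t * x))) = exp (- t\<^sup>2 / 2)"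
    by (metis integral_Re)
  moreover have "(\<lambda>x. Re (std_normal_density x *\<^sub>R iexp (t * x))) = (\<lambda>x. cos (t * x) * std_normal_density x)"
    by (simp add: fun_eq_iff Re_exp)
  ultimately show ?thesis by (simp only: cosT_def)
qed

text \<open>Fourier inversion at the origin. Insert the Gaussian \<open>D (\<xi> / n)\<close> and move the transform onto it:
  the transform of this Gaussian is an approximate identity with total mass \<open>2 \<pi> D 0\<close>.\<close>

lemma integral_cosT:
  assumes f: "schwartz f"
  shows "(LINT \<xi>|lborel. cosT f \<xi>) = 2 * pi * f 0"
proof -
  let ?D = std_normal_density
  have cf: "integrable lborel (cosT f)" by (intro schwartz_integrable schwartz_cosT_sinT f)
  have fi: "integrable lborel f" by (rule schwartz_integrable[OF f])
  have [measurable]: "f \<in> borel_measurable borel" by (rule schwartz_measurable[OF f])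
  have [measurable]: "cosT f \<in> borel_measurable borel" by (intro schwartz_measurable schwartz_cosT_sinT f)
  have fc: "isCont f 0" using schwartzD(1)[OF f] by (rule DERIV_isCont)
  obtain B where B: "\<And>x. \<bar>f x\<bar> \<le> B" using schwartzD(2)[OF f, of 0] by (auto simp: bounded_iff)
  have Dle: "?D x \<le> ?D 0" for x by (simp add: std_normal_density_def divide_right_mono)
  define L where "L n = (LINT \<xi>|lborel. ?D (\<xi> / real (Suc n)) * cosT f \<xi>)" for n
  have "(\<lambda>n. L n) \<longlonglongrightarrow> (LINT \<xi>|lborel. ?D 0 * cosT f \<xi>)"
    unfolding L_def
  proof (rule Bochner_Integration.integral_dominated_convergence)
    show "integrable lborel (\<lambda>\<xi>. ?D 0 * \<bar>cosT f \<xi>\<bar>)" using cf by (simp add: integrable_abs)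
    have "isCont ?D 0" unfolding std_normal_density_def by (intro continuous_intros) simp
    moreover have "(\<lambda>n. \<xi> / real (Suc n)) \<longlonglongrightarrow> 0" for \<xi> by (rule LIMSEQ_Suc) (rule lim_const_over_n)
    ultimately have "(\<lambda>n. ?D (\<xi> / real (Suc n))) \<longlonglongrightarrow> ?D 0" for \<xi> by (rule isCont_tendsto_compose)
    then show "AE \<xi> in lborel. (\<lambda>n. ?D (\<xi> / real (Suc n)) * cosT f \<xi>) \<longlonglongrightarrow> ?D 0 * cosT f \<xi>"
      by (intro AE_I2 tendsto_intros)
    show "AE \<xi> in lborel. norm (?D (\<xi> / real (Suc n)) * cosT f \<xi>) \<le> ?D 0 * \<bar>cosT f \<xi>\<bar>" for n
      using Dle by (intro AE_I2) (auto simp: abs_mult normal_density_nonneg intro!: mult_right_mono)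
  qed measurable
  moreover have "L n = sqrt (2 * pi) * (LINT z|lborel. f (z / real (Suc n)) * ?D z)" for n
  proof -
    define m where "m = real (Suc n)"
    have m: "0 < m" by (simp add: m_def)
    have gi: "integrable lborel (\<lambda>\<xi>. ?D (\<xi> / m))"
      using lborel_integrable_real_affine[OF gauss_integrable, of "1/m" 0] m by simp
    have ctg: "cosT (\<lambda>\<xi>. ?D (\<xi> / m)) y = sqrt (2 * pi) * m * ?D (m * y)" for y
    proof -
      have "cosT (\<lambda>\<xi>. ?D (\<xi> / m)) y = m * (LINT \<eta>|lborel. cos (y * (m * \<eta>)) * ?D \<eta>)"
        unfolding cosT_def using lborel_integral_real_affine[of m "\<lambda>\<xi>. cos (y * \<xi>) * ?D (\<xi> / m)" 0] m by simp
      also have "\<dots> = m * cosT ?D (m * y)" by (simp add: cosT_def mult_ac)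
      finally show ?thesis by (simp add: cosT_gauss std_normal_density_def)
    qed
    have "L n = (LINT \<xi>|lborel. ?D (\<xi> / m) * cosT f \<xi>)" by (simp add: L_def m_def)
    also have "\<dots> = (LINT y|lborel. f y * cosT (\<lambda>\<xi>. ?D (\<xi> / m)) y)"
      by (rule trig_multiplication(1)[OF fi gi])
    also have "\<dots> = (1 / m) * (LINT z|lborel. f (z / m) * (sqrt (2 * pi) * m * ?D z))"
      unfolding ctg using lborel_integral_real_affine[of "1/m" "\<lambda>y. f y * (sqrt (2 * pi) * m * ?D (m * y))" 0] m by simp
    also have "\<dots> = (1 / m) * (LINT z|lborel. (sqrt (2 * pi) * m) * (f (z / m) * ?D z))"
      by (intro arg_cong[of _ _ "\<lambda>x. 1/m * x"] Bochner_Integration.integral_cong refl) (simp add: mult_ac)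
    also have "\<dots> = sqrt (2 * pi) * (LINT z|lborel. f (z / m) * ?D z)" using m by simp
    finally show ?thesis by (simp add: m_def)
  qed
  moreover have "(\<lambda>n. LINT z|lborel. f (z / real (Suc n)) * ?D z) \<longlonglongrightarrow> (LINT z|lborel. f 0 * ?D z)"
  proof (rule Bochner_Integration.integral_dominated_convergence)
    show "integrable lborel (\<lambda>z. B * ?D z)" using gauss_integrable by simp
    have "(\<lambda>n. z / real (Suc n)) \<longlonglongrightarrow> 0" for z by (rule LIMSEQ_Suc) (rule lim_const_over_n)
    from isCont_tendsto_compose[OF fc this]
    show "AE z in lborel. (\<lambda>n. f (z / real (Suc n)) * ?D z) \<longlonglongrightarrow> f 0 * ?D z"
      by (intro AE_I2 tendsto_intros)
    show "AE z in lborel. norm (f (z / real (Suc n)) * ?D z) \<le> B * ?D z" for n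
      using B by (intro AE_I2) (auto simp: abs_mult normal_density_nonneg intro!: mult_right_mono)
  qed measurable
  ultimately have "(\<lambda>n. L n) \<longlonglongrightarrow> sqrt (2 * pi) * (LINT z|lborel. f 0 * ?D z)"
    by (simp add: tendsto_mult_left)
  with \<open>(\<lambda>n. L n) \<longlonglongrightarrow> (LINT \<xi>|lborel. ?D 0 * cosT f \<xi>)\<close>
  have "(LINT \<xi>|lborel. ?D 0 * cosT f \<xi>) = sqrt (2 * pi) * (LINT z|lborel. f 0 * ?D z)"
    by (rule LIMSEQ_unique)
  then have "?D 0 * (LINT \<xi>|lborel. cosT f \<xi>) = sqrt (2 * pi) * f 0" by simp
  then show ?thesis by (simp add: std_normal_density_def field_simps)
qed

lemma cosT_even: "cosT f (- \<xi>) = cosT f \<xi>" and sinT_odd: "sinT f (- \<xi>) = - sinT f \<xi>"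
  by (simp_all add: cosT_def sinT_def)

lemma integral_reflect:
  fixes f :: "real \<Rightarrow> real" shows "(LINT x|lborel. f (- x)) = (LINT x|lborel. f x)"
  using lborel_integral_real_affine[of "-1" f 0] by simp

lemma cosT_reflect: "cosT (\<lambda>x. f (- x)) \<xi> = cosT f \<xi>" and sinT_reflect: "sinT (\<lambda>x. f (- x)) \<xi> = - sinT f \<xi>"
  using integral_reflect[of "\<lambda>x. cos (\<xi> * x) * f x"] integral_reflect[of "\<lambda>x. sin (\<xi> * x) * f x"]
  by (simp_all add: cosT_def sinT_def)

lemma cosT_st_zero: "cosT (sinT f) x = 0" "sinT (cosT f) x = 0"
  using cosT_reflect[of "sinT f" x] sinT_reflect[of "cosT f" x] by (simp_all add: sinT_odd cosT_even cosT_minus)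

text \<open>The integrand \<open>cos (x \<xi>) cosT f \<xi> + sin (x \<xi>) sinT f \<xi>\<close> is the cosine transform of the translate
  of \<open>f\<close> by \<open>x\<close>, so inversion at the origin suffices.\<close>

lemma trig_inversion_sum:
  assumes f: "schwartz f"
  shows "cosT (cosT f) x + sinT (sinT f) x = 2 * pi * f x"
proof -
  have fi: "integrable lborel f" by (rule schwartz_integrable[OF f])
  have s: "cosT (\<lambda>z. f (z + x)) \<xi> = cos (x * \<xi>) * cosT f \<xi> + sin (x * \<xi>) * sinT f \<xi>" for \<xi>
  proof -
    have "cosT (\<lambda>z. f (z + x)) \<xi> = (LINT y|lborel. cos (\<xi> * (y - x)) * f y)"
      unfolding cosT_def using lborel_integral_real_affine[of 1 "\<lambda>y. cos (\<xi> * (y - x)) * f y" x] by (simp add: add.commute)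
    also have "\<dots> = (LINT y|lborel. cos (x * \<xi>) * (cos (\<xi> * y) * f y) + sin (x * \<xi>) * (sin (\<xi> * y) * f y))"
      by (intro Bochner_Integration.integral_cong refl) (simp add: right_diff_distrib cos_diff algebra_simps)
    also have "\<dots> = cos (x * \<xi>) * cosT f \<xi> + sin (x * \<xi>) * sinT f \<xi>"
      using trig_integrable[OF fi] by (simp add: cosT_def sinT_def)
    finally show ?thesis .
  qed
  have "cosT (cosT f) x + sinT (sinT f) x = (LINT \<xi>|lborel. cos (x * \<xi>) * cosT f \<xi> + sin (x * \<xi>) * sinT f \<xi>)"
    unfolding cosT_def[of "cosT f"] sinT_def[of "sinT f"]
    by (rule Bochner_Integration.integral_add[symmetric]) (intro trig_integrable schwartz_integrable schwartz_cosT_sinT f)+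
  also have "\<dots> = (LINT \<xi>|lborel. cosT (\<lambda>z. f (z + x)) \<xi>)" by (simp add: s)
  also have "\<dots> = 2 * pi * f x" using integral_cosT[OF schwartz_shift[OF f, of x]] by simp
  finally show ?thesis .
qed

text \<open>The first term of \<open>trig_inversion_sum\<close> is even in \<open>x\<close> and the second one is odd.\<close>

lemma trig_inversion:
  assumes f: "schwartz f"
  shows "cosT (cosT f) x = pi * (f x + f (- x))" "sinT (sinT f) x = pi * (f x - f (- x))"
  using trig_inversion_sum[OF f, of x] trig_inversion_sum[OF f, of "- x"]
  by (simp_all add: cosT_even sinT_odd algebra_simps)

lemma trig_plancherel:
  assumes f: "schwartz f"
  shows "(LINT x|lborel. (cosT f x)\<^sup>2 + (sinT f x)\<^sup>2) = 2 * pi * (LINT x|lborel. (f x)\<^sup>2)"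
proof -
  have i: "integrable lborel f" "integrable lborel (cosT f)" "integrable lborel (sinT f)"
    by (intro schwartz_integrable schwartz_cosT_sinT f)+
  have ii: "integrable lborel (\<lambda>x. g x * h x)" if "schwartz g" "schwartz h" for g h
    by (intro decays_integrable decays_mult schwartz_decays that)
  have "(LINT x|lborel. (cosT f x)\<^sup>2 + (sinT f x)\<^sup>2) = (LINT x|lborel. cosT f x * cosT f x) + (LINT x|lborel. sinT f x * sinT f x)"
    unfolding power2_eq_square by (intro Bochner_Integration.integral_add ii schwartz_cosT_sinT f)
  also have "\<dots> = (LINT x|lborel. f x * cosT (cosT f) x) + (LINT x|lborel. f x * sinT (sinT f) x)"
    using trig_multiplication(1)[OF i(1) i(2)] trig_multiplication(2)[OF i(1) i(3)] by simp
  also have "\<dots> = (LINT x|lborel. f x * cosT (cosT f) x + f x * sinT (sinT f) x)"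
    by (intro Bochner_Integration.integral_add[symmetric] ii schwartz_cosT_sinT f)
  also have "\<dots> = (LINT x|lborel. 2 * pi * (f x)\<^sup>2)"
    unfolding distrib_left[symmetric] trig_inversion_sum[OF f] by (simp add: power2_eq_square mult_ac)
  finally show ?thesis by simp
qed

section \<open>The Fourier transform on Schwartz functions\<close>

lemma complex_integral_split:
  fixes f g :: "real \<Rightarrow> real"
  assumes "integrable lborel f" "integrable lborel g"
  shows "(LINT x|lborel. complex_of_real (f x) + \<i> * complex_of_real (g x)) = Complex (LINT x|lborel. f x) (LINT x|lborel. g x)"
  using assms by (simp add: complex_eq_iff)

lemma fourier_eq:
  assumes "integrable lborel f"
  shows "fourier f \<xi> = Complex (cosT f \<xi> / sqrt (2 * pi)) (- sinT f \<xi> / sqrt (2 * pi))"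
proof -
  have e: "exp (- (\<i> * complex_of_real \<xi> * complex_of_real x)) * complex_of_real (f x)
     = complex_of_real (cos (\<xi> * x) * f x) + \<i> * complex_of_real (- (sin (\<xi> * x) * f x))" for x
    by (simp add: complex_eq_iff Re_exp Im_exp)
  have "(LINT x|lborel. exp (- (\<i> * complex_of_real \<xi> * complex_of_real x)) * complex_of_real (f x))
    = Complex (cosT f \<xi>) (- sinT f \<xi>)"
    unfolding e by (subst complex_integral_split) (use trig_integrable[OF assms] in \<open>auto simp: cosT_def sinT_def\<close>)
  then show ?thesis unfolding fourier_def by (simp add: complex_eq_iff)
qed

lemma fourier_Re_Im:
  assumes "integrable lborel f"
  shows "Re (fourier f \<xi>) = 1 / sqrt (2 * pi) * cosT f \<xi>" "Im (fourier f \<xi>) = - 1 / sqrt (2 * pi) * sinT f \<xi>"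
  by (simp_all add: fourier_eq[OF assms])

lemma schwartz_fourier:
  assumes "schwartz f"
  shows "schwartz (\<lambda>\<xi>. Re (fourier f \<xi>))" "schwartz (\<lambda>\<xi>. Im (fourier f \<xi>))"
  unfolding fourier_Re_Im[OF schwartz_integrable[OF assms]]
  by (intro schwartz_cmult schwartz_cosT_sinT assms)+

lemma cmod_fourier:
  assumes "integrable lborel f"
  shows "(cmod (fourier f \<xi>))\<^sup>2 = 1 / (2 * pi) * ((cosT f \<xi>)\<^sup>2 + (sinT f \<xi>)\<^sup>2)"
  unfolding cmod_power2 fourier_Re_Im[OF assms] by (simp add: power_divide field_simps)

lemma plancherel:
  assumes "schwartz f"
  shows "(LINT \<xi>|lborel. (cmod (fourier f \<xi>))\<^sup>2) = (LINT x|lborel. (f x)\<^sup>2)"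
  unfolding cmod_fourier[OF schwartz_integrable[OF assms]]
  using trig_plancherel[OF assms] by simp

lemma fourier_deriv_plus_2:
  assumes "schwartz f"
  shows "fourier (\<lambda>x. deriv f x + 2 * f x) \<xi> = (2 + \<i> * \<xi>) * fourier f \<xi>"
proof -
  have i: "integrable lborel f" "integrable lborel (deriv f)" "integrable lborel (\<lambda>x. 2 * f x)" "integrable lborel (\<lambda>x. deriv f x + 2 * f x)"
    by (intro schwartz_integrable schwartzD schwartz_cmult schwartz_add assms)+
  show ?thesis
    unfolding fourier_eq[OF i(4)] fourier_eq[OF i(1)] trig_add[OF i(2,3)] cosT_cmult sinT_cmult trig_of_deriv[OF assms]
    by (simp add: complex_eq_iff field_simps)
qed

lemma Hm1_fourier_distribution_of:
  assumes f: "schwartz f"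
  shows "Hm1_fourier (distribution_of f) (fourier f)"
proof -
  have fi: "integrable lborel f" by (rule schwartz_integrable[OF f])
  have RI: "schwartz (\<lambda>\<xi>. Re (fourier f \<xi>))" "schwartz (\<lambda>\<xi>. Im (fourier f \<xi>))" by (intro schwartz_fourier f)+
  have feq: "fourier f = (\<lambda>\<xi>. complex_of_real (Re (fourier f \<xi>)) + \<i> * complex_of_real (Im (fourier f \<xi>)))"
    by (simp add: fun_eq_iff complex_eq_iff)
  have [measurable]: "(\<lambda>\<xi>. Re (fourier f \<xi>)) \<in> borel_measurable borel" "(\<lambda>\<xi>. Im (fourier f \<xi>)) \<in> borel_measurable borel"
    using schwartz_measurable RI by auto
  have m: "fourier f \<in> borel_measurable borel" by (subst feq) measurable
  have "integrable lborel (\<lambda>\<xi>. (Re (fourier f \<xi>))\<^sup>2 + (Im (fourier f \<xi>))\<^sup>2)"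
    by (intro Bochner_Integration.integrable_add decays_integrable decays_power schwartz_decays RI) simp_all
  then have "integrable lborel (\<lambda>\<xi>. (cmod (fourier f \<xi>))\<^sup>2)" by (simp add: cmod_power2)
  then have i: "integrable lborel (\<lambda>\<xi>. (cmod (fourier f \<xi>))\<^sup>2 / (\<xi>\<^sup>2 + 4))"
  proof (rule Bochner_Integration.integrable_bound)
    show "(\<lambda>\<xi>. (cmod (fourier f \<xi>))\<^sup>2 / (\<xi>\<^sup>2 + 4)) \<in> borel_measurable lborel" using m by measurable
    show "AE \<xi> in lborel. norm ((cmod (fourier f \<xi>))\<^sup>2 / (\<xi>\<^sup>2 + 4)) \<le> norm ((cmod (fourier f \<xi>))\<^sup>2)"
    proof (intro AE_I2)
      fix \<xi> :: real
      have "1 \<le> \<xi>\<^sup>2 + 4" by (simp add: add_increasing)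
      then show "norm ((cmod (fourier f \<xi>))\<^sup>2 / (\<xi>\<^sup>2 + 4)) \<le> norm ((cmod (fourier f \<xi>))\<^sup>2)"
        using add_nonneg_pos[of "\<xi>\<^sup>2" 4] divide_left_mono[of 1 "\<xi>\<^sup>2 + 4" "(cmod (fourier f \<xi>))\<^sup>2"] by simp
    qed
  qed
  have "Complex (distribution_of f (\<lambda>\<xi>. Re (fourier \<phi> \<xi>))) (distribution_of f (\<lambda>\<xi>. Im (fourier \<phi> \<xi>)))
          = (LINT \<xi>|lborel. fourier f \<xi> * complex_of_real (\<phi> \<xi>))" if \<phi>: "schwartz \<phi>" for \<phi>
  proof -
    have \<phi>i: "integrable lborel \<phi>" by (rule schwartz_integrable[OF \<phi>])
    have ii: "integrable lborel (\<lambda>x. \<phi> x * Re (fourier f x))" "integrable lborel (\<lambda>x. \<phi> x * Im (fourier f x))"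
      by (intro decays_integrable decays_mult schwartz_decays RI \<phi>)+
    have "(LINT \<xi>|lborel. fourier f \<xi> * complex_of_real (\<phi> \<xi>))
      = (LINT \<xi>|lborel. complex_of_real (\<phi> \<xi> * Re (fourier f \<xi>)) + \<i> * complex_of_real (\<phi> \<xi> * Im (fourier f \<xi>)))"
      by (intro Bochner_Integration.integral_cong refl) (simp add: complex_eq_iff mult.commute)
    also have "\<dots> = Complex (LINT \<xi>|lborel. \<phi> \<xi> * Re (fourier f \<xi>)) (LINT \<xi>|lborel. \<phi> \<xi> * Im (fourier f \<xi>))"
      by (rule complex_integral_split[OF ii])
    also have "(LINT \<xi>|lborel. \<phi> \<xi> * Re (fourier f \<xi>)) = (LINT x|lborel. f x * Re (fourier \<phi> x))"
      unfolding fourier_Re_Im[OF fi] fourier_Re_Im[OF \<phi>i] mult.left_commute[of _ "1 / sqrt (2 * pi)"]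
      using trig_multiplication(1)[OF fi \<phi>i] by simp
    also have "(LINT \<xi>|lborel. \<phi> \<xi> * Im (fourier f \<xi>)) = (LINT x|lborel. f x * Im (fourier \<phi> x))"
      unfolding fourier_Re_Im[OF fi] fourier_Re_Im[OF \<phi>i] mult.left_commute[of _ "- 1 / sqrt (2 * pi)"]
      using trig_multiplication(2)[OF fi \<phi>i] by simp
    finally show ?thesis using schwartz_fourier[OF \<phi>] by (simp add: distribution_of_def)
  qed
  then show ?thesis using m i by (simp add: Hm1_fourier_def)
qed

lemma tempered_distribution_of:
  assumes f: "schwartz f" shows "tempered (distribution_of f)"
proof -
  have fi: "integrable lborel f" by (rule schwartz_integrable[OF f])
  have ii: "integrable lborel (\<lambda>x. f x * \<phi> x)" if "schwartz \<phi>" for \<phi>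
    by (intro decays_integrable decays_mult schwartz_decays f that)
  have "\<bar>LINT x|lborel. f x * \<phi> x\<bar> \<le> (LINT x|lborel. \<bar>f x\<bar>) * (\<Sum>k\<le>0. \<Sum>n\<le>0. schwartz_seminorm k n \<phi>)" if \<phi>: "schwartz \<phi>" for \<phi>
  proof -
    have "\<bar>LINT x|lborel. f x * \<phi> x\<bar> \<le> (LINT x|lborel. \<bar>f x\<bar> * schwartz_seminorm 0 0 \<phi>)"
    proof (rule Bochner_Integration.integral_abs_bound_integral[OF ii[OF \<phi>]])
      show "integrable lborel (\<lambda>x. \<bar>f x\<bar> * schwartz_seminorm 0 0 \<phi>)" using fi by (simp add: integrable_abs)
      show "\<bar>f x * \<phi> x\<bar> \<le> \<bar>f x\<bar> * schwartz_seminorm 0 0 \<phi>" for x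
        using schwartz_seminorm_bound[OF \<phi>, of x 0 0] by (simp add: abs_mult mult_left_mono)
    qed
    then show ?thesis by simp
  qed
  then have 1: "\<exists>A N. \<forall>\<phi>. schwartz \<phi> \<longrightarrow> \<bar>distribution_of f \<phi>\<bar> \<le> A * (\<Sum>k\<le>N. \<Sum>n\<le>N. schwartz_seminorm k n \<phi>)"
    by (intro exI[of _ "LINT x|lborel. \<bar>f x\<bar>"] exI[of _ 0]) (auto simp: distribution_of_def)
  have 2: "distribution_of f (\<lambda>x. \<phi> x + \<psi> x) = distribution_of f \<phi> + distribution_of f \<psi>"
    if "schwartz \<phi>" "schwartz \<psi>" for \<phi> \<psi>
    using schwartz_add[OF that] that ii[OF that(1)] ii[OF that(2)] by (simp add: distribution_of_def distrib_left)
  have 3: "distribution_of f (\<lambda>x. c * \<phi> x) = c * distribution_of f \<phi>" if "schwartz \<phi>" for c \<phi>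
    using schwartz_cmult[OF that] that by (simp add: distribution_of_def mult.left_commute)
  show ?thesis unfolding tempered_def using 1 2 3 by (auto simp: distribution_of_def)
qed

lemma distribution_of_in_Hm1: "schwartz f \<Longrightarrow> distribution_of f \<in> Hm1"
  unfolding Hm1_def using tempered_distribution_of Hm1_fourier_distribution_of by blast

section \<open>Square integrable functions\<close>

definition sqint :: "'a measure \<Rightarrow> ('a \<Rightarrow> real) \<Rightarrow> bool" where
  "sqint M f \<longleftrightarrow> f \<in> borel_measurable M \<and> integrable M (\<lambda>x. (f x)\<^sup>2)"

lemma sqint_mult: assumes "sqint M f" "sqint M g" shows "integrable M (\<lambda>x. f x * g x)"
proof (rule Bochner_Integration.integrable_bound[of M "\<lambda>x. (f x)\<^sup>2 + (g x)\<^sup>2"])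
  show "AE x in M. norm (f x * g x) \<le> norm ((f x)\<^sup>2 + (g x)\<^sup>2)"
  proof (intro AE_I2)
    fix x
    have "2 * (\<bar>f x\<bar> * \<bar>g x\<bar>) \<le> (f x)\<^sup>2 + (g x)\<^sup>2"
      using zero_le_power2[of "\<bar>f x\<bar> - \<bar>g x\<bar>"] by (simp add: power2_diff)
    moreover have "0 \<le> \<bar>f x\<bar> * \<bar>g x\<bar>" by simp
    ultimately have "\<bar>f x * g x\<bar> \<le> (f x)\<^sup>2 + (g x)\<^sup>2" unfolding abs_mult by linarith
    then show "norm (f x * g x) \<le> norm ((f x)\<^sup>2 + (g x)\<^sup>2)" by simp
  qed
qed (use assms in \<open>auto simp: sqint_def\<close>)

lemma sqint_add: assumes "sqint M f" "sqint M g" shows "sqint M (\<lambda>x. f x + g x)"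
proof -
  have "integrable M (\<lambda>x. (f x)\<^sup>2 + (g x)\<^sup>2 + 2 * (f x * g x))"
    using sqint_mult[OF assms] assms by (auto simp: sqint_def)
  then show ?thesis using assms by (auto simp: sqint_def power2_sum mult.assoc)
qed
lemma sqint_cmult: "sqint M f \<Longrightarrow> sqint M (\<lambda>x. c * f x)"
  by (auto simp: sqint_def power_mult_distrib)
lemma sqint_diff: assumes "sqint M f" "sqint M g" shows "sqint M (\<lambda>x. f x - g x)"
  using sqint_add[OF assms(1) sqint_cmult[OF assms(2), of "-1"]] by simp

lemma sq_integral_add:
  assumes "sqint M f" "sqint M g"
  shows "(LINT x|M. (f x + t * g x)\<^sup>2) = (LINT x|M. (f x)\<^sup>2) + 2 * t * (LINT x|M. f x * g x) + t\<^sup>2 * (LINT x|M. (g x)\<^sup>2)"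
proof -
  have "(LINT x|M. (f x + t * g x)\<^sup>2) = (LINT x|M. ((f x)\<^sup>2 + 2 * t * (f x * g x)) + t\<^sup>2 * (g x)\<^sup>2)"
    by (intro Bochner_Integration.integral_cong refl) (simp add: power2_sum power_mult_distrib algebra_simps)
  then show ?thesis using sqint_mult[OF assms] assms by (simp add: sqint_def)
qed

lemma cauchy_schwarz_integral:
  assumes f: "sqint M f" and g: "sqint M g"
  shows "(LINT x|M. f x * g x)\<^sup>2 \<le> (LINT x|M. (f x)\<^sup>2) * (LINT x|M. (g x)\<^sup>2)"
proof -
  define a b c where "a = (LINT x|M. (f x)\<^sup>2)" and "b = (LINT x|M. (g x)\<^sup>2)" and "c = (LINT x|M. f x * g x)"
  have q: "0 \<le> a + 2 * t * c + t\<^sup>2 * b" for t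
    unfolding a_def b_def c_def sq_integral_add[OF f g, symmetric] by simp
  have "0 \<le> b" by (simp add: b_def)
  show ?thesis
  proof (cases "b = 0")
    case True
    have "c = 0"
    proof (rule ccontr)
      assume "c \<noteq> 0"
      then have "a + 2 * (- (a + 1) / (2 * c)) * c = -1" by (simp add: field_simps)
      then show False using q[of "- (a + 1) / (2 * c)"] True by simp
    qed
    then show ?thesis using True by (simp flip: a_def b_def c_def)
  next
    case False
    then have b: "0 < b" using \<open>0 \<le> b\<close> by simp
    have "a + 2 * (- c / b) * c + (- c / b)\<^sup>2 * b = a - c\<^sup>2 / b"
      using b by (simp add: power2_eq_square field_simps)
    then have "c\<^sup>2 / b \<le> a" using q[of "- c / b"] by simp
    then show ?thesis using b by (simp add: pos_divide_le_eq flip: a_def b_def c_def)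
  qed
qed

definition L2_tendsto :: "'a measure \<Rightarrow> (nat \<Rightarrow> 'a \<Rightarrow> real) \<Rightarrow> ('a \<Rightarrow> real) \<Rightarrow> bool" where
  "L2_tendsto M v f \<longleftrightarrow> (\<forall>n. sqint M (v n)) \<and> sqint M f \<and> (\<lambda>n. LINT x|M. (v n x - f x)\<^sup>2) \<longlonglongrightarrow> 0"

lemma L2_tendsto_weak:
  assumes v: "L2_tendsto M v f" and g: "sqint M g"
  shows "(\<lambda>n. LINT x|M. v n x * g x) \<longlonglongrightarrow> (LINT x|M. f x * g x)"
proof -
  have s: "sqint M (v n)" "sqint M f" for n using v by (auto simp: L2_tendsto_def)
  have "(\<lambda>n. sqrt ((LINT x|M. (v n x - f x)\<^sup>2) * (LINT x|M. (g x)\<^sup>2))) \<longlonglongrightarrow> sqrt (0 * (LINT x|M. (g x)\<^sup>2))"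
    using v by (intro tendsto_intros) (auto simp: L2_tendsto_def)
  then have l: "(\<lambda>n. sqrt ((LINT x|M. (v n x - f x)\<^sup>2) * (LINT x|M. (g x)\<^sup>2))) \<longlonglongrightarrow> 0" by simp
  have "(\<lambda>n. (LINT x|M. v n x * g x) - (LINT x|M. f x * g x)) \<longlonglongrightarrow> 0"
  proof (rule tendsto_0_le[OF l, of _ 1], intro always_eventually allI)
    fix n
    have "(LINT x|M. v n x * g x) - (LINT x|M. f x * g x) = (LINT x|M. (v n x - f x) * g x)"
      using sqint_mult[OF s(1) g] sqint_mult[OF s(2) g] by (simp add: left_diff_distrib)
    moreover have "\<bar>LINT x|M. (v n x - f x) * g x\<bar> \<le> sqrt ((LINT x|M. (v n x - f x)\<^sup>2) * (LINT x|M. (g x)\<^sup>2))"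
      using real_sqrt_le_mono[OF cauchy_schwarz_integral[OF sqint_diff[OF s] g]] by simp
    ultimately show "norm ((LINT x|M. v n x * g x) - (LINT x|M. f x * g x)) \<le> norm (sqrt ((LINT x|M. (v n x - f x)\<^sup>2) * (LINT x|M. (g x)\<^sup>2))) * 1"
      by simp
  qed
  then show ?thesis by (simp add: LIM_zero_iff)
qed

lemma L2_tendsto_add:
  assumes "L2_tendsto M v f" "sqint M g" shows "L2_tendsto M (\<lambda>n x. v n x + g x) (\<lambda>x. f x + g x)"
  using assms by (auto simp: L2_tendsto_def intro: sqint_add)

lemma L2_tendsto_norm:
  assumes v: "L2_tendsto M v f"
  shows "(\<lambda>n. LINT x|M. (v n x)\<^sup>2) \<longlonglongrightarrow> (LINT x|M. (f x)\<^sup>2)"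
proof -
  have s: "sqint M (v n)" "sqint M f" for n using v by (auto simp: L2_tendsto_def)
  have eq: "(LINT x|M. (v n x)\<^sup>2) = (LINT x|M. (v n x - f x)\<^sup>2) + 2 * (LINT x|M. v n x * f x) - (LINT x|M. (f x)\<^sup>2)" for n
    using sq_integral_add[OF s(1)[of n] s(2), of "-1"] by simp
  have "(\<lambda>n. (LINT x|M. (v n x - f x)\<^sup>2) + 2 * (LINT x|M. v n x * f x) - (LINT x|M. (f x)\<^sup>2))
     \<longlonglongrightarrow> 0 + 2 * (LINT x|M. f x * f x) - (LINT x|M. (f x)\<^sup>2)"
    using v L2_tendsto_weak[OF v s(2)] by (intro tendsto_intros) (auto simp: L2_tendsto_def)
  then show ?thesis unfolding eq by (simp add: power2_eq_square)
qed

text \<open>Multiplication by an integrable weight \<open>W\<close> turns a Cauchy sequence in \<open>L\<^sup>2\<close> into one in \<open>L\<^sup>1\<close>, which has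
  an almost everywhere convergent subsequence; Fatou's lemma identifies its limit as the \<open>L\<^sup>2\<close> limit.\<close>

lemma L2_complete:
  fixes v :: "nat \<Rightarrow> 'a \<Rightarrow> real"
  assumes M: "sigma_finite_measure M" and s: "\<And>n. sqint M (v n)"
    and cauchy: "\<And>e. 0 < e \<Longrightarrow> \<exists>N. \<forall>i\<ge>N. \<forall>j\<ge>N. (LINT x|M. (v i x - v j x)\<^sup>2) < e"
  shows "\<exists>f. L2_tendsto M v f"
proof -
  obtain W :: "'a \<Rightarrow> real" where W: "W \<in> borel_measurable M" "\<And>x. 0 < W x" "\<And>x. W x \<le> 1" "integrable M W"
    by (rule sigma_finite_measure.obtain_positive_integrable_function[OF M]) blast
  have Ws: "sqint M W" unfolding sqint_def
  proof (intro conjI W Bochner_Integration.integrable_bound[OF W(4)] AE_I2)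
    show "(\<lambda>x. (W x)\<^sup>2) \<in> borel_measurable M" using W(1) by measurable
    show "norm ((W x)\<^sup>2) \<le> norm (W x)" for x
      using mult_right_mono[OF W(3)[of x], of "W x"] W(2)[of x] by (simp add: power2_eq_square)
  qed
  define I where "I = (LINT x|M. (W x)\<^sup>2)"
  have I: "0 \<le> I" by (simp add: I_def)
  have m[measurable]: "v n \<in> borel_measurable M" for n using s by (auto simp: sqint_def)
  obtain r where r: "strict_mono r" "AE x in M. Cauchy (\<lambda>i. W x * v (r i) x)"
  proof (rule cauchy_L1_AE_cauchy_subseq[of M "\<lambda>n x. W x * v n x"])
    show "integrable M (\<lambda>x. W x * v n x)" for n by (rule sqint_mult[OF Ws s])
    fix e :: real assume e: "0 < e"
    have "0 < e\<^sup>2 / (I + 1)" using e I by simp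
    then obtain N where N: "\<And>i j. N \<le> i \<Longrightarrow> N \<le> j \<Longrightarrow> (LINT x|M. (v i x - v j x)\<^sup>2) < e\<^sup>2 / (I + 1)"
      using cauchy by blast
    show "\<exists>N. \<forall>i\<ge>N. \<forall>j\<ge>N. (LINT x|M. norm (W x * v i x - W x * v j x)) < e"
    proof (intro exI[of _ N] allI impI)
      fix i j assume ij: "N \<le> i" "N \<le> j"
      have d: "sqint M (\<lambda>x. \<bar>v i x - v j x\<bar>)" using sqint_diff[OF s[of i] s[of j]] by (auto simp: sqint_def)
      have eq: "(LINT x|M. norm (W x * v i x - W x * v j x)) = (LINT x|M. W x * \<bar>v i x - v j x\<bar>)"
        using W(2) by (intro Bochner_Integration.integral_cong refl) (simp add: abs_mult less_imp_le flip: right_diff_distrib)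
      have "(LINT x|M. W x * \<bar>v i x - v j x\<bar>)\<^sup>2 \<le> I * (LINT x|M. (v i x - v j x)\<^sup>2)"
        using cauchy_schwarz_integral[OF Ws d] by (simp add: I_def)
      also have "\<dots> \<le> (I + 1) * (LINT x|M. (v i x - v j x)\<^sup>2)" by (intro mult_right_mono) auto
      also have "\<dots> < (I + 1) * (e\<^sup>2 / (I + 1))" using N[OF ij] I by (intro mult_strict_left_mono) auto
      also have "\<dots> = e\<^sup>2" using I by simp
      finally show "(LINT x|M. norm (W x * v i x - W x * v j x)) < e"
        unfolding eq using e by (simp add: power_less_imp_less_base)
    qed
  qed blast
  define f where "f x = lim (\<lambda>i. v (r i) x)" for x
  have fm[measurable]: "f \<in> borel_measurable M" unfolding f_def by measurable
  have lim: "AE x in M. (\<lambda>i. v (r i) x) \<longlonglongrightarrow> f x"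
    using r(2)
  proof eventually_elim
    case (elim x)
    then obtain l where "(\<lambda>i. W x * v (r i) x) \<longlonglongrightarrow> l" using Cauchy_convergent convergent_def by blast
    then have "(\<lambda>i. W x * v (r i) x / W x) \<longlonglongrightarrow> l / W x" using W(2)[of x] by (intro tendsto_intros) auto
    then have "(\<lambda>i. v (r i) x) \<longlonglongrightarrow> l / W x" using W(2)[of x] by simp
    then show ?case unfolding f_def by (metis limI)
  qed
  have bound: "(\<integral>\<^sup>+x. ennreal ((v n x - f x)\<^sup>2) \<partial>M) \<le> ennreal e"
    if N: "\<And>i j. N \<le> i \<Longrightarrow> N \<le> j \<Longrightarrow> (LINT x|M. (v i x - v j x)\<^sup>2) < e" and n: "N \<le> n" for n N e
  proof -
    have "(\<integral>\<^sup>+x. ennreal ((v n x - f x)\<^sup>2) \<partial>M) = (\<integral>\<^sup>+x. liminf (\<lambda>i. ennreal ((v n x - v (r i) x)\<^sup>2)) \<partial>M)"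
    proof (rule nn_integral_cong_AE)
      show "AE x in M. ennreal ((v n x - f x)\<^sup>2) = liminf (\<lambda>i. ennreal ((v n x - v (r i) x)\<^sup>2))"
        using lim
      proof eventually_elim
        case (elim x)
        then have "(\<lambda>i. ennreal ((v n x - v (r i) x)\<^sup>2)) \<longlonglongrightarrow> ennreal ((v n x - f x)\<^sup>2)"
          by (intro tendsto_ennrealI tendsto_intros)
        then show ?case by (rule lim_imp_Liminf[OF trivial_limit_sequentially, symmetric])
      qed
    qed
    also have "\<dots> \<le> liminf (\<lambda>i. \<integral>\<^sup>+x. ennreal ((v n x - v (r i) x)\<^sup>2) \<partial>M)"
      by (rule nn_integral_liminf) measurable
    also have "\<dots> \<le> ennreal e"
    proof (rule Liminf_le)
      show "\<forall>\<^sub>F i in sequentially. (\<integral>\<^sup>+x. ennreal ((v n x - v (r i) x)\<^sup>2) \<partial>M) \<le> ennreal e"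
        using eventually_ge_at_top[of N]
      proof eventually_elim
        case (elim i)
        then have ri: "N \<le> r i" using strict_mono_imp_increasing[OF r(1), of i] by simp
        have "(\<integral>\<^sup>+x. ennreal ((v n x - v (r i) x)\<^sup>2) \<partial>M) = ennreal (LINT x|M. (v n x - v (r i) x)\<^sup>2)"
          by (rule nn_integral_eq_integral) (use sqint_diff[OF s s] in \<open>auto simp: sqint_def\<close>)
        also have "\<dots> \<le> ennreal e" using N[OF n ri] by (intro ennreal_leI) simp
        finally show ?case .
      qed
    qed simp
    finally show ?thesis .
  qed
  have fin: "sqint M (\<lambda>x. v n x - f x) \<and> (LINT x|M. (v n x - f x)\<^sup>2) \<le> e"
    if N: "\<And>i j. N \<le> i \<Longrightarrow> N \<le> j \<Longrightarrow> (LINT x|M. (v i x - v j x)\<^sup>2) < e" and n: "N \<le> n" and e: "0 < e" for n N e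
  proof -
    have b: "(\<integral>\<^sup>+x. ennreal ((v n x - f x)\<^sup>2) \<partial>M) \<le> ennreal e" by (rule bound[OF N n])
    have i: "integrable M (\<lambda>x. (v n x - f x)\<^sup>2)"
      by (rule integrableI_bounded) (use b in \<open>auto intro: le_less_trans\<close>)
    then have "ennreal (LINT x|M. (v n x - f x)\<^sup>2) \<le> ennreal e"
      using b nn_integral_eq_integral[OF i] by simp
    then show ?thesis using i e by (simp add: sqint_def)
  qed
  obtain N1 where N1: "\<And>i j. N1 \<le> i \<Longrightarrow> N1 \<le> j \<Longrightarrow> (LINT x|M. (v i x - v j x)\<^sup>2) < 1"
    using cauchy[of 1] by auto
  have "sqint M (\<lambda>x. v N1 x - f x)" using fin[OF N1, of N1] by simp
  from sqint_diff[OF s[of N1] this] have fs: "sqint M f" by simp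
  have "(\<lambda>n. LINT x|M. (v n x - f x)\<^sup>2) \<longlonglongrightarrow> 0"
  proof (rule LIMSEQ_I)
    fix e :: real assume e: "0 < e"
    obtain N where "\<And>i j. N \<le> i \<Longrightarrow> N \<le> j \<Longrightarrow> (LINT x|M. (v i x - v j x)\<^sup>2) < e / 2"
      using cauchy[of "e / 2"] e by auto
    from fin[OF this] e show "\<exists>no. \<forall>n\<ge>no. norm ((LINT x|M. (v n x - f x)\<^sup>2) - 0) < e"
      by (intro exI[of _ N]) (force)
  qed
  then show ?thesis using s fs by (auto simp: L2_tendsto_def)
qed

text \<open>Almost minimal elements \<open>v n\<close> of \<open>C n\<close> form a Cauchy sequence by the parallelogram law, since the
  midpoint of \<open>v i\<close> and \<open>v j\<close> is not shorter than the infimum over \<open>C i\<close>, and these infima converge. For a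
  constant sequence \<open>C\<close> this is the projection theorem, for decreasing \<open>C n\<close> it yields weak limits as
  strong limits.\<close>

lemma L2_minimizing_sequence:
  fixes C :: "nat \<Rightarrow> ('a \<Rightarrow> real) set"
  assumes M: "sigma_finite_measure M"
    and decays: "\<And>m n. m \<le> n \<Longrightarrow> C n \<subseteq> C m" and sq: "\<And>n f. f \<in> C n \<Longrightarrow> sqint M f"
    and mid: "\<And>n f g. f \<in> C n \<Longrightarrow> g \<in> C n \<Longrightarrow> (\<lambda>x. (f x + g x) / 2) \<in> C n"
    and bd: "\<And>n. \<exists>f\<in>C n. (LINT x|M. (f x)\<^sup>2) \<le> B"
  shows "\<exists>v f. (\<forall>n. v n \<in> C n) \<and> L2_tendsto M v f \<and> (LINT x|M. (f x)\<^sup>2) \<le> B \<and>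
     (\<forall>g. (\<forall>n. g \<in> C n) \<longrightarrow> (LINT x|M. (f x)\<^sup>2) \<le> (LINT x|M. (g x)\<^sup>2))"
proof -
  define I where "I f = (LINT x|M. (f x)\<^sup>2)" for f :: "'a \<Rightarrow> real"
  have I0: "0 \<le> I f" for f by (simp add: I_def)
  define d where "d n = Inf (I ` C n)" for n
  have bb: "bdd_below (I ` C n)" for n using I0 by (intro bdd_belowI[of _ 0]) auto
  have d_le: "d n \<le> I f" if "f \<in> C n" for n f unfolding d_def using that bb by (intro cInf_lower) auto
  have ne: "C n \<noteq> {}" for n using bd by blast
  have dB: "d n \<le> B" for n using bd[of n] d_le by (auto simp flip: I_def intro: order_trans)
  have d_mono: "d m \<le> d n" if "m \<le> n" for m n
    unfolding d_def using decays[OF that] ne[of n] bb[of m] by (intro cInf_superset_mono) auto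
  have "\<exists>f. f \<in> C n \<and> I f < d n + 1 / real (Suc n)" for n
  proof -
    have "Inf (I ` C n) < d n + 1 / real (Suc n)" by (simp add: d_def)
    then show ?thesis using ne[of n] bb[of n] by (subst (asm) cInf_less_iff) auto
  qed
  then obtain v where v: "\<And>n. v n \<in> C n" "\<And>n. I (v n) < d n + 1 / real (Suc n)" by metis
  have "incseq d" using d_mono by (auto simp: incseq_def)
  then obtain D where D: "d \<longlonglongrightarrow> D" "\<And>n. d n \<le> D" using incseq_convergent[of d B] dB by blast
  have s: "sqint M (v n)" for n using sq v by blast
  have est: "(LINT x|M. (v i x - v j x)\<^sup>2) \<le> 2 * (D - d i) + 4 * (1 / real (Suc i))" if "i \<le> j" for i j
  proof -
    have "v j \<in> C i" using v decays that by blast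
    from mid[OF v(1) this] have "d i \<le> I (\<lambda>x. (v i x + v j x) / 2)" by (rule d_le)
    also have "\<dots> = (I (v i) + 2 * (LINT x|M. v i x * v j x) + I (v j)) / 4"
      using sq_integral_add[OF s[of i] s[of j], of 1] by (simp add: I_def power_divide)
    finally have 1: "4 * d i \<le> I (v i) + 2 * (LINT x|M. v i x * v j x) + I (v j)" by simp
    have 2: "(LINT x|M. (v i x - v j x)\<^sup>2) = I (v i) - 2 * (LINT x|M. v i x * v j x) + I (v j)"
      using sq_integral_add[OF s[of i] s[of j], of "-1"] by (simp add: I_def)
    have 3: "1 / real (Suc j) \<le> 1 / real (Suc i)" using that by (intro divide_left_mono) auto
    show ?thesis using 1 2 3 v(2)[of i] v(2)[of j] D(2)[of j] by argo
  qed
  have "\<exists>f. L2_tendsto M v f"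
  proof (rule L2_complete[OF M s])
    fix e :: real assume e: "0 < e"
    have "(\<lambda>i. 2 * (D - d i) + 4 * (1 / real (Suc i))) \<longlonglongrightarrow> 2 * (D - D) + 4 * 0"
      by (intro tendsto_intros D LIMSEQ_Suc[OF lim_const_over_n])
    then have "\<forall>\<^sub>F i in sequentially. 2 * (D - d i) + 4 * (1 / real (Suc i)) < e"
      using e by (intro order_tendstoD) auto
    then obtain N where N: "\<And>i. N \<le> i \<Longrightarrow> 2 * (D - d i) + 4 * (1 / real (Suc i)) < e"
      by (auto simp: eventually_sequentially)
    show "\<exists>N. \<forall>i\<ge>N. \<forall>j\<ge>N. (LINT x|M. (v i x - v j x)\<^sup>2) < e"
    proof (intro exI[of _ N] allI impI)
      fix i j assume "N \<le> i" "N \<le> j"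
      then show "(LINT x|M. (v i x - v j x)\<^sup>2) < e"
        using est[of i j] est[of j i] N[of i] N[of j] by (cases "i \<le> j") (auto simp: power2_commute[of "v i _"])
    qed
  qed
  then obtain f where f: "L2_tendsto M v f" by blast
  have "(\<lambda>n. d n + 1 / real (Suc n)) \<longlonglongrightarrow> D + 0"
    by (intro tendsto_intros D LIMSEQ_Suc[OF lim_const_over_n])
  then have fD: "I f \<le> D"
    using L2_tendsto_norm[OF f] v(2) unfolding I_def
    by (intro LIMSEQ_le[OF L2_tendsto_norm[OF f], of "\<lambda>n. d n + 1 / real (Suc n)"]) (auto intro: less_imp_le)
  have "D \<le> B" using D(1) dB by (intro LIMSEQ_le_const2[OF D(1)]) auto
  moreover have "D \<le> I g" if "\<forall>n. g \<in> C n" for g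
    using d_le that by (intro LIMSEQ_le_const2[OF D(1)]) auto
  ultimately show ?thesis using f fD v(1) unfolding I_def by (meson order_trans)
qed

section \<open>Schwartz approximations of intervals\<close>

text \<open>Products of two steep logistic functions approximate the indicator of an interval by Schwartz
  functions. They are convenient because derivatives of the logistic function are polynomials in it.\<close>

definition logistic :: "real \<Rightarrow> real" where "logistic x = 1 / (1 + exp (- x))"

lemma logistic_bounds: "0 < logistic x" "logistic x < 1" "logistic x \<le> exp x"
proof -
  have p: "0 < 1 + exp (- x)" by (simp add: add_pos_pos)
  show "0 < logistic x" "logistic x < 1" using p by (simp_all add: logistic_def)
  have "logistic x \<le> 1 / exp (- x)" unfolding logistic_def by (intro divide_left_mono) (auto simp: p)
  then show "logistic x \<le> exp x" by (simp add: exp_minus divide_inverse)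
qed

lemma logistic_deriv: "(logistic has_real_derivative (logistic x - (logistic x)\<^sup>2)) (at x)"
proof -
  have p: "1 + exp (- x) \<noteq> 0" using exp_gt_zero[of "- x"] by linarith
  have "(logistic has_real_derivative (exp (- x) / (1 + exp (- x))\<^sup>2)) (at x)"
    unfolding logistic_def[abs_def] by (rule derivative_eq_intros p refl)+ (simp add: power2_eq_square)
  moreover have "exp (- x) / (1 + exp (- x))\<^sup>2 = logistic x - (logistic x)\<^sup>2"
  proof -
    define q where "q = 1 + exp (- x)"
    have "q \<noteq> 0" and E: "exp (- x) = q - 1" using p by (simp_all add: q_def)
    then have "(q - 1) / q\<^sup>2 = 1 / q - (1 / q)\<^sup>2"
      by (simp add: power2_eq_square diff_divide_distrib)
    then show ?thesis unfolding E logistic_def by simp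
  qed
  ultimately show ?thesis by simp
qed

definition left_step :: "real \<Rightarrow> real \<Rightarrow> real \<Rightarrow> real" where "left_step n a x = logistic (n * (x - a))"
definition right_step :: "real \<Rightarrow> real \<Rightarrow> real \<Rightarrow> real" where "right_step n b x = logistic (n * (b - x))"

lemma step_deriv:
  "(left_step n a has_real_derivative n * (left_step n a x - (left_step n a x)\<^sup>2)) (at x)"
  "(right_step n b has_real_derivative - n * (right_step n b x - (right_step n b x)\<^sup>2)) (at x)"
proof -
  have "((\<lambda>x. n * (x - a)) has_real_derivative n) (at x)" by (auto intro!: derivative_eq_intros)
  from DERIV_chain2[OF logistic_deriv this] show "(left_step n a has_real_derivative n * (left_step n a x - (left_step n a x)\<^sup>2)) (at x)"
    by (simp add: left_step_def[abs_def] mult.commute)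
  have "((\<lambda>x. n * (b - x)) has_real_derivative - n) (at x)" by (auto intro!: derivative_eq_intros)
  from DERIV_chain2[OF logistic_deriv this] show "(right_step n b has_real_derivative - n * (right_step n b x - (right_step n b x)\<^sup>2)) (at x)"
    by (simp add: right_step_def[abs_def] mult.commute)
qed

lemma step_bounds: "0 < left_step n a x" "left_step n a x < 1" "0 < right_step n b x" "right_step n b x < 1"
  by (simp_all add: left_step_def right_step_def logistic_bounds)

lemma step_product_bound:
  assumes n: "1 \<le> n"
  shows "left_step n a x * right_step n b x \<le> exp (\<bar>a\<bar> + \<bar>b\<bar> - \<bar>x\<bar>)"
proof -
  note s = step_bounds[of n a x] step_bounds(3,4)[of n b x]
  have l: "left_step n a x * right_step n b x \<le> left_step n a x" "left_step n a x * right_step n b x \<le> right_step n b x"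
    using s by (simp_all add: mult_left_le mult_le_cancel_right1)
  consider "\<bar>x\<bar> \<le> \<bar>a\<bar> + \<bar>b\<bar>" | "\<bar>a\<bar> + \<bar>b\<bar> < x" | "\<bar>a\<bar> + \<bar>b\<bar> < - x" by linarith
  then show ?thesis
  proof cases
    case 1
    then have "1 \<le> exp (\<bar>a\<bar> + \<bar>b\<bar> - \<bar>x\<bar>)" by simp
    then show ?thesis using l s by linarith
  next
    case 2
    have "right_step n b x \<le> exp (n * (b - x))" by (simp add: right_step_def logistic_bounds)
    also have "n * (b - x) \<le> 1 * (b - x)" using n 2 by (intro mult_right_mono_neg) auto
    also have "1 * (b - x) \<le> \<bar>a\<bar> + \<bar>b\<bar> - \<bar>x\<bar>" using 2 abs_ge_self[of b] abs_ge_zero[of a] abs_ge_zero[of b] by simp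
    finally show ?thesis using l by simp
  next
    case 3
    have "left_step n a x \<le> exp (n * (x - a))" by (simp add: left_step_def logistic_bounds)
    also have "n * (x - a) \<le> 1 * (x - a)" using n 3 by (intro mult_right_mono_neg) auto
    also have "1 * (x - a) \<le> \<bar>a\<bar> + \<bar>b\<bar> - \<bar>x\<bar>" using 3 abs_ge_minus_self[of a] abs_ge_zero[of a] abs_ge_zero[of b] by simp
    finally show ?thesis using l by simp
  qed
qed

lemma power_le_exp: "0 \<le> y \<Longrightarrow> y ^ k \<le> real k ^ k * exp y" for y :: real
proof (cases "k = 0")
  case False
  assume y: "0 \<le> y"
  have "y / k \<le> exp (y / k)" using exp_ge_add_one_self[of "y / k"] by linarith
  then have "(y / k) ^ k \<le> exp (y / k) ^ k" using y by (intro power_mono) auto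
  also have "exp (y / k) ^ k = exp y" using False by (simp flip: exp_of_nat_mult)
  finally show ?thesis using False by (simp add: power_divide pos_divide_le_eq mult.commute)
qed simp

text \<open>A class that contains the product of the two steps and is closed under differentiation. Both
  exponents stay positive, so exponential decay at both ends is kept.\<close>

inductive step_poly :: "real \<Rightarrow> real \<Rightarrow> real \<Rightarrow> (real \<Rightarrow> real) \<Rightarrow> bool" for n a b where
  monomial: "step_poly n a b (\<lambda>x. left_step n a x ^ Suc i * right_step n b x ^ Suc j)"
| add: "step_poly n a b f \<Longrightarrow> step_poly n a b g \<Longrightarrow> step_poly n a b (\<lambda>x. f x + g x)"
| scale: "step_poly n a b f \<Longrightarrow> step_poly n a b (\<lambda>x. c * f x)"

lemma step_poly_deriv: "step_poly n a b f \<Longrightarrow> \<exists>f'. step_poly n a b f' \<and> (\<forall>x. (f has_real_derivative f' x) (at x))"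
proof (induction rule: step_poly.induct)
  case (monomial i j)
  let ?S = "left_step n a" and ?T = "right_step n b"
  let ?f' = "\<lambda>x. n * real (Suc i) * ((?S x ^ Suc i * ?T x ^ Suc j) + (-1) * (?S x ^ Suc (Suc i) * ?T x ^ Suc j))
     + (- n * real (Suc j)) * ((?S x ^ Suc i * ?T x ^ Suc j) + (-1) * (?S x ^ Suc i * ?T x ^ Suc (Suc j)))"
  have "step_poly n a b ?f'" by (intro step_poly.intros)
  moreover have "((\<lambda>x. ?S x ^ Suc i * ?T x ^ Suc j) has_real_derivative ?f' x) (at x)" for x
    by (rule DERIV_cong[OF DERIV_mult[OF DERIV_power[OF step_deriv(1)] DERIV_power[OF step_deriv(2)]]])
      (simp add: algebra_simps power2_eq_square)
  ultimately show ?case by blast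
next
  case (add f g)
  then show ?case by (blast intro: step_poly.add DERIV_add)
next
  case (scale f c)
  then show ?case by (blast intro: step_poly.scale DERIV_cmult)
qed

lemma step_poly_bounded: "step_poly n a b f \<Longrightarrow> 1 \<le> n \<Longrightarrow> bounded (range (\<lambda>x. x ^ k * f x))"
proof (induction rule: step_poly.induct)
  case (monomial i j)
  let ?S = "left_step n a" and ?T = "right_step n b"
  have "\<bar>x ^ k * (?S x ^ Suc i * ?T x ^ Suc j)\<bar> \<le> real k ^ k * exp (\<bar>a\<bar> + \<bar>b\<bar>)" for x
  proof -
    note s = step_bounds[of n a x] step_bounds(3,4)[of n b x]
    have "?S x ^ Suc i \<le> ?S x" "?T x ^ Suc j \<le> ?T x"
      using s power_decreasing[of 1 "Suc i" "?S x"] power_decreasing[of 1 "Suc j" "?T x"] by auto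
    then have "?S x ^ Suc i * ?T x ^ Suc j \<le> ?S x * ?T x" using s by (intro mult_mono) (auto intro: less_imp_le)
    also have "\<dots> \<le> exp (\<bar>a\<bar> + \<bar>b\<bar> - \<bar>x\<bar>)" by (rule step_product_bound) fact
    finally have le: "?S x ^ Suc i * ?T x ^ Suc j \<le> exp (\<bar>a\<bar> + \<bar>b\<bar> - \<bar>x\<bar>)" .
    have p: "0 \<le> ?S x ^ Suc i * ?T x ^ Suc j" using s by (intro mult_nonneg_nonneg zero_le_power) (auto intro: less_imp_le)
    have "\<bar>x ^ k * (?S x ^ Suc i * ?T x ^ Suc j)\<bar> = \<bar>x\<bar> ^ k * (?S x ^ Suc i * ?T x ^ Suc j)"
      by (metis abs_mult abs_of_nonneg[OF p] power_abs)
    also have "\<dots> \<le> (real k ^ k * exp \<bar>x\<bar>) * exp (\<bar>a\<bar> + \<bar>b\<bar> - \<bar>x\<bar>)"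
      by (intro mult_mono le power_le_exp p) auto
    also have "\<dots> = real k ^ k * exp (\<bar>a\<bar> + \<bar>b\<bar>)" by (simp add: mult.assoc flip: exp_add)
    finally show ?thesis .
  qed
  then show ?case unfolding bounded_iff by auto
next
  case (add f g)
  then show ?case using bounded_range_add[of "\<lambda>x. x ^ k * f x" "\<lambda>x. x ^ k * g x"] by (simp add: distrib_left)
next
  case (scale f c)
  then show ?case using bounded_range_cmult[of "\<lambda>x. x ^ k * f x" c] by (simp add: mult.left_commute)
qed

lemma schwartz_step_product:
  assumes "1 \<le> n" shows "schwartz (\<lambda>x. left_step n a x * right_step n b x)"
proof (rule schwartz_derivI[of "step_poly n a b"])
  show "step_poly n a b (\<lambda>x. left_step n a x * right_step n b x)"
    using step_poly.monomial[of n a b 0 0] by simp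
  fix f assume f: "step_poly n a b f"
  obtain f' where "step_poly n a b f'" "\<forall>x. (f has_real_derivative f' x) (at x)" using step_poly_deriv[OF f] by blast
  then show "\<exists>f'. step_poly n a b f' \<and> (\<forall>x. (f has_real_derivative f' x) (at x)) \<and> (\<forall>k. bounded (range (\<lambda>x. x ^ k * f x)))"
    using step_poly_bounded[OF f assms] by (intro exI[of _ f']) simp
qed

lemma logistic_limits:
  "0 < y \<Longrightarrow> (\<lambda>n. logistic (real (Suc n) * y)) \<longlonglongrightarrow> 1"
  "y < 0 \<Longrightarrow> (\<lambda>n. logistic (real (Suc n) * y)) \<longlonglongrightarrow> 0"
proof -
  have top: "filterlim (\<lambda>n. real (Suc n)) at_top sequentially"
    by (rule filterlim_compose[OF filterlim_real_sequentially filterlim_Suc])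
  show "(\<lambda>n. logistic (real (Suc n) * y)) \<longlonglongrightarrow> 1" if y: "0 < y"
  proof -
    have "filterlim (\<lambda>n. real (Suc n) * (- y)) at_bot sequentially"
      using y by (intro filterlim_tendsto_neg_mult_at_bot[OF tendsto_const _ top, of "- y", simplified mult.commute[of "- y"]]) simp
    then have "(\<lambda>n. exp (- (real (Suc n) * y))) \<longlonglongrightarrow> 0" using filterlim_compose[OF exp_at_bot] by simp
    then have "(\<lambda>n. 1 / (1 + exp (- (real (Suc n) * y)))) \<longlonglongrightarrow> 1 / (1 + 0)" by (intro tendsto_intros) auto
    then show ?thesis by (simp add: logistic_def)
  qed
  show "(\<lambda>n. logistic (real (Suc n) * y)) \<longlonglongrightarrow> 0" if y: "y < 0"
  proof (rule tendsto_sandwich[of "\<lambda>_. 0"])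
    have "filterlim (\<lambda>n. real (Suc n) * y) at_bot sequentially"
      using y by (intro filterlim_tendsto_neg_mult_at_bot[OF tendsto_const _ top, of y, simplified mult.commute[of y]]) simp
    then show "(\<lambda>n. exp (real (Suc n) * y)) \<longlonglongrightarrow> 0" by (rule filterlim_compose[OF exp_at_bot])
  qed (auto simp: logistic_bounds less_imp_le)
qed

section \<open>Separation and density of Schwartz functions\<close>

lemma weight_integrable:
  fixes h :: "real \<Rightarrow> real"
  assumes [measurable]: "h \<in> borel_measurable borel" and i: "integrable lborel (\<lambda>x. (h x)\<^sup>2 / (x\<^sup>2 + 4))"
  shows "integrable lborel (\<lambda>x. \<bar>h x\<bar> * exp (c - \<bar>x\<bar>))"
proof -
  have e: "(x\<^sup>2 + 4) * (exp (c - \<bar>x\<bar>))\<^sup>2 \<le> (272 * (exp c)\<^sup>2) * om x" for x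
  proof -
    have "\<bar>x\<bar> ^ 2 \<le> real 2 ^ 2 * exp \<bar>x\<bar>" by (rule power_le_exp) simp
    then have 1: "x\<^sup>2 + 4 \<le> 8 * exp \<bar>x\<bar>" 
    proof -
      have "1 \<le> exp \<bar>x\<bar>" by simp
      moreover have "x\<^sup>2 \<le> 4 * exp \<bar>x\<bar>" using \<open>\<bar>x\<bar> ^ 2 \<le> real 2 ^ 2 * exp \<bar>x\<bar>\<close> by simp
      ultimately show ?thesis by argo
    qed
    have "(x\<^sup>2 + 4) * (x\<^sup>2 + 4) \<le> (8 * exp \<bar>x\<bar>) * (8 * exp \<bar>x\<bar>)" by (intro mult_mono 1) auto
    then have "(x\<^sup>2 + 4) * (x\<^sup>2 + 4) * exp (- \<bar>x\<bar>) * exp (- \<bar>x\<bar>) \<le> 64"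
      by (simp add: exp_minus field_simps)
    then have "(x\<^sup>2 + 4) * (x\<^sup>2 + 4) * exp (- \<bar>x\<bar>) * exp (- \<bar>x\<bar>) * (exp c)\<^sup>2 \<le> 272 * (exp c)\<^sup>2"
      by (intro mult_right_mono) auto
    moreover have "exp (c - \<bar>x\<bar>) = exp c * exp (- \<bar>x\<bar>)" by (simp flip: exp_add)
    moreover have "0 < 4 + x\<^sup>2" by (simp add: add_pos_nonneg)
    ultimately show ?thesis by (simp add: om_def pos_le_divide_eq power2_eq_square algebra_simps)
  qed
  show ?thesis
  proof (rule Bochner_Integration.integrable_bound)
    show "integrable lborel (\<lambda>x. (h x)\<^sup>2 / (x\<^sup>2 + 4) + (272 * (exp c)\<^sup>2) * om x)"
      using i om_integrable by simp
    show "AE x in lborel. norm (\<bar>h x\<bar> * exp (c - \<bar>x\<bar>)) \<le> norm ((h x)\<^sup>2 / (x\<^sup>2 + 4) + (272 * (exp c)\<^sup>2) * om x)"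
    proof (intro AE_I2)
      fix x :: real
      define s where "s = sqrt (x\<^sup>2 + 4)"
      have p: "0 < x\<^sup>2 + 4" by (simp add: add_nonneg_pos)
      then have s: "0 < s" "s\<^sup>2 = x\<^sup>2 + 4" by (simp_all add: s_def)
      define A B where "A = \<bar>h x\<bar> / s" and "B = s * exp (c - \<bar>x\<bar>)"
      have AB: "\<bar>h x\<bar> * exp (c - \<bar>x\<bar>) = A * B" using s by (simp add: A_def B_def)
      have "A\<^sup>2 = (h x)\<^sup>2 / (x\<^sup>2 + 4)" "B\<^sup>2 = (x\<^sup>2 + 4) * (exp (c - \<bar>x\<bar>))\<^sup>2"
        using s by (simp_all add: A_def B_def power_divide power_mult_distrib)
      moreover have "2 * (A * B) \<le> A\<^sup>2 + B\<^sup>2" using zero_le_power2[of "A - B"] by (simp add: power2_diff)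
      moreover have "0 \<le> A * B" using s by (simp add: A_def B_def)
      ultimately have "A * B \<le> (h x)\<^sup>2 / (x\<^sup>2 + 4) + (272 * (exp c)\<^sup>2) * om x"
        using e[of x] by linarith
      then show "norm (\<bar>h x\<bar> * exp (c - \<bar>x\<bar>)) \<le> norm ((h x)\<^sup>2 / (x\<^sup>2 + 4) + (272 * (exp c)\<^sup>2) * om x)"
        using \<open>0 \<le> A * B\<close> unfolding AB by simp
    qed
  qed measurable
qed

text \<open>The measures whose densities are the positive and the negative part of \<open>f\<close> agree on all half-lines.\<close>

lemma AE_zero_if_interval_integrals_zero:
  fixes f :: "real \<Rightarrow> real"
  assumes f: "integrable lborel f" and z: "\<And>x. (LINT y|lborel. indicator {x<..} y * f y) = 0"
  shows "AE x in lborel. f x = 0"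
proof -
  have [measurable]: "f \<in> borel_measurable borel" using borel_measurable_integrable[OF f] by simp
  define p q where "p x = max 0 (f x)" and "q x = max 0 (- f x)" for x
  have pm[measurable]: "p \<in> borel_measurable borel" and qm[measurable]: "q \<in> borel_measurable borel"
    unfolding p_def q_def by measurable
  have pq: "integrable lborel p" "integrable lborel q"
    by (rule Bochner_Integration.integrable_bound[OF f]; (simp add: p_def q_def)?)+
  define P Q where "P = density lborel (\<lambda>x. ennreal (p x))" and "Q = density lborel (\<lambda>x. ennreal (q x))"
  have em: "emeasure (density lborel (\<lambda>x. ennreal (g x))) {x<..} = ennreal (LINT y|lborel. indicator {x<..} y * g y)"
    if g: "integrable lborel g" "\<And>x. 0 \<le> g x" for g :: "real \<Rightarrow> real" and x
  proof -
    have [measurable]: "g \<in> borel_measurable borel" using borel_measurable_integrable[OF g(1)] by simp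
    have "emeasure (density lborel (\<lambda>x. ennreal (g x))) {x<..} = (\<integral>\<^sup>+y. ennreal (g y) * indicator {x<..} y \<partial>lborel)"
      by (rule emeasure_density) auto
    also have "\<dots> = (\<integral>\<^sup>+y. ennreal (indicator {x<..} y * g y) \<partial>lborel)"
      by (intro nn_integral_cong) (auto simp: indicator_def)
    also have "\<dots> = ennreal (LINT y|lborel. indicator {x<..} y * g y)"
    proof (rule nn_integral_eq_integral)
      show "integrable lborel (\<lambda>y. indicator {x<..} y * g y)"
        using integrable_mult_indicator[OF _ g(1), of "{x<..}"] by simp
    qed (use g(2) in auto)
    finally show ?thesis .
  qed
  have "P = Q"
  proof (rule measure_eqI_lessThan)
    show "sets P = sets borel" "sets Q = sets borel" by (simp_all add: P_def Q_def)
    show "emeasure P {x<..} < \<infinity>" for x unfolding P_def by (subst em[OF pq(1)]) (auto simp: p_def)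
    show "emeasure P {x<..} = emeasure Q {x<..}" for x
    proof -
      have ii: "integrable lborel (\<lambda>y. indicator {x<..} y * p y)" "integrable lborel (\<lambda>y. indicator {x<..} y * q y)"
        using integrable_mult_indicator[OF _ pq(1), of "{x<..}"] integrable_mult_indicator[OF _ pq(2), of "{x<..}"] by simp_all
      have "(LINT y|lborel. indicator {x<..} y * p y) - (LINT y|lborel. indicator {x<..} y * q y) = (LINT y|lborel. indicator {x<..} y * f y)"
        unfolding Bochner_Integration.integral_diff[OF ii, symmetric]
        by (intro Bochner_Integration.integral_cong refl) (auto simp: p_def q_def max_def)
      then have "(LINT y|lborel. indicator {x<..} y * p y) = (LINT y|lborel. indicator {x<..} y * q y)" using z by simp
      then show ?thesis unfolding P_def Q_def by (subst em[OF pq(1)], simp add: p_def, subst em[OF pq(2)], simp add: q_def) simp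
    qed
  qed
  then have "AE x in lborel. ennreal (p x) = ennreal (q x)"
    unfolding P_def Q_def by (intro sigma_finite_measure.density_unique[OF lborel.sigma_finite_measure_axioms]) auto
  then show ?thesis by eventually_elim (auto simp: p_def q_def max_def split: if_splits)
qed

text \<open>The integral of \<open>h\<close> over every bounded interval is the limit of integrals against steep logistic
  products, so it vanishes.\<close>

theorem schwartz_separates:
  fixes h :: "real \<Rightarrow> real"
  assumes hm[measurable]: "h \<in> borel_measurable borel" and i: "integrable lborel (\<lambda>x. (h x)\<^sup>2 / (x\<^sup>2 + 4))"
    and z: "\<And>\<zeta>. schwartz \<zeta> \<Longrightarrow> (LINT x|lborel. h x * \<zeta> x) = 0"
  shows "AE x in lborel. h x = 0"
proof -
  have loc: "integrable lborel (\<lambda>x. indicator {a<..<b} x * h x)" for a b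
  proof (rule Bochner_Integration.integrable_bound[OF weight_integrable[OF hm i, of "\<bar>a\<bar> + \<bar>b\<bar>"]])
    show "AE x in lborel. norm (indicator {a<..<b} x * h x) \<le> norm (\<bar>h x\<bar> * exp (\<bar>a\<bar> + \<bar>b\<bar> - \<bar>x\<bar>))"
    proof (intro AE_I2)
      fix x
      have "\<bar>h x\<bar> * 1 \<le> \<bar>h x\<bar> * exp (\<bar>a\<bar> + \<bar>b\<bar> - \<bar>x\<bar>)" if "a < x" "x < b"
        using that by (intro mult_left_mono) auto
      then show "norm (indicator {a<..<b} x * h x) \<le> norm (\<bar>h x\<bar> * exp (\<bar>a\<bar> + \<bar>b\<bar> - \<bar>x\<bar>))"
        by (auto simp: indicator_def abs_mult)
    qed
  qed measurable
  have zero: "(LINT x|lborel. indicator {a<..<b} x * h x) = 0" if ab: "a < b" for a b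
  proof -
    define \<zeta> where "\<zeta> n x = left_step (real (Suc n)) a x * right_step (real (Suc n)) b x" for n x
    have \<zeta>: "schwartz (\<zeta> n)" for n unfolding \<zeta>_def[abs_def] by (rule schwartz_step_product) simp
    have [measurable]: "\<zeta> n \<in> borel_measurable borel" for n by (rule schwartz_measurable[OF \<zeta>])
    have "(\<lambda>n. LINT x|lborel. h x * \<zeta> n x) \<longlonglongrightarrow> (LINT x|lborel. indicator {a<..<b} x * h x)"
    proof (rule Bochner_Integration.integral_dominated_convergence)
      show "integrable lborel (\<lambda>x. \<bar>h x\<bar> * exp (\<bar>a\<bar> + \<bar>b\<bar> - \<bar>x\<bar>))" by (rule weight_integrable[OF hm i])
      show "AE x in lborel. norm (h x * \<zeta> n x) \<le> \<bar>h x\<bar> * exp (\<bar>a\<bar> + \<bar>b\<bar> - \<bar>x\<bar>)" for n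
      proof (intro AE_I2)
        fix x
        have "0 \<le> \<zeta> n x" unfolding \<zeta>_def using step_bounds by (intro mult_nonneg_nonneg) (auto intro: less_imp_le)
        then show "norm (h x * \<zeta> n x) \<le> \<bar>h x\<bar> * exp (\<bar>a\<bar> + \<bar>b\<bar> - \<bar>x\<bar>)"
          using step_product_bound[of "real (Suc n)" a x b] by (simp add: abs_mult mult_left_mono \<zeta>_def)
      qed
      show "AE x in lborel. (\<lambda>n. h x * \<zeta> n x) \<longlonglongrightarrow> indicator {a<..<b} x * h x"
        using AE_lborel_singleton[of a] AE_lborel_singleton[of b]
      proof eventually_elim
        case (elim x)
        have "(\<lambda>n. \<zeta> n x) \<longlonglongrightarrow> indicator {a<..<b} x"
        proof -
          consider "x < a" | "b < x" | "a < x" "x < b" using elim by linarith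
          then show ?thesis
          proof cases
            case 1
            then have "(\<lambda>n. logistic (real (Suc n) * (x - a)) * logistic (real (Suc n) * (b - x))) \<longlonglongrightarrow> 0 * 1"
              using ab by (intro tendsto_mult logistic_limits) auto
            then show ?thesis using 1 by (simp add: \<zeta>_def left_step_def right_step_def)
          next
            case 2
            then have "(\<lambda>n. logistic (real (Suc n) * (x - a)) * logistic (real (Suc n) * (b - x))) \<longlonglongrightarrow> 1 * 0"
              using ab by (intro tendsto_mult logistic_limits) auto
            then show ?thesis using 2 by (simp add: \<zeta>_def left_step_def right_step_def)
          next
            case 3
            then have "(\<lambda>n. logistic (real (Suc n) * (x - a)) * logistic (real (Suc n) * (b - x))) \<longlonglongrightarrow> 1 * 1"
              by (intro tendsto_mult logistic_limits) auto
            then show ?thesis using 3 by (simp add: \<zeta>_def left_step_def right_step_def)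
          qed
        qed
        from tendsto_mult_left[OF this, of "h x"] show ?case by (simp add: mult.commute)
      qed
    qed measurable
    then show ?thesis using z[OF \<zeta>] by (simp add: LIMSEQ_const_iff)
  qed
  have "AE x in lborel. indicator {- real n<..<real n} x * h x = 0" for n
  proof (rule AE_zero_if_interval_integrals_zero[OF loc])
    fix x
    have "(\<lambda>y. indicator {x<..} y * (indicator {- real n<..<real n} y * h y)) = (\<lambda>y. indicator {max x (- real n)<..<real n} y * h y)"
      by (auto simp: indicator_def fun_eq_iff)
    then show "(LINT y|lborel. indicator {x<..} y * (indicator {- real n<..<real n} y * h y)) = 0"
      using zero[of "max x (- real n)" "real n"] by (cases "max x (- real n) < real n") auto
  qed
  then have "AE x in lborel. \<forall>n. indicator {- real n<..<real n} x * h x = 0" unfolding AE_all_countable by blast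
  then show ?thesis
  proof eventually_elim
    case (elim x)
    obtain n where "\<bar>x\<bar> < real n" using reals_Archimedean2 by blast
    then have "x \<in> {- real n<..<real n}" by auto
    then show ?case using elim[rule_format, of n] by simp
  qed
qed

lemma schwartz_sqint: "schwartz f \<Longrightarrow> sqint lborel f"
  unfolding sqint_def using schwartz_measurable[of f] decays_integrable[OF decays_power[OF schwartz_decays[of f], of 2]] by auto

text \<open>The difference of \<open>k\<close> and its projection to the closure of the Schwartz functions is orthogonal to
  all of them, hence \<open>0\<close> by \<open>schwartz_separates\<close>.\<close>

theorem schwartz_dense_L2:
  assumes k: "sqint lborel k" and e: "0 < e"
  shows "\<exists>\<zeta>. schwartz \<zeta> \<and> (LINT x|lborel. (k x - \<zeta> x)\<^sup>2) < e"
proof -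
  define C where "C = {\<lambda>x. k x - \<zeta> x | \<zeta>. schwartz \<zeta>}"
  have z0: "schwartz (\<lambda>x. 0)" using schwartz_diff[OF schwartz_step_product[of 1 0 0] schwartz_step_product[of 1 0 0]] by simp
  have CI: "g \<in> C" if "schwartz \<zeta>" "g = (\<lambda>x. k x - \<zeta> x)" for \<zeta> g using that by (auto simp: C_def)
  have sq: "sqint lborel f" if "f \<in> C" for f using that k by (auto simp: C_def intro: sqint_diff schwartz_sqint)
  have "\<exists>v f. (\<forall>n::nat. v n \<in> C) \<and> L2_tendsto lborel v f \<and> (LINT x|lborel. (f x)\<^sup>2) \<le> (LINT x|lborel. (k x)\<^sup>2) \<and>
     (\<forall>g. (\<forall>n::nat. g \<in> C) \<longrightarrow> (LINT x|lborel. (f x)\<^sup>2) \<le> (LINT x|lborel. (g x)\<^sup>2))"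
  proof (rule L2_minimizing_sequence[OF lborel.sigma_finite_measure_axioms, of "\<lambda>_. C"])
    show "(\<lambda>x. (f x + g x) / 2) \<in> C" if fg: "f \<in> C" "g \<in> C" for f g
    proof -
      obtain \<phi> \<psi> where s: "schwartz \<phi>" "schwartz \<psi>" and f: "f = (\<lambda>x. k x - \<phi> x)" and g: "g = (\<lambda>x. k x - \<psi> x)"
        using fg by (auto simp: C_def)
      have "schwartz (\<lambda>x. 1/2 * (\<phi> x + \<psi> x))" by (intro schwartz_cmult schwartz_add s)
      moreover have "(\<lambda>x. (f x + g x) / 2) = (\<lambda>x. k x - 1/2 * (\<phi> x + \<psi> x))" by (simp add: f g fun_eq_iff field_simps)
      ultimately show ?thesis by (rule CI)
    qed
    have "k \<in> C" by (rule CI[OF z0]) simp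
    then show "\<exists>f\<in>C. (LINT x|lborel. (f x)\<^sup>2) \<le> (LINT x|lborel. (k x)\<^sup>2)" by blast
  qed (use sq in auto)
  then obtain v f where v: "\<And>n. v n \<in> C" and lim: "L2_tendsto lborel v f"
    and min: "\<And>g. g \<in> C \<Longrightarrow> (LINT x|lborel. (f x)\<^sup>2) \<le> (LINT x|lborel. (g x)\<^sup>2)" by blast
  have fs: "sqint lborel f" using lim by (simp add: L2_tendsto_def)
  have orth: "(LINT x|lborel. f x * \<zeta> x) = 0" if \<zeta>: "schwartz \<zeta>" for \<zeta>
  proof -
    define b c where "b = (LINT x|lborel. (\<zeta> x)\<^sup>2)" and "c = (LINT x|lborel. f x * \<zeta> x)"
    have \<zeta>s: "sqint lborel \<zeta>" by (rule schwartz_sqint[OF \<zeta>])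
    have q: "0 \<le> 2 * t * c + t\<^sup>2 * b" for t
    proof -
      have "L2_tendsto lborel (\<lambda>n x. v n x + t * \<zeta> x) (\<lambda>x. f x + t * \<zeta> x)"
        by (intro L2_tendsto_add lim sqint_cmult \<zeta>s)
      then have l: "(\<lambda>n. LINT x|lborel. (v n x + t * \<zeta> x)\<^sup>2) \<longlonglongrightarrow> (LINT x|lborel. (f x + t * \<zeta> x)\<^sup>2)"
        by (rule L2_tendsto_norm)
      have "(\<lambda>x. v n x + t * \<zeta> x) \<in> C" for n
      proof -
        obtain \<phi> where \<phi>: "schwartz \<phi>" "v n = (\<lambda>x. k x - \<phi> x)" using v[of n] by (auto simp: C_def)
        have "schwartz (\<lambda>x. \<phi> x - t * \<zeta> x)" by (intro schwartz_diff schwartz_cmult \<phi> \<zeta>)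
        moreover have "(\<lambda>x. v n x + t * \<zeta> x) = (\<lambda>x. k x - (\<phi> x - t * \<zeta> x))" by (simp add: \<phi>(2) fun_eq_iff)
        ultimately show ?thesis by (rule CI)
      qed
      then have "(LINT x|lborel. (f x)\<^sup>2) \<le> (LINT x|lborel. (f x + t * \<zeta> x)\<^sup>2)"
        using min by (intro LIMSEQ_le_const[OF l]) auto
      then show ?thesis unfolding sq_integral_add[OF fs \<zeta>s] by (simp add: b_def c_def)
    qed
    have b: "0 \<le> b" by (simp add: b_def)
    define s where "s = c / (b + 1)"
    have c: "c = s * (b + 1)" using b by (simp add: s_def)
    have "2 * (- s) * c + (- s)\<^sup>2 * b = - (s\<^sup>2 * (b + 2))"
      unfolding c by (simp add: power2_eq_square algebra_simps)
    then have "s\<^sup>2 * (b + 2) \<le> 0" using q[of "- s"] by simp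
    then have "s = 0" using b by (simp add: mult_le_0_iff)
    then have "c = 0" using c by simp
    then show ?thesis by (simp add: c_def)
  qed
  have "AE x in lborel. f x = 0"
  proof (rule schwartz_separates)
    show fm[measurable]: "f \<in> borel_measurable borel" using fs by (simp add: sqint_def)
    show "integrable lborel (\<lambda>x. (f x)\<^sup>2 / (x\<^sup>2 + 4))"
    proof (rule Bochner_Integration.integrable_bound[of lborel "\<lambda>x. (f x)\<^sup>2"])
      show "integrable lborel (\<lambda>x. (f x)\<^sup>2)" using fs by (simp add: sqint_def)
      show "AE x in lborel. norm ((f x)\<^sup>2 / (x\<^sup>2 + 4)) \<le> norm ((f x)\<^sup>2)"
      proof (intro AE_I2)
        fix x :: real
        have "1 \<le> x\<^sup>2 + 4" "0 < x\<^sup>2 + 4" by (simp_all add: add_increasing add_nonneg_pos)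
        then show "norm ((f x)\<^sup>2 / (x\<^sup>2 + 4)) \<le> norm ((f x)\<^sup>2)"
          using divide_left_mono[of 1 "x\<^sup>2 + 4" "(f x)\<^sup>2"] by simp
      qed
    qed measurable
  qed (rule orth)
  then have "(LINT x|lborel. (f x)\<^sup>2) = 0" by (intro integral_eq_zero_AE) (auto elim!: eventually_mono)
  then have "(\<lambda>n. LINT x|lborel. (v n x)\<^sup>2) \<longlonglongrightarrow> 0" using L2_tendsto_norm[OF lim] by simp
  then have "\<forall>\<^sub>F n in sequentially. (LINT x|lborel. (v n x)\<^sup>2) < e" using e by (rule order_tendstoD)
  then obtain n where "(LINT x|lborel. (v n x)\<^sup>2) < e" using eventually_sequentially by auto
  then show ?thesis using v[of n] unfolding C_def by auto
qed

section \<open>The Fourier side of negative Sobolev regularity\<close>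

text \<open>Real and imaginary part of \<open>g / (2 + i \<xi>)\<close>. If \<open>g\<close> is the Fourier transform of \<open>h' + 2 h\<close>, this is
  the transform of \<open>h\<close>; the norm in \<open>H\<^sup>-\<^sup>1\<close> is the \<open>L\<^sup>2\<close> norm of this quotient.\<close>

definition half_re :: "(real \<Rightarrow> complex) \<Rightarrow> real \<Rightarrow> real" where "half_re g \<xi> = Re (g \<xi> / (2 + \<i> * \<xi>))"
definition half_im :: "(real \<Rightarrow> complex) \<Rightarrow> real \<Rightarrow> real" where "half_im g \<xi> = Im (g \<xi> / (2 + \<i> * \<xi>))"

definition Hm1_weight :: "(real \<Rightarrow> complex) \<Rightarrow> bool" where
  "Hm1_weight g \<longleftrightarrow> g \<in> borel_measurable borel \<and> integrable lborel (\<lambda>\<xi>. (cmod (g \<xi>))\<^sup>2 / (\<xi>\<^sup>2 + 4))"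

definition Hm1_size :: "(real \<Rightarrow> complex) \<Rightarrow> real" where
  "Hm1_size g = (LINT \<xi>|lborel. (cmod (g \<xi>))\<^sup>2 / (\<xi>\<^sup>2 + 4))"

lemma two_plus_ne: "2 + \<i> * complex_of_real \<xi> \<noteq> 0"
  by (simp add: complex_eq_iff)

lemma cmod_two_plus: "(cmod (2 + \<i> * complex_of_real \<xi>))\<^sup>2 = \<xi>\<^sup>2 + 4"
  by (simp add: cmod_power2)

lemma half_eq: "g \<xi> = (2 + \<i> * \<xi>) * Complex (half_re g \<xi>) (half_im g \<xi>)"
proof -
  have "Complex (half_re g \<xi>) (half_im g \<xi>) = g \<xi> / (2 + \<i> * \<xi>)" by (simp add: half_re_def half_im_def)
  then show ?thesis using two_plus_ne[of \<xi>] by simp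
qed

lemma half_Re_Im: "Re (g \<xi>) = 2 * half_re g \<xi> - \<xi> * half_im g \<xi>" "Im (g \<xi>) = 2 * half_im g \<xi> + \<xi> * half_re g \<xi>"
  by (subst half_eq[of g], simp)+

lemma half_sum: "(half_re g \<xi>)\<^sup>2 + (half_im g \<xi>)\<^sup>2 = (cmod (g \<xi>))\<^sup>2 / (\<xi>\<^sup>2 + 4)"
  unfolding half_re_def half_im_def cmod_power2[symmetric]
  by (simp only: norm_divide power_divide cmod_two_plus)

lemma half_sqint:
  assumes "Hm1_weight g"
  shows "sqint lborel (half_re g)" "sqint lborel (half_im g)"
    "(LINT \<xi>|lborel. (half_re g \<xi>)\<^sup>2) + (LINT \<xi>|lborel. (half_im g \<xi>)\<^sup>2) = Hm1_size g"
proof -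
  have [measurable]: "g \<in> borel_measurable borel" using assms by (simp add: Hm1_weight_def)
  have [measurable]: "half_re g \<in> borel_measurable borel" unfolding half_re_def by measurable
  have [measurable]: "half_im g \<in> borel_measurable borel" unfolding half_im_def by measurable
  have i: "integrable lborel (\<lambda>\<xi>. (cmod (g \<xi>))\<^sup>2 / (\<xi>\<^sup>2 + 4))" using assms by (simp add: Hm1_weight_def)
  have b: "norm ((half_re g \<xi>)\<^sup>2) \<le> norm ((cmod (g \<xi>))\<^sup>2 / (\<xi>\<^sup>2 + 4))"
    "norm ((half_im g \<xi>)\<^sup>2) \<le> norm ((cmod (g \<xi>))\<^sup>2 / (\<xi>\<^sup>2 + 4))" for \<xi>
    unfolding half_sum[symmetric] by simp_all
  have 1: "integrable lborel (\<lambda>\<xi>. (half_re g \<xi>)\<^sup>2)"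
    by (rule Bochner_Integration.integrable_bound[OF i _ AE_I2]) (use b in auto)
  have 2: "integrable lborel (\<lambda>\<xi>. (half_im g \<xi>)\<^sup>2)"
    by (rule Bochner_Integration.integrable_bound[OF i _ AE_I2]) (use b in auto)
  show "sqint lborel (half_re g)" "sqint lborel (half_im g)" using 1 2 by (simp_all add: sqint_def)
  show "(LINT \<xi>|lborel. (half_re g \<xi>)\<^sup>2) + (LINT \<xi>|lborel. (half_im g \<xi>)\<^sup>2) = Hm1_size g"
    unfolding Bochner_Integration.integral_add[OF 1 2, symmetric] half_sum Hm1_size_def ..
qed

lemma Hm1_pairing_parts:
  assumes g: "Hm1_weight g" and \<phi>: "schwartz \<phi>"
  shows "integrable lborel (\<lambda>\<xi>. Re (g \<xi>) * \<phi> \<xi>)" "integrable lborel (\<lambda>\<xi>. Im (g \<xi>) * \<phi> \<xi>)"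
    "(LINT \<xi>|lborel. g \<xi> * complex_of_real (\<phi> \<xi>)) = Complex (LINT \<xi>|lborel. Re (g \<xi>) * \<phi> \<xi>) (LINT \<xi>|lborel. Im (g \<xi>) * \<phi> \<xi>)"
    "\<bar>LINT \<xi>|lborel. Re (g \<xi>) * \<phi> \<xi>\<bar> \<le> sqrt (Hm1_size g) * (2 * sqrt (LINT \<xi>|lborel. (\<phi> \<xi>)\<^sup>2) + sqrt (LINT \<xi>|lborel. (\<xi> * \<phi> \<xi>)\<^sup>2))"
    "\<bar>LINT \<xi>|lborel. Im (g \<xi>) * \<phi> \<xi>\<bar> \<le> sqrt (Hm1_size g) * (2 * sqrt (LINT \<xi>|lborel. (\<phi> \<xi>)\<^sup>2) + sqrt (LINT \<xi>|lborel. (\<xi> * \<phi> \<xi>)\<^sup>2))"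
proof -
  note h = half_sqint[OF g]
  have s: "sqint lborel \<phi>" "sqint lborel (\<lambda>\<xi>. \<xi> * \<phi> \<xi>)" by (intro schwartz_sqint schwartz_mult_x \<phi>)+
  have re: "Re (g \<xi>) * \<phi> \<xi> = 2 * (half_re g \<xi> * \<phi> \<xi>) - half_im g \<xi> * (\<xi> * \<phi> \<xi>)" for \<xi>
    by (simp add: half_Re_Im(1)[of g] algebra_simps)
  have im: "Im (g \<xi>) * \<phi> \<xi> = 2 * (half_im g \<xi> * \<phi> \<xi>) + half_re g \<xi> * (\<xi> * \<phi> \<xi>)" for \<xi>
    by (simp add: half_Re_Im(2)[of g] algebra_simps)
  have i: "integrable lborel (\<lambda>\<xi>. half_re g \<xi> * \<phi> \<xi>)" "integrable lborel (\<lambda>\<xi>. half_im g \<xi> * \<phi> \<xi>)"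
    "integrable lborel (\<lambda>\<xi>. half_re g \<xi> * (\<xi> * \<phi> \<xi>))" "integrable lborel (\<lambda>\<xi>. half_im g \<xi> * (\<xi> * \<phi> \<xi>))"
    by (intro sqint_mult h s)+
  show 1: "integrable lborel (\<lambda>\<xi>. Re (g \<xi>) * \<phi> \<xi>)" unfolding re using i by simp
  show 2: "integrable lborel (\<lambda>\<xi>. Im (g \<xi>) * \<phi> \<xi>)" unfolding im using i by simp
  have "(LINT \<xi>|lborel. g \<xi> * complex_of_real (\<phi> \<xi>)) = (LINT \<xi>|lborel. complex_of_real (Re (g \<xi>) * \<phi> \<xi>) + \<i> * complex_of_real (Im (g \<xi>) * \<phi> \<xi>))"
    by (intro Bochner_Integration.integral_cong refl) (simp add: complex_eq_iff)
  then show "(LINT \<xi>|lborel. g \<xi> * complex_of_real (\<phi> \<xi>)) = Complex (LINT \<xi>|lborel. Re (g \<xi>) * \<phi> \<xi>) (LINT \<xi>|lborel. Im (g \<xi>) * \<phi> \<xi>)"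
    using complex_integral_split[OF 1 2] by simp
  have nn: "0 \<le> (LINT \<xi>|lborel. (half_re g \<xi>)\<^sup>2)" "0 \<le> (LINT \<xi>|lborel. (half_im g \<xi>)\<^sup>2)" by simp_all
  have le: "(LINT \<xi>|lborel. (half_re g \<xi>)\<^sup>2) \<le> Hm1_size g" "(LINT \<xi>|lborel. (half_im g \<xi>)\<^sup>2) \<le> Hm1_size g"
    using h(3) nn by linarith+
  have cs: "\<bar>LINT \<xi>|lborel. f \<xi> * p \<xi>\<bar> \<le> sqrt (Hm1_size g) * sqrt (LINT \<xi>|lborel. (p \<xi>)\<^sup>2)"
    if "f = half_re g \<or> f = half_im g" "sqint lborel p" for f p
  proof -
    have f: "sqint lborel f" "(LINT \<xi>|lborel. (f \<xi>)\<^sup>2) \<le> Hm1_size g" using that h le by auto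
    have "(LINT \<xi>|lborel. f \<xi> * p \<xi>)\<^sup>2 \<le> (LINT \<xi>|lborel. (f \<xi>)\<^sup>2) * (LINT \<xi>|lborel. (p \<xi>)\<^sup>2)"
      by (rule cauchy_schwarz_integral[OF f(1) that(2)])
    also have "\<dots> \<le> Hm1_size g * (LINT \<xi>|lborel. (p \<xi>)\<^sup>2)" by (intro mult_right_mono f) simp
    finally show ?thesis using real_sqrt_le_mono by (fastforce simp: real_sqrt_mult)
  qed
  have "(LINT \<xi>|lborel. Re (g \<xi>) * \<phi> \<xi>) = 2 * (LINT \<xi>|lborel. half_re g \<xi> * \<phi> \<xi>) - (LINT \<xi>|lborel. half_im g \<xi> * (\<xi> * \<phi> \<xi>))"
    unfolding re using i by simp
  then show "\<bar>LINT \<xi>|lborel. Re (g \<xi>) * \<phi> \<xi>\<bar> \<le> sqrt (Hm1_size g) * (2 * sqrt (LINT \<xi>|lborel. (\<phi> \<xi>)\<^sup>2) + sqrt (LINT \<xi>|lborel. (\<xi> * \<phi> \<xi>)\<^sup>2))"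
    using cs[of "half_re g", OF _ s(1)] cs[of "half_im g", OF _ s(2)] unfolding distrib_left by simp
  have "(LINT \<xi>|lborel. Im (g \<xi>) * \<phi> \<xi>) = 2 * (LINT \<xi>|lborel. half_im g \<xi> * \<phi> \<xi>) + (LINT \<xi>|lborel. half_re g \<xi> * (\<xi> * \<phi> \<xi>))"
    unfolding im using i by simp
  then show "\<bar>LINT \<xi>|lborel. Im (g \<xi>) * \<phi> \<xi>\<bar> \<le> sqrt (Hm1_size g) * (2 * sqrt (LINT \<xi>|lborel. (\<phi> \<xi>)\<^sup>2) + sqrt (LINT \<xi>|lborel. (\<xi> * \<phi> \<xi>)\<^sup>2))"
    using cs[of "half_im g", OF _ s(1)] cs[of "half_re g", OF _ s(2)] unfolding distrib_left by simp
qed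

lemma Hm1_fourierD:
  assumes "Hm1_fourier T g"
  shows "Hm1_weight g"
    and "schwartz \<phi> \<Longrightarrow> T (\<lambda>\<xi>. Re (fourier \<phi> \<xi>)) = (LINT \<xi>|lborel. Re (g \<xi>) * \<phi> \<xi>)"
    and "schwartz \<phi> \<Longrightarrow> T (\<lambda>\<xi>. Im (fourier \<phi> \<xi>)) = (LINT \<xi>|lborel. Im (g \<xi>) * \<phi> \<xi>)"
proof -
  show w: "Hm1_weight g" using assms by (simp add: Hm1_fourier_def Hm1_weight_def)
  have eq: "Complex (T (\<lambda>\<xi>. Re (fourier \<phi> \<xi>))) (T (\<lambda>\<xi>. Im (fourier \<phi> \<xi>)))
    = Complex (LINT \<xi>|lborel. Re (g \<xi>) * \<phi> \<xi>) (LINT \<xi>|lborel. Im (g \<xi>) * \<phi> \<xi>)" if "schwartz \<phi>"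
    unfolding Hm1_pairing_parts(3)[OF w that, symmetric] using assms that by (simp add: Hm1_fourier_def)
  show "schwartz \<phi> \<Longrightarrow> T (\<lambda>\<xi>. Re (fourier \<phi> \<xi>)) = (LINT \<xi>|lborel. Re (g \<xi>) * \<phi> \<xi>)"
   "schwartz \<phi> \<Longrightarrow> T (\<lambda>\<xi>. Im (fourier \<phi> \<xi>)) = (LINT \<xi>|lborel. Im (g \<xi>) * \<phi> \<xi>)"
    using eq by auto
qed

lemma Hm1_fourierI:
  assumes w: "Hm1_weight g"
    and "\<And>\<phi>. schwartz \<phi> \<Longrightarrow> T (\<lambda>\<xi>. Re (fourier \<phi> \<xi>)) = (LINT \<xi>|lborel. Re (g \<xi>) * \<phi> \<xi>)"
    and "\<And>\<phi>. schwartz \<phi> \<Longrightarrow> T (\<lambda>\<xi>. Im (fourier \<phi> \<xi>)) = (LINT \<xi>|lborel. Im (g \<xi>) * \<phi> \<xi>)"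
  shows "Hm1_fourier T g"
  using assms Hm1_pairing_parts(3)[OF w] by (auto simp: Hm1_fourier_def Hm1_weight_def)

lemma Hm1_weight_parts:
  assumes "Hm1_weight g"
  shows "(\<lambda>\<xi>. Re (g \<xi>)) \<in> borel_measurable borel" "integrable lborel (\<lambda>\<xi>. (Re (g \<xi>))\<^sup>2 / (\<xi>\<^sup>2 + 4))"
    "(\<lambda>\<xi>. Im (g \<xi>)) \<in> borel_measurable borel" "integrable lborel (\<lambda>\<xi>. (Im (g \<xi>))\<^sup>2 / (\<xi>\<^sup>2 + 4))"
proof -
  have [measurable]: "g \<in> borel_measurable borel" using assms by (simp add: Hm1_weight_def)
  have i: "integrable lborel (\<lambda>\<xi>. (cmod (g \<xi>))\<^sup>2 / (\<xi>\<^sup>2 + 4))" using assms by (simp add: Hm1_weight_def)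
  have p: "0 < \<xi>\<^sup>2 + 4" for \<xi> :: real by (simp add: add_nonneg_pos)
  show [measurable]: "(\<lambda>\<xi>. Re (g \<xi>)) \<in> borel_measurable borel" "(\<lambda>\<xi>. Im (g \<xi>)) \<in> borel_measurable borel" by measurable
  have le: "norm ((Re (g \<xi>))\<^sup>2 / (\<xi>\<^sup>2 + 4)) \<le> norm ((cmod (g \<xi>))\<^sup>2 / (\<xi>\<^sup>2 + 4))"
    "norm ((Im (g \<xi>))\<^sup>2 / (\<xi>\<^sup>2 + 4)) \<le> norm ((cmod (g \<xi>))\<^sup>2 / (\<xi>\<^sup>2 + 4))" for \<xi>
    using p[of \<xi>] by (simp_all add: cmod_power2 divide_right_mono)
  show "integrable lborel (\<lambda>\<xi>. (Re (g \<xi>))\<^sup>2 / (\<xi>\<^sup>2 + 4))"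
    by (rule Bochner_Integration.integrable_bound[OF i _ AE_I2[OF le(1)]]) measurable
  show "integrable lborel (\<lambda>\<xi>. (Im (g \<xi>))\<^sup>2 / (\<xi>\<^sup>2 + 4))"
    by (rule Bochner_Integration.integrable_bound[OF i _ AE_I2[OF le(2)]]) measurable
qed

lemma weighted_diff_integrable:
  fixes f g :: "real \<Rightarrow> real"
  assumes [measurable]: "f \<in> borel_measurable borel" "g \<in> borel_measurable borel"
    and i: "integrable lborel (\<lambda>\<xi>. (f \<xi>)\<^sup>2 / (\<xi>\<^sup>2 + 4))" "integrable lborel (\<lambda>\<xi>. (g \<xi>)\<^sup>2 / (\<xi>\<^sup>2 + 4))"
  shows "integrable lborel (\<lambda>\<xi>. (f \<xi> - g \<xi>)\<^sup>2 / (\<xi>\<^sup>2 + 4))"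
proof (rule Bochner_Integration.integrable_bound)
  show "integrable lborel (\<lambda>\<xi>. 2 * ((f \<xi>)\<^sup>2 / (\<xi>\<^sup>2 + 4)) + 2 * ((g \<xi>)\<^sup>2 / (\<xi>\<^sup>2 + 4)))"
    by (intro Bochner_Integration.integrable_add integrable_mult_right i)
  show "AE \<xi> in lborel. norm ((f \<xi> - g \<xi>)\<^sup>2 / (\<xi>\<^sup>2 + 4)) \<le> norm (2 * ((f \<xi>)\<^sup>2 / (\<xi>\<^sup>2 + 4)) + 2 * ((g \<xi>)\<^sup>2 / (\<xi>\<^sup>2 + 4)))"
  proof (intro AE_I2)
    fix \<xi> :: real
    have p: "0 < \<xi>\<^sup>2 + 4" by (simp add: add_nonneg_pos)
    have "(f \<xi> - g \<xi>)\<^sup>2 \<le> 2 * (f \<xi>)\<^sup>2 + 2 * (g \<xi>)\<^sup>2"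
      using zero_le_power2[of "f \<xi> + g \<xi>"] by (simp add: power2_sum power2_diff)
    from divide_right_mono[OF this, of "\<xi>\<^sup>2 + 4"] p
    have "(f \<xi> - g \<xi>)\<^sup>2 / (\<xi>\<^sup>2 + 4) \<le> 2 * ((f \<xi>)\<^sup>2 / (\<xi>\<^sup>2 + 4)) + 2 * ((g \<xi>)\<^sup>2 / (\<xi>\<^sup>2 + 4))" by (simp add: add_divide_distrib)
    then show "norm ((f \<xi> - g \<xi>)\<^sup>2 / (\<xi>\<^sup>2 + 4)) \<le> norm (2 * ((f \<xi>)\<^sup>2 / (\<xi>\<^sup>2 + 4)) + 2 * ((g \<xi>)\<^sup>2 / (\<xi>\<^sup>2 + 4)))"
      using p by simp
  qed
qed measurable

lemma Hm1_fourier_diff: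
  assumes "Hm1_fourier T g" "Hm1_fourier T' g'"
  shows "Hm1_fourier (\<lambda>\<phi>. T \<phi> - T' \<phi>) (\<lambda>\<xi>. g \<xi> - g' \<xi>)"
proof (rule Hm1_fourierI)
  note w = Hm1_fourierD(1)[OF assms(1)] Hm1_fourierD(1)[OF assms(2)]
  note p = Hm1_weight_parts[OF w(1)] Hm1_weight_parts[OF w(2)]
  have "integrable lborel (\<lambda>\<xi>. (Re (g \<xi>) - Re (g' \<xi>))\<^sup>2 / (\<xi>\<^sup>2 + 4) + (Im (g \<xi>) - Im (g' \<xi>))\<^sup>2 / (\<xi>\<^sup>2 + 4))"
    by (intro Bochner_Integration.integrable_add weighted_diff_integrable p)
  then have "integrable lborel (\<lambda>\<xi>. (cmod (g \<xi> - g' \<xi>))\<^sup>2 / (\<xi>\<^sup>2 + 4))"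
    by (simp add: cmod_power2 add_divide_distrib)
  then show "Hm1_weight (\<lambda>\<xi>. g \<xi> - g' \<xi>)" using w by (auto simp: Hm1_weight_def)
  show "T (\<lambda>\<xi>. Re (fourier \<phi> \<xi>)) - T' (\<lambda>\<xi>. Re (fourier \<phi> \<xi>)) = (LINT \<xi>|lborel. Re (g \<xi> - g' \<xi>) * \<phi> \<xi>)"
    and "T (\<lambda>\<xi>. Im (fourier \<phi> \<xi>)) - T' (\<lambda>\<xi>. Im (fourier \<phi> \<xi>)) = (LINT \<xi>|lborel. Im (g \<xi> - g' \<xi>) * \<phi> \<xi>)"
    if "schwartz \<phi>" for \<phi>
    using Hm1_fourierD(2,3)[OF assms(1) that] Hm1_fourierD(2,3)[OF assms(2) that]
      Hm1_pairing_parts(1,2)[OF w(1) that] Hm1_pairing_parts(1,2)[OF w(2) that]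
    by (simp_all add: left_diff_distrib)
qed

lemma Hm1_fourier_unique:
  assumes "Hm1_fourier T g" "Hm1_fourier T g'"
  shows "AE \<xi> in lborel. g \<xi> = g' \<xi>"
proof -
  note d = Hm1_fourier_diff[OF assms]
  note w = Hm1_fourierD(1)[OF d]
  note p = Hm1_weight_parts[OF w]
  have "AE \<xi> in lborel. Re (g \<xi> - g' \<xi>) = 0"
    by (rule schwartz_separates[OF p(1,2)]) (use Hm1_fourierD(2)[OF d] in simp)
  moreover have "AE \<xi> in lborel. Im (g \<xi> - g' \<xi>) = 0"
    by (rule schwartz_separates[OF p(3,4)]) (use Hm1_fourierD(3)[OF d] in simp)
  ultimately show ?thesis by eventually_elim (simp add: complex_eq_iff)
qed

text \<open>The value of the norm does not depend on the representative picked by \<open>SOME\<close>, by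
  \<open>Hm1_fourier_unique\<close>.\<close>

lemma Hm1_norm_eq:
  assumes g: "Hm1_fourier T g" shows "Hm1_norm T = sqrt (Hm1_size g)"
proof -
  have s: "Hm1_fourier T (SOME g. Hm1_fourier T g)" using g by (rule someI[where P="Hm1_fourier T"])
  have "(LINT \<xi>|lborel. (cmod ((SOME g. Hm1_fourier T g) \<xi>))\<^sup>2 / (\<xi>\<^sup>2 + 4)) = Hm1_size g"
    unfolding Hm1_size_def
  proof (rule integral_cong_AE)
    have [measurable]: "g \<in> borel_measurable borel" "(SOME g. Hm1_fourier T g) \<in> borel_measurable borel"
      using g s by (auto simp: Hm1_fourier_def)
    show "(\<lambda>\<xi>. (cmod ((SOME g. Hm1_fourier T g) \<xi>))\<^sup>2 / (\<xi>\<^sup>2 + 4)) \<in> borel_measurable lborel"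
      "(\<lambda>\<xi>. (cmod (g \<xi>))\<^sup>2 / (\<xi>\<^sup>2 + 4)) \<in> borel_measurable lborel" by measurable
    show "AE \<xi> in lborel. (cmod ((SOME g. Hm1_fourier T g) \<xi>))\<^sup>2 / (\<xi>\<^sup>2 + 4) = (cmod (g \<xi>))\<^sup>2 / (\<xi>\<^sup>2 + 4)"
      using Hm1_fourier_unique[OF s g] by eventually_elim simp
  qed
  then show ?thesis by (simp add: Hm1_norm_def)
qed

text \<open>By Fourier inversion \<open>\<phi>\<close> is the sum of \<open>Re (fourier p)\<close> and \<open>Im (fourier q)\<close>, where \<open>p\<close> and \<open>q\<close> are the
  real and the imaginary part of \<open>fourier \<phi>\<close>. On such functions a distribution in \<open>H\<^sup>-\<^sup>1\<close> is given by an
  integral against its transform, to which the Cauchy-Schwarz inequality applies.\<close>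

lemma Hm1_pairing_bound:
  assumes \<phi>: "schwartz \<phi>"
  shows "\<exists>C. \<forall>T\<in>Hm1. \<forall>T'\<in>Hm1. \<bar>T \<phi> - T' \<phi>\<bar> \<le> C * Hm1_norm (\<lambda>\<phi>. T \<phi> - T' \<phi>)"
proof -
  define R where "R p = 2 * sqrt (LINT \<xi>|lborel. (p \<xi>)\<^sup>2) + sqrt (LINT \<xi>|lborel. (\<xi> * p \<xi>)\<^sup>2)" for p :: "real \<Rightarrow> real"
  define p where "p = (\<lambda>\<xi>. Re (fourier \<phi> \<xi>))"
  define q where "q = (\<lambda>\<xi>. Im (fourier \<phi> \<xi>))"
  have pq: "schwartz p" "schwartz q" unfolding p_def q_def by (intro schwartz_fourier \<phi>)+
  have inv: "\<phi> x = Re (fourier p x) + Im (fourier q x)" for x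
    unfolding fourier_Re_Im[OF schwartz_integrable[OF pq(1)]] fourier_Re_Im[OF schwartz_integrable[OF pq(2)]]
    unfolding p_def q_def fourier_Re_Im[OF schwartz_integrable[OF \<phi>]] cosT_cmult sinT_cmult
    using trig_inversion_sum[OF \<phi>, of x] by (simp add: field_simps)
  have form: "T \<phi> = (LINT \<xi>|lborel. Re (g \<xi>) * p \<xi>) + (LINT \<xi>|lborel. Im (g \<xi>) * q \<xi>)"
    if T: "tempered T" "Hm1_fourier T g" for T g
  proof -
    have "T \<phi> = T (\<lambda>x. Re (fourier p x) + Im (fourier q x))" using inv by (simp add: fun_eq_iff[symmetric] flip: inv)
    also have "\<dots> = T (\<lambda>x. Re (fourier p x)) + T (\<lambda>x. Im (fourier q x))"
      using T(1) schwartz_fourier[OF pq(1)] schwartz_fourier[OF pq(2)] by (simp add: tempered_def)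
    finally show ?thesis using Hm1_fourierD(2)[OF T(2) pq(1)] Hm1_fourierD(3)[OF T(2) pq(2)] by simp
  qed
  show ?thesis
  proof (intro exI[of _ "R p + R q"] ballI)
    fix T T' assume "T \<in> Hm1" "T' \<in> Hm1"
    then obtain g g' where T: "tempered T" "Hm1_fourier T g" "tempered T'" "Hm1_fourier T' g'" by (auto simp: Hm1_def)
    note d = Hm1_fourier_diff[OF T(2,4)]
    note w = Hm1_fourierD(1)[OF d]
    note w1 = Hm1_fourierD(1)[OF T(2)] and w2 = Hm1_fourierD(1)[OF T(4)]
    have "T \<phi> - T' \<phi> = (LINT \<xi>|lborel. Re (g \<xi> - g' \<xi>) * p \<xi>) + (LINT \<xi>|lborel. Im (g \<xi> - g' \<xi>) * q \<xi>)"
      unfolding form[OF T(1,2)] form[OF T(3,4)]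
      using Hm1_pairing_parts(1,2)[OF w1 pq(1)] Hm1_pairing_parts(1,2)[OF w2 pq(1)]
        Hm1_pairing_parts(1,2)[OF w1 pq(2)] Hm1_pairing_parts(1,2)[OF w2 pq(2)]
      by (simp add: left_diff_distrib)
    also have "\<bar>\<dots>\<bar> \<le> sqrt (Hm1_size (\<lambda>\<xi>. g \<xi> - g' \<xi>)) * R p + sqrt (Hm1_size (\<lambda>\<xi>. g \<xi> - g' \<xi>)) * R q"
      unfolding R_def by (intro order_trans[OF abs_triangle_ineq] add_mono Hm1_pairing_parts(4)[OF w pq(1)] Hm1_pairing_parts(5)[OF w pq(2)])
    also have "\<dots> = (R p + R q) * Hm1_norm (\<lambda>\<phi>. T \<phi> - T' \<phi>)"
      unfolding Hm1_norm_eq[OF d] by (simp add: algebra_simps)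
    finally show "\<bar>T \<phi> - T' \<phi>\<bar> \<le> (R p + R q) * Hm1_norm (\<lambda>\<phi>. T \<phi> - T' \<phi>)" .
  qed
qed

lemma reflect_integrable: "integrable lborel f \<Longrightarrow> integrable lborel (\<lambda>x. f (- x :: real) :: real)"
  using lborel_integrable_real_affine[of f "-1" 0] by simp

lemma sqint_reflect: assumes "sqint lborel f" shows "sqint lborel (\<lambda>x. f (- x :: real))"
proof -
  have "f \<in> borel_measurable borel" using assms by (simp add: sqint_def)
  then have "(\<lambda>x. f (- x)) \<in> borel_measurable borel" by measurable
  then show ?thesis using assms reflect_integrable[of "\<lambda>x. (f x)\<^sup>2"] by (simp add: sqint_def)
qed

text \<open>Because \<open>T\<close> is real, reflecting \<open>\<phi>\<close> conjugates \<open>\<integral> g \<phi>\<close>; so the reflection of \<open>g\<close> and its conjugate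
  have the same integrals against all Schwartz functions.\<close>

lemma Hm1_fourier_hermitian:
  assumes T: "tempered T" and g: "Hm1_fourier T g"
  shows "AE \<xi> in lborel. half_re g (- \<xi>) = half_re g \<xi> \<and> half_im g (- \<xi>) = - half_im g \<xi>"
proof -
  note w = Hm1_fourierD(1)[OF g]
  note p = Hm1_weight_parts[OF w]
  have refl_int: "integrable lborel (\<lambda>\<xi>. (f (- \<xi>))\<^sup>2 / (\<xi>\<^sup>2 + 4))" if "integrable lborel (\<lambda>\<xi>. (f \<xi>)\<^sup>2 / (\<xi>\<^sup>2 + 4))" for f :: "real \<Rightarrow> real"
    using reflect_integrable[OF that] by simp
  have swap: "(LINT \<xi>|lborel. f (- \<xi>) * \<phi> \<xi>) = (LINT \<xi>|lborel. f \<xi> * \<phi> (- \<xi>))" for f \<phi> :: "real \<Rightarrow> real"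
    using integral_reflect[of "\<lambda>\<xi>. f \<xi> * \<phi> (- \<xi>)"] by simp
  have re: "AE \<xi> in lborel. Re (g (- \<xi>)) - Re (g \<xi>) = 0"
  proof (rule schwartz_separates)
    show [measurable]: "(\<lambda>\<xi>. Re (g (- \<xi>)) - Re (g \<xi>)) \<in> borel_measurable borel" using p(1) by measurable
    show "integrable lborel (\<lambda>\<xi>. (Re (g (- \<xi>)) - Re (g \<xi>))\<^sup>2 / (\<xi>\<^sup>2 + 4))"
      by (rule weighted_diff_integrable[OF _ p(1) refl_int[OF p(2)] p(2)]) (use p(1) in measurable)
    fix \<phi> assume \<phi>: "schwartz \<phi>"
    note \<phi>' = schwartz_reflect[OF \<phi>]
    have i: "integrable lborel (\<lambda>\<xi>. Re (g (- \<xi>)) * \<phi> \<xi>)"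
      using reflect_integrable[OF Hm1_pairing_parts(1)[OF w \<phi>']] by simp
    have "(LINT \<xi>|lborel. (Re (g (- \<xi>)) - Re (g \<xi>)) * \<phi> \<xi>) = (LINT \<xi>|lborel. Re (g \<xi>) * \<phi> (- \<xi>)) - (LINT \<xi>|lborel. Re (g \<xi>) * \<phi> \<xi>)"
      unfolding left_diff_distrib using i Hm1_pairing_parts(1)[OF w \<phi>] swap[of "\<lambda>\<xi>. Re (g \<xi>)" \<phi>] by simp
    also have "\<dots> = T (\<lambda>\<xi>. Re (fourier (\<lambda>x. \<phi> (- x)) \<xi>)) - T (\<lambda>\<xi>. Re (fourier \<phi> \<xi>))"
      using Hm1_fourierD(2)[OF g \<phi>] Hm1_fourierD(2)[OF g \<phi>'] by simp
    also have "\<dots> = 0"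
      unfolding fourier_Re_Im[OF schwartz_integrable[OF \<phi>]] fourier_Re_Im[OF schwartz_integrable[OF \<phi>']] cosT_reflect by simp
    finally show "(LINT \<xi>|lborel. (Re (g (- \<xi>)) - Re (g \<xi>)) * \<phi> \<xi>) = 0" .
  qed
  have im: "AE \<xi> in lborel. Im (g (- \<xi>)) - (- Im (g \<xi>)) = 0"
  proof (rule schwartz_separates)
    have pm: "(\<lambda>\<xi>. - Im (g \<xi>)) \<in> borel_measurable borel" "integrable lborel (\<lambda>\<xi>. (- Im (g \<xi>))\<^sup>2 / (\<xi>\<^sup>2 + 4))"
      using p(3,4) by auto
    show [measurable]: "(\<lambda>\<xi>. Im (g (- \<xi>)) - (- Im (g \<xi>))) \<in> borel_measurable borel" using p(3) by measurable
    show "integrable lborel (\<lambda>\<xi>. (Im (g (- \<xi>)) - (- Im (g \<xi>)))\<^sup>2 / (\<xi>\<^sup>2 + 4))"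
      by (rule weighted_diff_integrable[OF _ pm(1) refl_int[OF p(4)] pm(2)]) (use p(3) in measurable)
    fix \<phi> assume \<phi>: "schwartz \<phi>"
    note \<phi>' = schwartz_reflect[OF \<phi>]
    have i: "integrable lborel (\<lambda>\<xi>. Im (g (- \<xi>)) * \<phi> \<xi>)"
      using reflect_integrable[OF Hm1_pairing_parts(2)[OF w \<phi>']] by simp
    have "(LINT \<xi>|lborel. (Im (g (- \<xi>)) - (- Im (g \<xi>))) * \<phi> \<xi>) = (LINT \<xi>|lborel. Im (g \<xi>) * \<phi> (- \<xi>)) + (LINT \<xi>|lborel. Im (g \<xi>) * \<phi> \<xi>)"
      using i Hm1_pairing_parts(2)[OF w \<phi>] swap[of "\<lambda>\<xi>. Im (g \<xi>)" \<phi>] by (simp add: distrib_right)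
    also have "\<dots> = T (\<lambda>\<xi>. Im (fourier (\<lambda>x. \<phi> (- x)) \<xi>)) + T (\<lambda>\<xi>. Im (fourier \<phi> \<xi>))"
      using Hm1_fourierD(3)[OF g \<phi>] Hm1_fourierD(3)[OF g \<phi>'] by simp
    also have "(\<lambda>\<xi>. Im (fourier (\<lambda>x. \<phi> (- x)) \<xi>)) = (\<lambda>\<xi>. (-1) * Im (fourier \<phi> \<xi>))"
      unfolding fourier_Re_Im[OF schwartz_integrable[OF \<phi>]] fourier_Re_Im[OF schwartz_integrable[OF \<phi>']] sinT_reflect by simp
    also have "T (\<lambda>\<xi>. (-1) * Im (fourier \<phi> \<xi>)) = (-1) * T (\<lambda>\<xi>. Im (fourier \<phi> \<xi>))"
      using T schwartz_fourier(2)[OF \<phi>] unfolding tempered_def by blast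
    finally show "(LINT \<xi>|lborel. (Im (g (- \<xi>)) - (- Im (g \<xi>))) * \<phi> \<xi>) = 0" by simp
  qed
  from re im show ?thesis
  proof eventually_elim
    case (elim \<xi>)
    then have "g (- \<xi>) = cnj (g \<xi>)" by (simp add: complex_eq_iff)
    then have "g (- \<xi>) / (2 + \<i> * complex_of_real (- \<xi>)) = cnj (g \<xi> / (2 + \<i> * complex_of_real \<xi>))" by simp
    then show ?case unfolding half_re_def half_im_def by (simp only: cnj.simps)
  qed
qed

section \<open>Weak limits\<close>

text \<open>Let \<open>C n\<close> consist of the functions with squared norm at most \<open>B\<close> whose pairings deviate from \<open>L\<close> by no more than
  the worst deviation among the \<open>F k\<close> with \<open>k \<ge> n\<close>. These sets are convex and decreasing and \<open>F n\<close>
  belongs to \<open>C n\<close>, so \<open>L2_minimizing_sequence\<close> provides a strong limit; its pairings are the \<open>L \<psi>\<close>.\<close>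

lemma weak_limit_L2:
  fixes F :: "nat \<Rightarrow> 'a \<Rightarrow> real"
  assumes M: "sigma_finite_measure M" and s: "\<And>k. sqint M (F k)" and b: "\<And>k. (LINT x|M. (F k x)\<^sup>2) \<le> B"
    and X: "\<And>\<psi>. \<psi> \<in> X \<Longrightarrow> sqint M \<psi>" and lim: "\<And>\<psi>. \<psi> \<in> X \<Longrightarrow> (\<lambda>k. LINT x|M. F k x * \<psi> x) \<longlonglongrightarrow> L \<psi>"
  shows "\<exists>f. sqint M f \<and> (LINT x|M. (f x)\<^sup>2) \<le> B \<and> (\<forall>\<psi>\<in>X. (LINT x|M. f x * \<psi> x) = L \<psi>)"
proof -
  define C where "C n = {f. sqint M f \<and> (LINT x|M. (f x)\<^sup>2) \<le> B \<and> (\<forall>\<psi>\<in>X. \<forall>e>0. (\<forall>k\<ge>n. \<bar>(LINT x|M. F k x * \<psi> x) - L \<psi>\<bar> \<le> e) \<longrightarrow> \<bar>(LINT x|M. f x * \<psi> x) - L \<psi>\<bar> \<le> e)}" for n :: nat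
  have "\<exists>v f. (\<forall>n. v n \<in> C n) \<and> L2_tendsto M v f \<and> (LINT x|M. (f x)\<^sup>2) \<le> B \<and>
     (\<forall>g. (\<forall>n. g \<in> C n) \<longrightarrow> (LINT x|M. (f x)\<^sup>2) \<le> (LINT x|M. (g x)\<^sup>2))"
  proof (rule L2_minimizing_sequence[OF M])
    show "C n \<subseteq> C m" if "m \<le> n" for m n
    proof
      fix f assume f: "f \<in> C n"
      have "\<bar>(LINT x|M. f x * \<psi> x) - L \<psi>\<bar> \<le> e"
        if "\<psi> \<in> X" "0 < e" "\<forall>k\<ge>m. \<bar>(LINT x|M. F k x * \<psi> x) - L \<psi>\<bar> \<le> e" for \<psi> e
        using f that \<open>m \<le> n\<close> order_trans unfolding C_def by blast
      then show "f \<in> C m" using f by (auto simp: C_def)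
    qed
    show "sqint M f" if "f \<in> C n" for n f using that by (simp add: C_def)
    have "F n \<in> C n" for n using s b by (auto simp: C_def)
    then show "\<exists>f\<in>C n. (LINT x|M. (f x)\<^sup>2) \<le> B" for n using b by blast
    show "(\<lambda>x. (f x + g x) / 2) \<in> C n" if fg: "f \<in> C n" "g \<in> C n" for n f g
    proof -
      have sf: "sqint M f" "sqint M g" using fg by (simp_all add: C_def)
      have eq: "(\<lambda>x. (f x + g x) / 2) = (\<lambda>x. 1/2 * (f x + g x))" by simp
      have sm: "sqint M (\<lambda>x. (f x + g x) / 2)" unfolding eq by (intro sqint_cmult sqint_add sf)
      have "(LINT x|M. ((f x + g x) / 2)\<^sup>2) \<le> (LINT x|M. 1/2 * (f x)\<^sup>2 + 1/2 * (g x)\<^sup>2)"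
      proof (rule integral_mono)
        show "integrable M (\<lambda>x. ((f x + g x) / 2)\<^sup>2)" using sm by (simp add: sqint_def)
        show "integrable M (\<lambda>x. 1/2 * (f x)\<^sup>2 + 1/2 * (g x)\<^sup>2)" using sf by (simp add: sqint_def)
        show "((f x + g x) / 2)\<^sup>2 \<le> 1/2 * (f x)\<^sup>2 + 1/2 * (g x)\<^sup>2" for x
          using zero_le_power2[of "f x - g x"] by (simp add: power_divide power2_sum power2_diff)
      qed
      also have "\<dots> = 1/2 * (LINT x|M. (f x)\<^sup>2) + 1/2 * (LINT x|M. (g x)\<^sup>2)" using sf by (simp add: sqint_def)
      also have "\<dots> \<le> B" using fg by (simp add: C_def)
      finally have 1: "(LINT x|M. ((f x + g x) / 2)\<^sup>2) \<le> B" .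
      have 2: "\<bar>(LINT x|M. (f x + g x) / 2 * \<psi> x) - L \<psi>\<bar> \<le> e"
        if \<psi>: "\<psi> \<in> X" and e: "0 < e" and k: "\<forall>k\<ge>n. \<bar>(LINT x|M. F k x * \<psi> x) - L \<psi>\<bar> \<le> e" for \<psi> e
      proof -
        have "(LINT x|M. (f x + g x) / 2 * \<psi> x) = (LINT x|M. 1/2 * (f x * \<psi> x) + 1/2 * (g x * \<psi> x))"
          by (intro Bochner_Integration.integral_cong refl) (simp add: field_simps)
        also have "\<dots> = 1/2 * (LINT x|M. f x * \<psi> x) + 1/2 * (LINT x|M. g x * \<psi> x)"
          using sqint_mult[OF sf(1) X[OF \<psi>]] sqint_mult[OF sf(2) X[OF \<psi>]] by simp
        finally have eq: "(LINT x|M. (f x + g x) / 2 * \<psi> x) = 1/2 * (LINT x|M. f x * \<psi> x) + 1/2 * (LINT x|M. g x * \<psi> x)" .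
        have "\<bar>(LINT x|M. f x * \<psi> x) - L \<psi>\<bar> \<le> e" "\<bar>(LINT x|M. g x * \<psi> x) - L \<psi>\<bar> \<le> e"
          using fg \<psi> e k unfolding C_def by blast+
        then show ?thesis unfolding eq by argo
      qed
      show ?thesis using sm 1 2 by (auto simp: C_def)
    qed
  qed
  then obtain v f where v: "\<And>n. v n \<in> C n" and f: "L2_tendsto M v f" "(LINT x|M. (f x)\<^sup>2) \<le> B" by blast
  have "(LINT x|M. f x * \<psi> x) = L \<psi>" if \<psi>: "\<psi> \<in> X" for \<psi>
  proof -
    have l: "(\<lambda>n. \<bar>(LINT x|M. v n x * \<psi> x) - L \<psi>\<bar>) \<longlonglongrightarrow> \<bar>(LINT x|M. f x * \<psi> x) - L \<psi>\<bar>"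
      by (intro tendsto_intros L2_tendsto_weak[OF f(1) X[OF \<psi>]])
    have "\<bar>(LINT x|M. f x * \<psi> x) - L \<psi>\<bar> \<le> 0 + e" if e: "0 < e" for e
    proof -
      obtain N where N: "\<And>k. N \<le> k \<Longrightarrow> \<bar>(LINT x|M. F k x * \<psi> x) - L \<psi>\<bar> \<le> e"
        using LIMSEQ_D[OF lim[OF \<psi>] e] by (auto intro: less_imp_le)
      have "\<bar>(LINT x|M. v n x * \<psi> x) - L \<psi>\<bar> \<le> e" if "N \<le> n" for n
        using v[of n] N \<psi> e that unfolding C_def by (auto intro: order_trans)
      then show ?thesis using LIMSEQ_le_const2[OF l, of e] by auto
    qed
    then have "\<bar>(LINT x|M. f x * \<psi> x) - L \<psi>\<bar> \<le> 0" by (rule field_le_epsilon)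
    then show ?thesis by simp
  qed
  then show ?thesis using f by (auto simp: L2_tendsto_def)
qed

section \<open>Density of smooth data\<close>

text \<open>Approximate the two halves \<open>a\<close>, \<open>b\<close> of the transform of \<open>T\<close> in \<open>L\<^sup>2\<close> by Schwartz functions \<open>\<alpha>\<close>, \<open>\<beta>\<close>, and let
  \<open>h\<close> be the real part of the inverse transform of \<open>\<alpha> + i \<beta>\<close>. Taking the real part replaces \<open>\<alpha>\<close> by its
  even and \<open>\<beta>\<close> by its odd part, which does not increase the distance, since \<open>a\<close> is even and \<open>b\<close> is odd.\<close>

lemma Hm1_density:
  assumes T: "T \<in> Hm1" and e: "0 < e"
  shows "\<exists>h. schwartz h \<and> Hm1_norm (\<lambda>\<phi>. distribution_of (\<lambda>x. deriv h x + 2 * h x) \<phi> - T \<phi>) < e \<and>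
    (LINT x|lborel. (h x)\<^sup>2) \<le> 2 * (Hm1_norm T)\<^sup>2 + e"
proof -
  obtain g where Tt: "tempered T" and g: "Hm1_fourier T g" using T by (auto simp: Hm1_def)
  note w = Hm1_fourierD(1)[OF g]
  define a b where "a = half_re g" and "b = half_im g"
  have s: "sqint lborel a" "sqint lborel b" and ab: "(LINT x|lborel. (a x)\<^sup>2) + (LINT x|lborel. (b x)\<^sup>2) = Hm1_size g"
    unfolding a_def b_def using half_sqint[OF w] by auto
  have par: "AE x in lborel. a (- x) = a x \<and> b (- x) = - b x"
    unfolding a_def b_def by (rule Hm1_fourier_hermitian[OF Tt g])
  (* The first bound serves the distance in the norm, the second one the size of h. *)
  define e' where "e' = min (e\<^sup>2 / 2) (e / 4)"
  have e': "0 < e'" "2 * e' \<le> e\<^sup>2" "4 * e' \<le> e" using e by (auto simp: e'_def)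
  obtain \<alpha> where \<alpha>: "schwartz \<alpha>" "(LINT x|lborel. (a x - \<alpha> x)\<^sup>2) < e'" using schwartz_dense_L2[OF s(1) e'(1)] by blast
  obtain \<beta> where \<beta>: "schwartz \<beta>" "(LINT x|lborel. (b x - \<beta> x)\<^sup>2) < e'" using schwartz_dense_L2[OF s(2) e'(1)] by blast
  define a' b' where "a' x = (\<alpha> x + \<alpha> (- x)) / 2" and "b' x = (\<beta> x - \<beta> (- x)) / 2" for x
  have a'e: "a' = (\<lambda>x. 1/2 * (\<alpha> x + \<alpha> (- x)))" and b'e: "b' = (\<lambda>x. 1/2 * (\<beta> x - \<beta> (- x)))" by (auto simp: a'_def b'_def)
  have sab: "schwartz a'" "schwartz b'" unfolding a'e b'e
    by (intro schwartz_cmult schwartz_add schwartz_diff schwartz_reflect \<alpha> \<beta>)+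
  note sab' = schwartz_sqint[OF sab(1)] schwartz_sqint[OF sab(2)]
  have sym: "(LINT x|lborel. (a0 x - (\<gamma> x + \<sigma> * \<gamma> (- x)) / 2)\<^sup>2) \<le> (LINT x|lborel. (a0 x - \<gamma> x)\<^sup>2)"
    if a0: "sqint lborel a0" and p: "AE x in lborel. a0 (- x) = \<sigma> * a0 x" and \<gamma>: "schwartz \<gamma>" and \<sigma>: "\<sigma> = 1 \<or> \<sigma> = -1" for a0 \<gamma> and \<sigma> :: real
  proof -
    have s1: "sqint lborel (\<lambda>x. a0 x - \<gamma> x)" by (intro sqint_diff a0 schwartz_sqint \<gamma>)
    note s2 = sqint_reflect[OF s1]
    have s3: "sqint lborel (\<lambda>x. a0 x - (\<gamma> x + \<sigma> * \<gamma> (- x)) / 2)"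
      using sqint_diff[OF a0 sqint_cmult[OF sqint_add[OF schwartz_sqint[OF \<gamma>] sqint_cmult[OF schwartz_sqint[OF schwartz_reflect[OF \<gamma>]], of \<sigma>]], of "1/2"]] by simp
    have "(LINT x|lborel. (a0 x - (\<gamma> x + \<sigma> * \<gamma> (- x)) / 2)\<^sup>2) \<le> (LINT x|lborel. 1/2 * (a0 x - \<gamma> x)\<^sup>2 + 1/2 * (a0 (- x) - \<gamma> (- x))\<^sup>2)"
    proof (rule integral_mono_AE)
      show "integrable lborel (\<lambda>x. (a0 x - (\<gamma> x + \<sigma> * \<gamma> (- x)) / 2)\<^sup>2)" using s3 by (simp add: sqint_def)
      show "integrable lborel (\<lambda>x. 1/2 * (a0 x - \<gamma> x)\<^sup>2 + 1/2 * (a0 (- x) - \<gamma> (- x))\<^sup>2)" using s1 s2 by (simp add: sqint_def)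
      show "AE x in lborel. (a0 x - (\<gamma> x + \<sigma> * \<gamma> (- x)) / 2)\<^sup>2 \<le> 1/2 * (a0 x - \<gamma> x)\<^sup>2 + 1/2 * (a0 (- x) - \<gamma> (- x))\<^sup>2"
        using p
      proof eventually_elim
        case (elim x)
        define A B where "A = a0 x - \<gamma> x" and "B = a0 (- x) - \<gamma> (- x)"
        have "a0 x - (\<gamma> x + \<sigma> * \<gamma> (- x)) / 2 = (A + \<sigma> * B) / 2"
        proof -
          have "\<sigma> * a0 (- x) = a0 x" using \<sigma> elim by auto
          then have "A + \<sigma> * B = 2 * a0 x - (\<gamma> x + \<sigma> * \<gamma> (- x))" by (simp add: A_def B_def right_diff_distrib)
          then show ?thesis by (simp add: diff_divide_distrib add_divide_distrib)
        qed
        moreover have "((A + \<sigma> * B) / 2)\<^sup>2 \<le> 1/2 * A\<^sup>2 + 1/2 * B\<^sup>2"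
          using \<sigma> zero_le_power2[of "A - B"] zero_le_power2[of "A + B"]
          by (auto simp: power_divide power2_sum power2_diff)
        ultimately show ?case unfolding A_def[symmetric] B_def[symmetric] by metis
      qed
    qed
    also have "\<dots> = 1/2 * (LINT x|lborel. (a0 x - \<gamma> x)\<^sup>2) + 1/2 * (LINT x|lborel. (a0 (- x) - \<gamma> (- x))\<^sup>2)"
      using s1 s2 by (simp add: sqint_def)
    also have "(LINT x|lborel. (a0 (- x) - \<gamma> (- x))\<^sup>2) = (LINT x|lborel. (a0 x - \<gamma> x)\<^sup>2)"
      using integral_reflect[of "\<lambda>x. (a0 x - \<gamma> x)\<^sup>2"] by simp
    finally show ?thesis by simp
  qed
  have "AE x in lborel. a (- x) = 1 * a x" "AE x in lborel. b (- x) = (-1) * b x" using par by auto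
  from sym[OF s(1) this(1) \<alpha>(1)] sym[OF s(2) this(2) \<beta>(1)]
  have close: "(LINT x|lborel. (a x - a' x)\<^sup>2) < e'" "(LINT x|lborel. (b x - b' x)\<^sup>2) < e'"
    using \<alpha>(2) \<beta>(2) by (simp_all add: a'_def b'_def)
  define h where "h x = Re (fourier \<alpha> x) + Im (fourier \<beta> x)" for x
  have hs: "schwartz h" unfolding h_def[abs_def] by (intro schwartz_add schwartz_fourier \<alpha> \<beta>)
  have Fh: "fourier h \<xi> = Complex (a' \<xi>) (b' \<xi>)" for \<xi>
  proof -
    have i: "integrable lborel (\<lambda>x. Re (fourier \<alpha> x))" "integrable lborel (\<lambda>x. Im (fourier \<beta> x))"
      by (intro schwartz_integrable schwartz_fourier \<alpha> \<beta>)+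
    have c: "1 / sqrt (2 * pi) * (1 / sqrt (2 * pi)) = 1 / (2 * pi)" by simp
    have 1: "cosT h \<xi> / sqrt (2 * pi) = a' \<xi>" and 2: "- sinT h \<xi> / sqrt (2 * pi) = b' \<xi>"
      unfolding h_def[abs_def] trig_add[OF i]
      unfolding fourier_Re_Im[OF schwartz_integrable[OF \<alpha>(1)]] fourier_Re_Im[OF schwartz_integrable[OF \<beta>(1)]] cosT_cmult sinT_cmult
        cosT_st_zero trig_inversion[OF \<alpha>(1)] trig_inversion[OF \<beta>(1)]
      using c by (simp_all add: a'_def b'_def field_simps)
    show ?thesis unfolding fourier_eq[OF schwartz_integrable[OF hs]] 1 2 ..
  qed
  define p where "p x = deriv h x + 2 * h x" for x
  have ps: "schwartz p" unfolding p_def[abs_def] by (intro schwartz_add schwartz_cmult schwartzD hs)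
  have d: "Hm1_fourier (\<lambda>\<phi>. distribution_of p \<phi> - T \<phi>) (\<lambda>\<xi>. fourier p \<xi> - g \<xi>)"
    by (rule Hm1_fourier_diff[OF Hm1_fourier_distribution_of[OF ps] g])
  have Fp: "fourier p \<xi> - g \<xi> = (2 + \<i> * \<xi>) * Complex (a' \<xi> - a \<xi>) (b' \<xi> - b \<xi>)" for \<xi>
  proof -
    have "fourier p \<xi> = (2 + \<i> * \<xi>) * Complex (a' \<xi>) (b' \<xi>)"
      unfolding p_def[abs_def] fourier_deriv_plus_2[OF hs] Fh ..
    moreover have "g \<xi> = (2 + \<i> * \<xi>) * Complex (a \<xi>) (b \<xi>)" unfolding a_def b_def by (rule half_eq)
    ultimately show ?thesis by (simp only: right_diff_distrib[symmetric] complex_diff)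
  qed
  have i2: "integrable lborel (\<lambda>x. (a x - a' x)\<^sup>2)" "integrable lborel (\<lambda>x. (b x - b' x)\<^sup>2)"
    using sqint_diff[OF s(1) sab'(1)] sqint_diff[OF s(2) sab'(2)] by (simp_all add: sqint_def)
  have "Hm1_size (\<lambda>\<xi>. fourier p \<xi> - g \<xi>) = (LINT x|lborel. (a x - a' x)\<^sup>2 + (b x - b' x)\<^sup>2)"
    unfolding Hm1_size_def
  proof (intro Bochner_Integration.integral_cong refl)
    fix \<xi> :: real
    have p: "\<xi>\<^sup>2 + 4 \<noteq> 0" by (metis add_nonneg_pos less_irrefl zero_le_power2 zero_less_numeral)
    show "(cmod (fourier p \<xi> - g \<xi>))\<^sup>2 / (\<xi>\<^sup>2 + 4) = (a \<xi> - a' \<xi>)\<^sup>2 + (b \<xi> - b' \<xi>)\<^sup>2"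
      unfolding Fp norm_mult power_mult_distrib cmod_two_plus using p
      by (simp add: cmod_power2 power2_commute)
  qed
  also have "\<dots> = (LINT x|lborel. (a x - a' x)\<^sup>2) + (LINT x|lborel. (b x - b' x)\<^sup>2)" using i2 by simp
  also have "\<dots> < e\<^sup>2" using close e' by simp
  finally have "Hm1_size (\<lambda>\<xi>. fourier p \<xi> - g \<xi>) < e\<^sup>2" .
  from real_sqrt_less_mono[OF this] have "sqrt (Hm1_size (\<lambda>\<xi>. fourier p \<xi> - g \<xi>)) < e" using e by simp
  then have N: "Hm1_norm (\<lambda>\<phi>. distribution_of p \<phi> - T \<phi>) < e" by (simp add: Hm1_norm_eq[OF d])
  have "(LINT x|lborel. (h x)\<^sup>2) = (LINT x|lborel. (a' x)\<^sup>2 + (b' x)\<^sup>2)"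
    unfolding plancherel[OF hs, symmetric] Fh by (simp add: cmod_power2)
  also have "\<dots> \<le> (LINT x|lborel. (2 * (a x)\<^sup>2 + 2 * (b x)\<^sup>2) + (2 * (a x - a' x)\<^sup>2 + 2 * (b x - b' x)\<^sup>2))"
  proof (rule integral_mono)
    show "integrable lborel (\<lambda>x. (a' x)\<^sup>2 + (b' x)\<^sup>2)" using sab' by (simp add: sqint_def)
    show "integrable lborel (\<lambda>x. (2 * (a x)\<^sup>2 + 2 * (b x)\<^sup>2) + (2 * (a x - a' x)\<^sup>2 + 2 * (b x - b' x)\<^sup>2))"
      using s i2 by (simp add: sqint_def)
    have sq: "y\<^sup>2 \<le> 2 * x\<^sup>2 + 2 * (x - y)\<^sup>2" for x y :: real
      using zero_le_power2[of "2 * x - y"] by (simp add: power2_diff power_mult_distrib)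
    show "(a' x)\<^sup>2 + (b' x)\<^sup>2 \<le> (2 * (a x)\<^sup>2 + 2 * (b x)\<^sup>2) + (2 * (a x - a' x)\<^sup>2 + 2 * (b x - b' x)\<^sup>2)" for x
      using sq[of "a' x" "a x"] sq[of "b' x" "b x"] by linarith
  qed
  also have "\<dots> = 2 * Hm1_size g + 2 * ((LINT x|lborel. (a x - a' x)\<^sup>2) + (LINT x|lborel. (b x - b' x)\<^sup>2))"
    unfolding ab[symmetric] using s i2 by (simp add: sqint_def)
  also have "\<dots> \<le> 2 * (Hm1_norm T)\<^sup>2 + e"
  proof -
    have "0 \<le> Hm1_size g" unfolding Hm1_size_def by (intro Bochner_Integration.integral_nonneg) simp
    then have "(Hm1_norm T)\<^sup>2 = Hm1_size g" by (simp add: Hm1_norm_eq[OF g])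
    then show ?thesis using close e' by simp
  qed
  finally show ?thesis using hs N unfolding p_def[abs_def] by blast
qed

section \<open>Classical solutions\<close>

text \<open>The seminorms with no derivative and the powers \<open>0\<close> and \<open>2\<close> of \<open>x\<close> dominate the weighted sup norm.\<close>

lemma schwartz_KdV_solution_smooth:
  assumes u: "schwartz_KdV_solution u"
  shows "kdv_flow_smooth u (\<lambda>t. deriv (u t)) (\<lambda>t. deriv (deriv (u t))) (\<lambda>t. deriv (deriv (deriv (u t))))"
proof -
  have s: "schwartz (u t)" for t using u by (simp add: schwartz_KdV_solution_def)
  note s1 = schwartzD(3)[OF s] 
  note s2 = schwartzD(3)[OF s1]
  note s3 = schwartzD(3)[OF s2]
  show ?thesis
  proof
    show "(u t has_real_derivative deriv (u t) x) (at x)" "(deriv (u t) has_real_derivative deriv (deriv (u t)) x) (at x)"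
      "(deriv (deriv (u t)) has_real_derivative deriv (deriv (deriv (u t))) x) (at x)" for t x
      by (intro schwartzD(1) s s1 s2)+
    show "decays (u t)" "decays (deriv (u t))" "decays (deriv (deriv (u t)))" "decays (deriv (deriv (deriv (u t))))" for t
      by (intro schwartz_decays s s1 s2 s3)+
    show "wdiff u (\<lambda>x. - deriv (deriv (deriv (u t))) x + 6 * u t x * deriv (u t) x) t" for t
    proof -
      define V where "V x = - deriv (deriv (deriv (u t))) x + 6 * u t x * deriv (u t) x" for x
      have dV: "decays V" unfolding V_def[abs_def]
        by (intro decays_add decays_minus decays_mult decays_cmult schwartz_decays s s1 s3)
      define \<Delta> where "\<Delta> r x = (u r x - u t x) / (r - t) - V x" for r x
      have d\<Delta>: "decays (\<Delta> r)" for r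
      proof -
        have "decays (\<lambda>x. inverse (r - t) * (u r x - u t x) - V x)"
          by (intro decays_diff decays_cmult schwartz_decays s dV)
        then show ?thesis by (simp add: \<Delta>_def[abs_def] divide_inverse mult.commute)
      qed
      have lim: "((\<lambda>r. schwartz_seminorm k n (\<Delta> r)) \<longlongrightarrow> 0) (at t)" for k n
        using u unfolding schwartz_KdV_solution_def by (simp add: \<Delta>_def[abs_def] V_def numeral_3_eq_3)
      have bd: "\<bar>x ^ k * \<Delta> r x\<bar> \<le> schwartz_seminorm k 0 (\<Delta> r)" if k: "k = 0 \<or> k = 2" for k r x
        unfolding schwartz_seminorm_def funpow_0
      proof (rule cSUP_upper)
        obtain C where C: "0 \<le> C" "\<And>x. \<bar>\<Delta> r x\<bar> \<le> C * om x" by (rule decays_bound_nonneg[OF d\<Delta>[of r]]) blast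
        have "\<bar>x ^ k * \<Delta> r x\<bar> \<le> C" for x
        proof -
          have "\<bar>x ^ k\<bar> * om x \<le> 1" using k by (auto simp: om_le_1 om_def divide_le_eq add_pos_nonneg)
          then have "C * (\<bar>x ^ k\<bar> * om x) \<le> C" using C(1) by (simp add: mult_left_le)
          moreover have "\<bar>x ^ k * \<Delta> r x\<bar> \<le> \<bar>x ^ k\<bar> * (C * om x)" unfolding abs_mult by (intro mult_left_mono C) simp
          ultimately show ?thesis by (simp add: mult.left_commute)
        qed
        then show "bdd_above (range (\<lambda>x. \<bar>x ^ k * \<Delta> r x\<bar>))" by (rule bdd_aboveI2)
      qed simp
      have om: "\<bar>\<Delta> r x\<bar> \<le> (4 * schwartz_seminorm 0 0 (\<Delta> r) + schwartz_seminorm 2 0 (\<Delta> r)) * om x" for r x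
        by (rule decaysI(1)) (use d\<Delta>[of r] bd[of 0] bd[of 2] in \<open>auto simp: decays_def\<close>)
      have "wdiff u V t" unfolding wdiff_def
      proof (intro allI impI)
        fix e :: real assume e: "0 < e"
        have "((\<lambda>r. 4 * schwartz_seminorm 0 0 (\<Delta> r) + schwartz_seminorm 2 0 (\<Delta> r)) \<longlongrightarrow> 4 * 0 + 0) (at t)"
          by (intro tendsto_intros lim)
        then have "\<forall>\<^sub>F r in at t. 4 * schwartz_seminorm 0 0 (\<Delta> r) + schwartz_seminorm 2 0 (\<Delta> r) < e"
          using e by (intro order_tendstoD) auto
        then show "\<forall>\<^sub>F r in at t. \<forall>x. \<bar>(u r x - u t x) / (r - t) - V x\<bar> \<le> e * om x"
        proof eventually_elim
          case (elim r)
          show ?case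
          proof
            fix x
            have "\<bar>\<Delta> r x\<bar> \<le> e * om x"
              by (rule order_trans[OF om]) (intro mult_right_mono less_imp_le[OF elim] less_imp_le[OF om_pos])
            then show "\<bar>(u r x - u t x) / (r - t) - V x\<bar> \<le> e * om x" by (simp add: \<Delta>_def)
          qed
        qed
      qed
      then show ?thesis by (simp add: V_def[abs_def])
    qed
  qed
qed

lemma resolvent_inverse:
  assumes h: "schwartz h" shows "resolvent (\<lambda>x. deriv h x + 2 * h x) = h"
proof
  fix x
  define f where "f x = deriv h x + 2 * h x" for x
  have df: "decays f" unfolding f_def[abs_def] by (intro decays_add decays_cmult schwartz_decays schwartzD h)
  define Z where "Z x = resolvent f x - h x" for x
  have dZ: "(Z has_real_derivative (0 - 2 * Z x)) (at x)" for x
    unfolding Z_def[abs_def] by (rule DERIV_cong[OF DERIV_diff[OF decays_resolvent(2)[OF df] schwartzD(1)[OF h]]]) (simp add: f_def)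
  have "bounded_cont Z" unfolding Z_def[abs_def] by (intro decays_bounded_cont decays_diff decays_resolvent(1) df schwartz_decays h)
  then obtain B where B: "\<And>x. \<bar>Z x\<bar> \<le> B" by (auto simp: bounded_cont_def)
  have "\<bar>Z x\<bar> \<le> 2 * 0 * om x" by (rule comparison_abs[OF dZ _ B]) simp
  then show "resolvent (\<lambda>x. deriv h x + 2 * h x) x = h x" by (simp add: Z_def f_def[abs_def])
qed

text \<open>Since \<open>f = H' + 2 H\<close> for \<open>H = resolvent f\<close>, integration by parts moves the derivative to \<open>\<psi>\<close>. This bounds
  pairings of solutions uniformly in time and gives the dominating function for the limit.\<close>

lemma resolvent_pairing_bound:
  assumes f: "decays f" and \<psi>: "schwartz \<psi>"
  shows "\<bar>LINT x|lborel. f x * \<psi> x\<bar> \<le> (LINT x|lborel. (resolvent f x)\<^sup>2) + (LINT x|lborel. (2 * \<psi> x - deriv \<psi> x)\<^sup>2)"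
proof -
  note d = decays_resolvent(1)[OF f] schwartz_decays[OF \<psi>] schwartz_decays[OF schwartzD(3)[OF \<psi>]] f
  have d2: "decays (\<lambda>x. 2 * \<psi> x - deriv \<psi> x)" by (intro decays_diff decays_cmult d)
  have "(LINT x|lborel. f x * \<psi> x - resolvent f x * (2 * \<psi> x - deriv \<psi> x)) = 0"
  proof (rule integral_deriv_zero_decays)
    show "((\<lambda>x. resolvent f x * \<psi> x) has_real_derivative f x * \<psi> x - resolvent f x * (2 * \<psi> x - deriv \<psi> x)) (at x)" for x
      by (rule DERIV_cong[OF DERIV_mult[OF decays_resolvent(2)[OF f] schwartzD(1)[OF \<psi>]]]) (simp add: algebra_simps)
  qed (intro decays_diff decays_mult d d2)+
  then have "(LINT x|lborel. f x * \<psi> x) = (LINT x|lborel. resolvent f x * (2 * \<psi> x - deriv \<psi> x))"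
    using decays_integrable[OF decays_mult[OF d(4,2)]] decays_integrable[OF decays_mult[OF d(1) d2]]
    by (simp add: Bochner_Integration.integral_diff)
  also have "\<bar>\<dots>\<bar> \<le> (LINT x|lborel. (resolvent f x)\<^sup>2 + (2 * \<psi> x - deriv \<psi> x)\<^sup>2)"
  proof (rule Bochner_Integration.integral_abs_bound_integral)
    show "integrable lborel (\<lambda>x. resolvent f x * (2 * \<psi> x - deriv \<psi> x))" by (intro decays_integrable decays_mult d(1) d2)
    show "integrable lborel (\<lambda>x. (resolvent f x)\<^sup>2 + (2 * \<psi> x - deriv \<psi> x)\<^sup>2)"
      by (intro decays_integrable decays_add decays_power d(1) d2) simp_all
    fix x
    define A B where "A = resolvent f x" and "B = 2 * \<psi> x - deriv \<psi> x"
    have "2 * \<bar>A * B\<bar> \<le> A\<^sup>2 + B\<^sup>2" using zero_le_power2[of "\<bar>A\<bar> - \<bar>B\<bar>"] by (simp add: power2_diff abs_mult)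
    moreover have "0 \<le> \<bar>A * B\<bar>" by simp
    ultimately have "\<bar>A * B\<bar> \<le> A\<^sup>2 + B\<^sup>2" by linarith
    then show "\<bar>resolvent f x * (2 * \<psi> x - deriv \<psi> x)\<bar> \<le> (resolvent f x)\<^sup>2 + (2 * \<psi> x - deriv \<psi> x)\<^sup>2" by (simp add: A_def B_def)
  qed
  also have "\<dots> = (LINT x|lborel. (resolvent f x)\<^sup>2) + (LINT x|lborel. (2 * \<psi> x - deriv \<psi> x)\<^sup>2)"
    by (intro Bochner_Integration.integral_add decays_integrable decays_power d(1) d2) simp_all
  finally show ?thesis .
qed

section \<open>Test functions\<close>

text \<open>Unlike \<open>test_function\<close>, with the support fixed; this class is closed under spatial derivatives, and
  so it can serve in \<open>schwartz_derivI\<close>.\<close>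

definition smooth_supported :: "(real \<times> real) set \<Rightarrow> (real \<times> real \<Rightarrow> real) \<Rightarrow> bool" where
  "smooth_supported S g \<longleftrightarrow> (\<forall>n. times_differentiable n g) \<and> (\<forall>z. z \<notin> S \<longrightarrow> g z = 0)"

definition space_deriv :: "(real \<times> real \<Rightarrow> real) \<Rightarrow> real \<times> real \<Rightarrow> real" where
  "space_deriv g z = frechet_derivative g (at z) (0, 1)"

lemma smooth_supportedD:
  assumes g: "smooth_supported S g"
  shows "continuous_on UNIV g" "g differentiable (at z)" "z \<notin> S \<Longrightarrow> g z = 0"
proof -
  have "times_differentiable 0 g" "times_differentiable (Suc 0) g" using g unfolding smooth_supported_def by blast+
  then show "continuous_on UNIV g" "g differentiable (at z)" unfolding times_differentiable.simps by blast+
  show "z \<notin> S \<Longrightarrow> g z = 0" using g unfolding smooth_supported_def by blast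
qed

lemma smooth_supported_space_deriv:
  assumes g: "smooth_supported S g" and S: "compact S"
  shows "smooth_supported S (space_deriv g)"
proof -
  have "times_differentiable n (space_deriv g)" for n
  proof -
    have "times_differentiable (Suc n) g" using g unfolding smooth_supported_def by blast
    then show ?thesis by (simp add: space_deriv_def[abs_def])
  qed
  moreover have "space_deriv g z = 0" if z: "z \<notin> S" for z
  proof -
    have "open (- S)" using S by (simp add: compact_imp_closed open_Compl)
    have "((\<lambda>_. 0) has_derivative (\<lambda>_. 0 :: real)) (at z)" by simp
    then have "(g has_derivative (\<lambda>_. 0)) (at z)"
      by (rule has_derivative_transform_within_open[OF _ \<open>open (- S)\<close>]) (use z smooth_supportedD(3)[OF g] in auto)
    then have "frechet_derivative g (at z) = (\<lambda>_. 0)" by (metis frechet_derivative_at)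
    then show ?thesis by (simp add: space_deriv_def)
  qed
  ultimately show ?thesis by (simp add: smooth_supported_def)
qed

lemma slice_deriv:
  assumes g: "smooth_supported S g"
  shows "((\<lambda>x. g (t, x)) has_real_derivative space_deriv g (t, x)) (at x)"
proof -
  define g' where "g' = frechet_derivative g (at (t, x))"
  have g': "(g has_derivative g') (at (t, x))"
    unfolding g'_def using smooth_supportedD(2)[OF g] by (simp add: frechet_derivative_works)
  have "((\<lambda>x. (t, x)) has_derivative (\<lambda>h. (0, h))) (at x)"
    by (intro has_derivative_Pair has_derivative_const has_derivative_ident)
  from has_derivative_compose[OF this g'] have d: "((\<lambda>x. g (t, x)) has_derivative (\<lambda>h. g' (0, h))) (at x)" by simp
  have "g' (0, h) = space_deriv g (t, x) * h" for h
  proof -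
    have "linear g'" using g' by (rule has_derivative_linear)
    then have "g' (h *\<^sub>R (0, 1)) = h *\<^sub>R g' (0, 1)" by (rule linear_cmul)
    then show ?thesis by (simp add: space_deriv_def g'_def)
  qed
  then have "(\<lambda>h. g' (0, h)) = (*) (space_deriv g (t, x))" by auto
  then show ?thesis using d by (simp add: has_field_derivative_def)
qed

lemma bounded_compact_support:
  fixes f :: "real \<times> real \<Rightarrow> real"
  assumes c: "continuous_on UNIV f" and S: "compact S" and z: "\<And>z. z \<notin> S \<Longrightarrow> f z = 0"
  obtains B where "0 \<le> B" "\<And>z. \<bar>f z\<bar> \<le> B"
proof -
  have "compact (f ` S)" by (intro compact_continuous_image continuous_on_subset[OF c] S) simp
  from compact_imp_bounded[OF this] obtain B where B: "\<And>z. z \<in> S \<Longrightarrow> \<bar>f z\<bar> \<le> B"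
    unfolding bounded_iff by auto
  have "\<bar>f z\<bar> \<le> \<bar>B\<bar>" for z using B[of z] z[of z] by (cases "z \<in> S") auto
  then show thesis using that[of "\<bar>B\<bar>"] by simp
qed

lemma moment_bounded:
  assumes g: "smooth_supported S g" and S: "compact S"
  obtains B where "0 \<le> B" "\<And>t x. \<bar>x ^ k * g (t, x)\<bar> \<le> B"
proof -
  have "continuous_on UNIV (\<lambda>z. snd z ^ k * g z)" by (intro continuous_intros smooth_supportedD(1)[OF g])
  then obtain B where B: "0 \<le> B" "\<And>z. \<bar>snd z ^ k * g z\<bar> \<le> B"
    by (rule bounded_compact_support[OF _ S]) (use smooth_supportedD(3)[OF g] in auto)
  have "\<bar>x ^ k * g (t, x)\<bar> \<le> B" for t x using B(2)[of "(t, x)"] by simp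
  then show thesis using that B(1) by blast
qed

lemma schwartz_slice:
  assumes g: "smooth_supported S g" and S: "compact S"
  shows "schwartz (\<lambda>x. g (t, x))"
proof (rule schwartz_derivI[of "\<lambda>h. \<exists>g. smooth_supported S g \<and> h = (\<lambda>x. g (t, x))"])
  fix h assume "\<exists>g. smooth_supported S g \<and> h = (\<lambda>x. g (t, x))"
  then obtain g where g: "smooth_supported S g" and h: "h = (\<lambda>x. g (t, x))" by blast
  show "\<exists>f'. (\<exists>g. smooth_supported S g \<and> f' = (\<lambda>x. g (t, x))) \<and> (\<forall>x. (h has_real_derivative f' x) (at x)) \<and> (\<forall>k. bounded (range (\<lambda>x. x ^ k * h x)))"
  proof (rule exI[of _ "\<lambda>x. space_deriv g (t, x)"], intro conjI allI)
    show "\<exists>ga. smooth_supported S ga \<and> (\<lambda>x. space_deriv g (t, x)) = (\<lambda>x. ga (t, x))"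
      using smooth_supported_space_deriv[OF g S] by blast
    show "(h has_real_derivative space_deriv g (t, x)) (at x)" for x unfolding h by (rule slice_deriv[OF g])
    show "bounded (range (\<lambda>x. x ^ k * h x))" for k
    proof -
      obtain B where "\<And>t x. \<bar>x ^ k * g (t, x)\<bar> \<le> B" by (rule moment_bounded[OF g S, of k]) blast
      then show ?thesis unfolding h bounded_iff by auto
    qed
  qed
qed (use g in blast)

lemma slice_om_bound:
  assumes g: "smooth_supported S g" and S: "compact S"
  obtains B where "0 \<le> B" "\<And>t x. \<bar>g (t, x)\<bar> \<le> B * om x"
proof -
  obtain B where B: "0 \<le> B" "\<And>t x. \<bar>x ^ 0 * g (t, x)\<bar> \<le> B" by (rule moment_bounded[OF g S, of 0]) blast
  obtain C where C: "0 \<le> C" "\<And>t x. \<bar>x ^ 2 * g (t, x)\<bar> \<le> C" by (rule moment_bounded[OF g S, of 2]) blast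
  have "\<bar>g (t, x)\<bar> \<le> (4 * B + C) * om x" for t x
    by (rule decaysI(1)[OF schwartz_continuous[OF schwartz_slice[OF g S]]]) (use B C in auto)
  then show thesis using that[of "4 * B + C"] B C by simp
qed

lemma test_functionD:
  assumes "test_function \<Omega> \<psi>"
  obtains S where "compact S" "S \<subseteq> \<Omega>" "smooth_supported S \<psi>"
  using assms unfolding test_function_def smooth_supported_def by blast

lemma slice_integral_bound:
  assumes g: "smooth_supported S g" and S: "compact S"
  obtains B where "\<And>t. (LINT x|lborel. (2 * g (t, x) - space_deriv g (t, x))\<^sup>2) \<le> B"
proof -
  note g' = smooth_supported_space_deriv[OF g S]
  obtain B where B: "0 \<le> B" "\<And>t x. \<bar>g (t, x)\<bar> \<le> B * om x" by (rule slice_om_bound[OF g S]) blast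
  obtain C where C: "0 \<le> C" "\<And>t x. \<bar>space_deriv g (t, x)\<bar> \<le> C * om x" by (rule slice_om_bound[OF g' S]) blast
  define D where "D = (2 * B + C)\<^sup>2 / 4"
  have "(LINT x|lborel. (2 * g (t, x) - space_deriv g (t, x))\<^sup>2) \<le> (LINT x|lborel. D * om x)" for t
  proof (rule integral_mono)
    show "integrable lborel (\<lambda>x. (2 * g (t, x) - space_deriv g (t, x))\<^sup>2)"
      by (intro decays_integrable decays_power decays_diff decays_cmult schwartz_decays schwartz_slice[OF g S] schwartz_slice[OF g' S]) simp
    show "integrable lborel (\<lambda>x. D * om x)" by (simp add: om_integrable)
    have "\<bar>2 * g (t, x) - space_deriv g (t, x)\<bar> \<le> (2 * B + C) * om x" for x
    proof -
      have "(2 * B + C) * om x = 2 * (B * om x) + C * om x" by (simp add: algebra_simps)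
      then show ?thesis using B(2)[of t x] C(2)[of t x] by linarith
    qed
    then show "(2 * g (t, x) - space_deriv g (t, x))\<^sup>2 \<le> D * om x" for x
      unfolding D_def by (rule om_bound_sq)
  qed
  then show thesis by (rule that)
qed

lemma compact_support_sqint:
  fixes \<psi> :: "real \<times> real \<Rightarrow> real"
  assumes c: "continuous_on UNIV \<psi>" and S: "compact S" and z: "\<And>z. z \<notin> S \<Longrightarrow> \<psi> z = 0"
  shows "sqint lborel \<psi>" "integrable lborel \<psi>"
proof -
  have gen: "integrable lborel f" if cf: "continuous_on UNIV f" and zf: "\<And>z. z \<notin> S \<Longrightarrow> f z = 0" for f :: "real \<times> real \<Rightarrow> real"
  proof -
    have "set_integrable lborel S f"
      unfolding set_integrable_def by (rule borel_integrable_compact[OF S continuous_on_subset[OF cf]]) simp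
    moreover have "(\<lambda>z. indicat_real S z *\<^sub>R f z) = f" using zf by (auto simp: indicator_def fun_eq_iff)
    ultimately show ?thesis by (simp add: set_integrable_def)
  qed
  show "integrable lborel \<psi>" by (rule gen[OF c z])
  have "integrable lborel (\<lambda>z. (\<psi> z)\<^sup>2)" by (rule gen) (use c z in \<open>auto intro!: continuous_intros\<close>)
  then show "sqint lborel \<psi>" using borel_measurable_continuous_onI[OF c] by (simp add: sqint_def)
qed

section \<open>The space-time norm of the limit\<close>

lemma shifted_local_smoothing:
  fixes t0 x0 :: real
  assumes u: "kdv_flow_smooth u u1 u2 u3" and init: "(LINT x|lborel. (resolvent (u 0) x)\<^sup>2) \<le> 1/1536"
  defines "F \<equiv> \<lambda>z. indicat_real ({0<..<1} \<times> {0<..<1}) z * u (fst z - t0) (snd z - x0)"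
  shows "sqint lborel F" "(LINT z|lborel. (F z)\<^sup>2) \<le> 1"
proof -
  interpret kdv_flow_smooth u u1 u2 u3 by (rule u)
  have "continuous_on UNIV (\<lambda>z. (\<lambda>(t, x). u t x) (fst z - t0, snd z - x0))"
    by (rule continuous_on_compose2[OF u_continuous]) (auto intro!: continuous_intros)
  then have c: "continuous_on UNIV (\<lambda>z. u (fst z - t0) (snd z - x0))" by simp
  have [measurable]: "(\<lambda>z. u (fst z - t0) (snd z - x0)) \<in> borel_measurable borel"
    by (rule borel_measurable_continuous_onI[OF c])
  have [measurable]: "({0<..<1} \<times> {0<..<1} :: (real \<times> real) set) \<in> sets borel" by (intro borel_open open_Times) auto
  have Fm[measurable]: "F \<in> borel_measurable borel" unfolding F_def by measurable
  have "(\<integral>\<^sup>+z. ennreal ((F z)\<^sup>2) \<partial>lborel) = (\<integral>\<^sup>+z. ennreal ((F z)\<^sup>2) \<partial>(lborel \<Otimes>\<^sub>M lborel))"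
    by (simp add: lborel_prod)
  also have "\<dots> = (\<integral>\<^sup>+t. \<integral>\<^sup>+x. ennreal ((F (t, x))\<^sup>2) \<partial>lborel \<partial>lborel)"
    by (rule lborel.nn_integral_fst[symmetric]) (use Fm in \<open>simp add: lborel_prod\<close>)
  also have "\<dots> \<le> (\<integral>\<^sup>+t. (\<integral>\<^sup>+x. ennreal ((u (t - t0) x)\<^sup>2) * indicator {-x0..-x0+1} x \<partial>lborel) * indicator {-t0..-t0+1} (t - t0) \<partial>lborel)"
  proof (rule nn_integral_mono)
    fix t :: real
    have m: "(\<lambda>x. ennreal ((u (t - t0) x)\<^sup>2) * indicator {-x0..-x0+1} x) \<in> borel_measurable borel"
    proof -
      have "u (t - t0) \<in> borel_measurable borel"
        using decays_u(1) by (intro borel_measurable_continuous_onI) (simp add: decays_def)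
      then show ?thesis by measurable
    qed
    have "(\<integral>\<^sup>+x. ennreal ((F (t, x))\<^sup>2) \<partial>lborel) \<le> (\<integral>\<^sup>+x. (ennreal ((u (t - t0) (-x0 + 1 * x))\<^sup>2) * indicator {-x0..-x0+1} (-x0 + 1 * x)) * indicator {-t0..-t0+1} (t - t0) \<partial>lborel)"
      by (intro nn_integral_mono) (auto simp: F_def indicator_def split: if_splits)
    also have "\<dots> = (\<integral>\<^sup>+x. ennreal ((u (t - t0) (-x0 + 1 * x))\<^sup>2) * indicator {-x0..-x0+1} (-x0 + 1 * x) \<partial>lborel) * indicator {-t0..-t0+1} (t - t0)"
      by (rule nn_integral_multc) (rule measurable_compose[OF _ m[unfolded measurable_lborel2[symmetric]]], simp)
    also have "(\<integral>\<^sup>+x. ennreal ((u (t - t0) (-x0 + 1 * x))\<^sup>2) * indicator {-x0..-x0+1} (-x0 + 1 * x) \<partial>lborel) = (\<integral>\<^sup>+x. ennreal ((u (t - t0) x)\<^sup>2) * indicator {-x0..-x0+1} x \<partial>lborel)"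
      using nn_integral_real_affine[OF m, of 1 "-x0"] by simp
    finally show "(\<integral>\<^sup>+x. ennreal ((F (t, x))\<^sup>2) \<partial>lborel) \<le> (\<integral>\<^sup>+x. ennreal ((u (t - t0) x)\<^sup>2) * indicator {-x0..-x0+1} x \<partial>lborel) * indicator {-t0..-t0+1} (t - t0)" .
  qed
  also have "\<dots> = (\<integral>\<^sup>+t. (\<integral>\<^sup>+x. ennreal ((u t x)\<^sup>2) * indicator {-x0..-x0+1} x \<partial>lborel) * indicator {-t0..-t0+1} t \<partial>lborel)"
  proof -
    have um: "(\<lambda>(t, x). u t x) \<in> borel_measurable (lborel \<Otimes>\<^sub>M lborel)"
      using borel_measurable_continuous_onI[OF u_continuous] by (simp add: lborel_prod)
    have um2: "(\<lambda>z. ennreal ((case z of (t, x) \<Rightarrow> u t x)\<^sup>2) * indicator {-x0..-x0+1} (snd z)) \<in> borel_measurable (lborel \<Otimes>\<^sub>M lborel)"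
      using um by measurable
    have "(\<lambda>t. \<integral>\<^sup>+x. ennreal ((u t x)\<^sup>2) * indicator {-x0..-x0+1} x \<partial>lborel) \<in> borel_measurable lborel"
      using lborel.borel_measurable_nn_integral_fst[OF um2] by simp
    then have "(\<lambda>t. (\<integral>\<^sup>+x. ennreal ((u t x)\<^sup>2) * indicator {-x0..-x0+1} x \<partial>lborel) * indicator {-t0..-t0+1} t) \<in> borel_measurable borel"
      by measurable
    from nn_integral_real_affine[OF this, of 1 "-t0"] show ?thesis by simp
  qed
  also have "\<dots> \<le> 1" by (rule local_smoothing) (use init in \<open>simp add: \<eta>_def\<close>)
  finally have b: "(\<integral>\<^sup>+z. ennreal ((F z)\<^sup>2) \<partial>lborel) \<le> 1" .
  have i: "integrable lborel (\<lambda>z. (F z)\<^sup>2)"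
    by (rule integrableI_bounded) (use b Fm in \<open>auto intro: le_less_trans\<close>)
  then show "sqint lborel F" using Fm by (simp add: sqint_def)
  have "ennreal (LINT z|lborel. (F z)\<^sup>2) \<le> ennreal 1" using b nn_integral_eq_integral[OF i] by simp
  then show "(LINT z|lborel. (F z)\<^sup>2) \<le> 1" by simp
qed

lemma classical_pairing:
  fixes t0 x0 :: real
  assumes u: "kdv_flow_smooth u u1 u2 u3" and \<psi>: "smooth_supported S \<psi>" and S: "compact S" "S \<subseteq> {0<..<1} \<times> {0<..<1}"
  defines "F \<equiv> \<lambda>z. indicat_real ({0<..<1} \<times> {0<..<1}) z * u (fst z - t0) (snd z - x0)"
  defines "p \<equiv> \<lambda>t. LINT x|lborel. u (t - t0) x * \<psi> (t, x + x0)"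
  shows "p \<in> borel_measurable lborel" "(LINT t|lborel. p t) = (LINT z|lborel. F z * \<psi> z)"
proof -
  interpret kdv_flow_smooth u u1 u2 u3 by (rule u)
  have "continuous_on UNIV (\<lambda>z. (\<lambda>(t, x). u t x) (fst z - t0, snd z - x0))"
    by (rule continuous_on_compose2[OF u_continuous]) (auto intro!: continuous_intros)
  then have c: "continuous_on UNIV (\<lambda>z. u (fst z - t0) (snd z - x0) * \<psi> z)"
    using smooth_supportedD(1)[OF \<psi>] by (intro continuous_intros) simp
  have i: "integrable lborel (\<lambda>z. u (fst z - t0) (snd z - x0) * \<psi> z)"
    by (rule compact_support_sqint(2)[OF c S(1)]) (use smooth_supportedD(3)[OF \<psi>] in simp)
  then have i2: "integrable (lborel \<Otimes>\<^sub>M lborel) (\<lambda>(t, x). u (t - t0) (x - x0) * \<psi> (t, x))"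
    by (simp add: lborel_prod split_beta')
  have shift: "p t = (LINT x|lborel. u (t - t0) (x - x0) * \<psi> (t, x))" for t
    unfolding p_def using lborel_integral_real_affine[of 1 "\<lambda>x. u (t - t0) (x - x0) * \<psi> (t, x)" x0]
    by (simp add: add.commute)
  have m: "(\<lambda>(t, x). u (t - t0) (x - x0) * \<psi> (t, x)) \<in> borel_measurable (lborel \<Otimes>\<^sub>M lborel)"
    using i2 by (rule borel_measurable_integrable)
  show "p \<in> borel_measurable lborel" unfolding shift[abs_def]
    by (rule lborel.borel_measurable_lebesgue_integral[OF m])
  have "(LINT t|lborel. p t) = (LINT t|lborel. LINT x|lborel. u (t - t0) (x - x0) * \<psi> (t, x))" by (simp add: shift)
  also have "\<dots> = (LINT z|(lborel \<Otimes>\<^sub>M lborel). (case z of (t, x) \<Rightarrow> u (t - t0) (x - x0) * \<psi> (t, x)))"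
    by (rule lborel_pair.integral_fst[OF i2])
  also have "\<dots> = (LINT z|lborel. u (fst z - t0) (snd z - x0) * \<psi> z)" by (simp add: lborel_prod split_beta')
  also have "\<dots> = (LINT z|lborel. F z * \<psi> z)"
  proof (intro Bochner_Integration.integral_cong refl)
    fix z show "u (fst z - t0) (snd z - x0) * \<psi> z = F z * \<psi> z"
      using smooth_supportedD(3)[OF \<psi>, of z] S(2) by (cases "z \<in> S") (auto simp: F_def indicator_def)
  qed
  finally show "(LINT t|lborel. p t) = (LINT z|lborel. F z * \<psi> z)" .
qed

text \<open>The integral bounded by \<open>B\<close> is invariant under translations, so one constant serves all \<open>x0\<close>.\<close>

lemma classical_pairing_bound:
  assumes u: "kdv_flow_smooth u u1 u2 u3" and init: "(LINT x|lborel. (resolvent (u 0) x)\<^sup>2) \<le> 1/1536"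
    and \<psi>: "smooth_supported S \<psi>" and S: "compact S" "S \<subseteq> {0<..<1} \<times> {0<..<1}"
    and B: "\<And>t. (LINT x|lborel. (2 * \<psi> (t, x) - space_deriv \<psi> (t, x))\<^sup>2) \<le> B"
  shows "\<bar>LINT x|lborel. u (t - t0) x * \<psi> (t, x + x0)\<bar> \<le> (1 + B) * indicat_real {0..1} t"
proof (cases "t \<in> {0<..<1}")
  case False
  then have "(t, x) \<notin> S" for x using S(2) by auto
  then have "\<psi> (t, x) = 0" for x by (rule smooth_supportedD(3)[OF \<psi>])
  moreover have "0 \<le> 1 + B"
  proof -
    have "0 \<le> (LINT x|lborel. (2 * \<psi> (0, x) - space_deriv \<psi> (0, x))\<^sup>2)" by simp
    then show ?thesis using B[of 0] by linarith
  qed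
  ultimately show ?thesis by simp
next
  case True
  interpret kdv_flow_smooth u u1 u2 u3 by (rule u)
  note s = schwartz_shift[OF schwartz_slice[OF \<psi> S(1)], of t x0]
  have d: "deriv (\<lambda>x. \<psi> (t, x + x0)) x = space_deriv \<psi> (t, x + x0)" for x
    using slice_deriv[OF \<psi>, of t "x + x0"] by (intro DERIV_imp_deriv) (simp add: DERIV_shift)
  have "\<bar>LINT x|lborel. u (t - t0) x * \<psi> (t, x + x0)\<bar>
     \<le> \<eta> (t - t0) + (LINT x|lborel. (2 * \<psi> (t, x + x0) - space_deriv \<psi> (t, x + x0))\<^sup>2)"
    using resolvent_pairing_bound[OF decays_u(1) s] unfolding d \<eta>_def .
  also have "(LINT x|lborel. (2 * \<psi> (t, x + x0) - space_deriv \<psi> (t, x + x0))\<^sup>2) = (LINT x|lborel. (2 * \<psi> (t, x) - space_deriv \<psi> (t, x))\<^sup>2)"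
    using lborel_integral_real_affine[of 1 "\<lambda>x. (2 * \<psi> (t, x) - space_deriv \<psi> (t, x))\<^sup>2" x0] by (simp add: add.commute)
  also have "\<eta> (t - t0) + \<dots> \<le> 1 + B"
    using B[of t] global_bound(1)[of "t - t0"] init by (simp add: \<eta>_def)
  finally show ?thesis using True by simp
qed

theorem lemma7p1:
  "\<exists>C>0::real. \<exists>\<delta>>0::real. \<forall>q. KdV_solution q \<and> Hm1_norm (q 0) \<le> \<delta> \<longrightarrow>
     (SUP (t0, x0)\<in>(UNIV :: (real \<times> real) set).
        spacetime_L2_sq ({0<..<1} \<times> {0<..<1}) (\<lambda>t. translate x0 (q (t - t0))))
     \<le> ennreal (C * \<delta>\<^sup>2)"
  (* With these constants C \<delta>^2 = 1, which is the bound of shifted_local_smoothing; and \<delta> is so small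
     that 2 \<delta>^2 plus the approximation error stays below 1/1536. *)
proof (rule exI[of _ 10000], rule conjI, simp, rule exI[of _ "1/100"], rule conjI, simp, intro allI impI)
  fix q assume "KdV_solution q \<and> Hm1_norm (q 0) \<le> 1/100"
  then obtain \<Phi> where q0: "q 0 \<in> Hm1" and flow: "KdV_flow \<Phi>" and q: "\<And>t. q t = \<Phi> t (q 0)" and small: "Hm1_norm (q 0) \<le> 1/100"
    unfolding KdV_solution_def by blast
  have N0: "0 \<le> Hm1_norm (q 0)" unfolding Hm1_norm_def by (intro real_sqrt_ge_zero Bochner_Integration.integral_nonneg) simp
  have "\<forall>n. \<exists>h. schwartz h \<and> Hm1_norm (\<lambda>\<phi>. distribution_of (\<lambda>x. deriv h x + 2 * h x) \<phi> - q 0 \<phi>) < 1 / 10000 / real (Suc n) \<and>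
    (LINT x|lborel. (h x)\<^sup>2) \<le> 2 * (Hm1_norm (q 0))\<^sup>2 + 1 / 10000 / real (Suc n)"
    by (intro allI Hm1_density[OF q0]) simp
  from choice[OF this] obtain h where h: "\<And>n. schwartz (h n)" and
    close: "\<And>n. Hm1_norm (\<lambda>\<phi>. distribution_of (\<lambda>x. deriv (h n) x + 2 * h n x) \<phi> - q 0 \<phi>) < 1 / 10000 / real (Suc n)" and
    hb: "\<And>n. (LINT x|lborel. (h n x)\<^sup>2) \<le> 2 * (Hm1_norm (q 0))\<^sup>2 + 1 / 10000 / real (Suc n)" by blast
  define f where "f n = (\<lambda>x. deriv (h n) x + 2 * h n x)" for n
  have fs: "schwartz (f n)" for n unfolding f_def by (intro schwartz_add schwartz_cmult schwartzD h)
  have hsmall: "(LINT x|lborel. (h n x)\<^sup>2) \<le> 1/1536" for n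
  proof -
    have "(Hm1_norm (q 0))\<^sup>2 \<le> (1/100)\<^sup>2" using small N0 by (intro power_mono)
    moreover have "1 / 10000 / real (Suc n) \<le> 1 / 10000" by (simp add: divide_le_eq)
    moreover have "(1/100)\<^sup>2 = (1/10000 :: real)" by (simp add: power2_eq_square)
    ultimately show ?thesis using hb[of n] by argo
  qed
  have classical: "\<exists>u. schwartz_KdV_solution u \<and> u 0 = f \<and> (\<forall>t. \<Phi> t (distribution_of f) = distribution_of (u t))"
    if "schwartz f" for f
    using flow[unfolded KdV_flow_def, THEN conjunct2, THEN conjunct2, THEN spec, of f] that by (rule mp)
  have "\<forall>n. \<exists>u. schwartz_KdV_solution u \<and> u 0 = f n \<and> (\<forall>t. \<Phi> t (distribution_of (f n)) = distribution_of (u t))"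
    by (intro allI classical fs)
  from choice[OF this] obtain u where
    U: "\<forall>n. schwartz_KdV_solution (u n) \<and> u n 0 = f n \<and> (\<forall>t. \<Phi> t (distribution_of (f n)) = distribution_of (u n t))" ..
  have u: "schwartz_KdV_solution (u n)" for n using U[THEN spec, of n, THEN conjunct1] .
  have u0: "u n 0 = f n" for n using U[THEN spec, of n, THEN conjunct2, THEN conjunct1] .
  have u_flow: "\<Phi> t (distribution_of (f n)) = distribution_of (u n t)" for n t
    using U[THEN spec, of n, THEN conjunct2, THEN conjunct2, THEN spec, of t] .
  note us = schwartz_KdV_solution_smooth[OF u]
  have init: "(LINT x|lborel. (resolvent (u n 0) x)\<^sup>2) \<le> 1/1536" for n
    unfolding u0 f_def resolvent_inverse[OF h] by (rule hsmall)
  have uS: "schwartz (u n t)" for n t using u[of n] by (simp add: schwartz_KdV_solution_def)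
  have clim: "(\<lambda>n. Hm1_norm (\<lambda>\<phi>. distribution_of (u n t) \<phi> - q t \<phi>)) \<longlonglongrightarrow> 0" for t
  proof (rule LIMSEQ_I)
    fix e :: real assume e: "0 < e"
    obtain d where d: "0 < d" "\<And>s g. g \<in> Hm1 \<Longrightarrow> \<bar>s - t\<bar> < d \<Longrightarrow> Hm1_norm (\<lambda>\<phi>. g \<phi> - q 0 \<phi>) < d \<Longrightarrow> Hm1_norm (\<lambda>\<phi>. \<Phi> s g \<phi> - \<Phi> t (q 0) \<phi>) < e"
      using flow q0 e unfolding KdV_flow_def by meson
    obtain N where N: "1 / d < real (Suc N)" using reals_Archimedean2 less_trans by (metis of_nat_less_iff lessI)
    show "\<exists>N. \<forall>n\<ge>N. norm (Hm1_norm (\<lambda>\<phi>. distribution_of (u n t) \<phi> - q t \<phi>) - 0) < e"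
    proof (intro exI[of _ N] allI impI)
      fix n assume n: "N \<le> n"
      have "1 / 10000 / real (Suc n) \<le> 1 / real (Suc n)" by (intro divide_right_mono) auto
      also have "\<dots> \<le> 1 / real (Suc N)" using n by (intro divide_left_mono) auto
      also have "\<dots> < d" using N d(1) by (simp add: field_simps)
      finally have "Hm1_norm (\<lambda>\<phi>. distribution_of (f n) \<phi> - q 0 \<phi>) < d" using close[of n] by (simp add: f_def)
      from d(2)[OF distribution_of_in_Hm1[OF fs] _ this, of t] d(1)
      have "Hm1_norm (\<lambda>\<phi>. distribution_of (u n t) \<phi> - q t \<phi>) < e"
        unfolding u_flow q[symmetric] by simp
      moreover have "0 \<le> Hm1_norm (\<lambda>\<phi>. distribution_of (u n t) \<phi> - q t \<phi>)"
        unfolding Hm1_norm_def by (intro real_sqrt_ge_zero Bochner_Integration.integral_nonneg) simp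
      ultimately show "norm (Hm1_norm (\<lambda>\<phi>. distribution_of (u n t) \<phi> - q t \<phi>) - 0) < e" by simp
    qed
  qed
  have qH: "q t \<in> Hm1" for t using flow q0 unfolding KdV_flow_def q[of t] by blast
  have plim: "(\<lambda>n. LINT x|lborel. u n t x * \<phi> x) \<longlonglongrightarrow> q t \<phi>" if \<phi>: "schwartz \<phi>" for t \<phi>
  proof -
    obtain C where C: "\<And>T T'. T \<in> Hm1 \<Longrightarrow> T' \<in> Hm1 \<Longrightarrow> \<bar>T \<phi> - T' \<phi>\<bar> \<le> C * Hm1_norm (\<lambda>\<phi>. T \<phi> - T' \<phi>)"
      using Hm1_pairing_bound[OF \<phi>] by blast
    have "(\<lambda>n. distribution_of (u n t) \<phi> - q t \<phi>) \<longlonglongrightarrow> 0"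
    proof (rule tendsto_0_le[OF tendsto_mult_right_zero[OF clim[of t], of C], of _ 1], intro always_eventually allI)
      fix n
      show "norm (distribution_of (u n t) \<phi> - q t \<phi>) \<le> norm (C * Hm1_norm (\<lambda>\<phi>. distribution_of (u n t) \<phi> - q t \<phi>)) * 1"
        using order_trans[OF C[OF distribution_of_in_Hm1[OF uS] qH] abs_ge_self] by simp
    qed
    then have "(\<lambda>n. distribution_of (u n t) \<phi>) \<longlonglongrightarrow> q t \<phi>" by (simp add: LIM_zero_iff)
    then show ?thesis using \<phi> by (simp add: distribution_of_def)
  qed
  have main: "spacetime_L2_sq ({0<..<1} \<times> {0<..<1}) (\<lambda>t. translate x0 (q (t - t0))) \<le> 1" for t0 x0
  proof -
    let ?\<Omega> = "{0<..<1} \<times> {0<..<1} :: (real \<times> real) set"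
    define Q where "Q t = translate x0 (q (t - t0))" for t
    define F where "F n z = indicat_real ?\<Omega> z * u n (fst z - t0) (snd z - x0)" for n z
    have F: "sqint lborel (F n)" "(LINT z|lborel. (F n z)\<^sup>2) \<le> 1" for n
      unfolding F_def by (rule shifted_local_smoothing[OF us init])+
    have "\<exists>f. sqint lborel f \<and> (LINT z|lborel. (f z)\<^sup>2) \<le> 1 \<and> (\<forall>\<psi>\<in>Collect (test_function ?\<Omega>). (LINT z|lborel. f z * \<psi> z) = spacetime_pairing Q \<psi>)"
    proof (rule weak_limit_L2[OF lborel.sigma_finite_measure_axioms F])
      fix \<psi> assume "\<psi> \<in> Collect (test_function ?\<Omega>)"
      then obtain S where S: "compact S" "S \<subseteq> ?\<Omega>" and \<psi>: "smooth_supported S \<psi>" by (auto elim: test_functionD)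
      show "sqint lborel \<psi>"
        by (rule compact_support_sqint(1)[OF smooth_supportedD(1)[OF \<psi>] S(1) smooth_supportedD(3)[OF \<psi>]])
      obtain B where B: "\<And>t. (LINT x|lborel. (2 * \<psi> (t, x) - space_deriv \<psi> (t, x))\<^sup>2) \<le> B"
        by (rule slice_integral_bound[OF \<psi> S(1)]) blast
      define p where "p n t = (LINT x|lborel. u n (t - t0) x * \<psi> (t, x + x0))" for n t
      have pm: "p n \<in> borel_measurable lborel" and pI: "(LINT t|lborel. p n t) = (LINT z|lborel. F n z * \<psi> z)" for n
        unfolding p_def[abs_def] F_def by (rule classical_pairing[OF us \<psi> S])+
      have pl: "(\<lambda>n. p n t) \<longlonglongrightarrow> Q t (\<lambda>x. \<psi> (t, x))" for t
        unfolding p_def Q_def translate_def by (rule plim[OF schwartz_shift[OF schwartz_slice[OF \<psi> S(1)]]])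
      have "(\<lambda>n. LINT t|lborel. p n t) \<longlonglongrightarrow> (LINT t|lborel. Q t (\<lambda>x. \<psi> (t, x)))"
      proof (rule Bochner_Integration.integral_dominated_convergence)
        show "(\<lambda>t. Q t (\<lambda>x. \<psi> (t, x))) \<in> borel_measurable lborel"
          by (rule borel_measurable_LIMSEQ_real[OF pl pm])
        show "p n \<in> borel_measurable lborel" for n by (rule pm)
        have "integrable lborel (indicat_real {0..1::real})" by (rule integrable_real_indicator) auto
        then show "integrable lborel (\<lambda>t. (1 + B) * indicat_real {0..1::real} t)"
          by (intro integrable_mult_right)
        show "AE t in lborel. (\<lambda>n. p n t) \<longlonglongrightarrow> Q t (\<lambda>x. \<psi> (t, x))" using pl by simp
        show "AE t in lborel. norm (p n t) \<le> (1 + B) * indicat_real {0..1} t" for n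
          unfolding p_def real_norm_def by (intro AE_I2 classical_pairing_bound[OF us init \<psi> S B])
      qed
      then show "(\<lambda>n. LINT z|lborel. F n z * \<psi> z) \<longlonglongrightarrow> spacetime_pairing Q \<psi>"
        by (simp add: pI spacetime_pairing_def)
    qed
    then obtain G where G: "sqint lborel G" "(LINT z|lborel. (G z)\<^sup>2) \<le> 1"
      and Gp: "\<And>\<psi>. test_function ?\<Omega> \<psi> \<Longrightarrow> (LINT z|lborel. G z * \<psi> z) = spacetime_pairing Q \<psi>" by auto
    have \<Omega>: "?\<Omega> \<in> sets lborel" by (simp add: borel_open open_Times)
    have "is_L2_function_on ?\<Omega> Q G"
      unfolding is_L2_function_on_def
    proof (intro conjI allI impI)
      show "G \<in> borel_measurable borel" using G(1) by (simp add: sqint_def)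
      show "set_integrable lborel ?\<Omega> (\<lambda>z. (G z)\<^sup>2)"
        unfolding set_integrable_def by (rule integrable_mult_indicator[OF \<Omega>]) (use G(1) in \<open>simp add: sqint_def\<close>)
      fix \<psi> assume \<psi>: "test_function ?\<Omega> \<psi>"
      then obtain S where S: "compact S" "S \<subseteq> ?\<Omega>" "smooth_supported S \<psi>" by (rule test_functionD)
      have "(\<lambda>z. indicat_real ?\<Omega> z *\<^sub>R (G z * \<psi> z)) = (\<lambda>z. G z * \<psi> z)"
      proof
        fix z show "indicat_real ?\<Omega> z *\<^sub>R (G z * \<psi> z) = G z * \<psi> z"
          using smooth_supportedD(3)[OF S(3), of z] S(2) by (cases "z \<in> S") (auto simp: indicator_def)
      qed
      then show "spacetime_pairing Q \<psi> = (LINT z:?\<Omega>|lborel. G z * \<psi> z)"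
        unfolding set_lebesgue_integral_def using Gp[OF \<psi>] by simp
    qed
    then have "spacetime_L2_sq ?\<Omega> Q \<le> (\<integral>\<^sup>+z\<in>?\<Omega>. ennreal ((G z)\<^sup>2) \<partial>lborel)"
      unfolding spacetime_L2_sq_def by (intro INF_lower) simp
    also have "\<dots> \<le> (\<integral>\<^sup>+z. ennreal ((G z)\<^sup>2) \<partial>lborel)"
      by (intro nn_integral_mono) (auto simp: indicator_def)
    also have "\<dots> = ennreal (LINT z|lborel. (G z)\<^sup>2)"
      by (rule nn_integral_eq_integral) (use G(1) in \<open>auto simp: sqint_def\<close>)
    also have "\<dots> \<le> ennreal 1" using G(2) by (rule ennreal_leI)
    finally show ?thesis by (simp add: Q_def[abs_def])
  qed
  have "10000 * (1/100)\<^sup>2 = (1::real)" by (simp add: power2_eq_square)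
  then have "ennreal (10000 * (1/100)\<^sup>2) = 1" by simp
  then show "(SUP (t0, x0)\<in>(UNIV :: (real \<times> real) set).
        spacetime_L2_sq ({0<..<1} \<times> {0<..<1}) (\<lambda>t. translate x0 (q (t - t0))))
     \<le> ennreal (10000 * (1/100)\<^sup>2)"
    using main by (auto intro!: SUP_least)
qed

end
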